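(* Let $(X,\mu)$ and $(Y,\nu)$ be standard $\sigma$-finite measure spaces. The set $\mathfrak{S}_{\mathrm{cl}}(X,Y)$ of all closable multipliers is a subalgebra of the algebra $\mathfrak{B}(X\times Y)$ of all measurable complex-valued functions on $X\times Y$ (with pointwise operations).
   Context: Write $H_1=L^2(X,\mu)$, $H_2=L^2(Y,\nu)$; for $k\in L^2(X\times Y,\mu\times\nu)$ let $I_k:H_1\to H_2$ be the Hilbert–Schmidt operator $(I_k\xi)(y)=\int_X k(x,y)\xi(x)\,d\mu(x)$. For measurable $\varphi:X\times Y\to\mathbb{C}$ let $D(\varphi)=\{k\in L^2(X\times Y):\varphi k\in L^2(X\times Y)\}$ and let $S_\varphi$ be the densely defined operator on the space $\mathcal{K}(H_1,H_2)$ of compact operators (with the operator norm) with domain $\{I_k:k\in D(\varphi)\}$ given by $S_\varphi(I_k)=I_{\varphi k}$. The function $\varphi$ is a closable multiplier if $S_\varphi$ is closable, i.e. the norm closure of its graph in $\mathcal{K}(H_1,H_2)\oplus\mathcal{K}(H_1,H_2)$ is the graph of an operator. *)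

theory Defs
  imports "HOL-Analysis.Analysis"
begin

text \<open>A standard measure space is a measure on the Borel sets of some Polish topology;
  only the \<open>\<sigma>\<close>-algebra is part of the data, the topology is not.\<close>

definition standard_sigma_finite :: "'a measure \<Rightarrow> bool" where
  "standard_sigma_finite M \<longleftrightarrow> sigma_finite_measure M \<and>
     (\<exists>T. topspace T = space M \<and> completely_metrizable_space T \<and> second_countable T \<and>
          sets M = sigma_sets (space M) {U. openin T U})"


section \<open>Complex normed spaces on explicit carriers\<close>

text \<open>The spaces below depend on measures, hence they cannot be types of class
  \<open>real_normed_vector\<close>.\<close>

record 'v cnormed =
  vecs :: "'v set"
  vadd :: "'v \<Rightarrow> 'v \<Rightarrow> 'v"
  vscale :: "complex \<Rightarrow> 'v \<Rightarrow> 'v"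
  vnorm :: "'v \<Rightarrow> real"

text \<open>The locale \<open>Metric_space\<close> demands symmetry and nonnegativity of the distance also outside
  the carrier; hence the default value 0 there.\<close>

definition vdist :: "'v cnormed \<Rightarrow> 'v \<Rightarrow> 'v \<Rightarrow> real" where
  "vdist E u v = (if u \<in> vecs E \<and> v \<in> vecs E then vnorm E (vadd E u (vscale E (-1) v)) else 0)"

definition norm_topology :: "'v cnormed \<Rightarrow> 'v topology" where
  "norm_topology E = Metric_space.mtopology (vecs E) (vdist E)"

definition linear_subspace :: "'v cnormed \<Rightarrow> 'v set \<Rightarrow> bool" where
  "linear_subspace E D \<longleftrightarrow> D \<subseteq> vecs E \<and> D \<noteq> {} \<and>
     (\<forall>u\<in>D. \<forall>v\<in>D. vadd E u v \<in> D) \<and> (\<forall>c. \<forall>u\<in>D. vscale E c u \<in> D)"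

definition linear_on :: "'u cnormed \<Rightarrow> 'v cnormed \<Rightarrow> 'u set \<Rightarrow> ('u \<Rightarrow> 'v) \<Rightarrow> bool" where
  "linear_on E F D T \<longleftrightarrow> linear_subspace E D \<and> T ` D \<subseteq> vecs F \<and>
     (\<forall>u\<in>D. \<forall>v\<in>D. T (vadd E u v) = vadd F (T u) (T v)) \<and>
     (\<forall>c. \<forall>u\<in>D. T (vscale E c u) = vscale F c (T u))"

definition compact_operators :: "'u cnormed \<Rightarrow> 'v cnormed \<Rightarrow> ('u \<Rightarrow> 'v) set" where
  "compact_operators E F = {T \<in> extensional (vecs E). linear_on E F (vecs E) T \<and>
     compactin (norm_topology F)
       (norm_topology F closure_of (T ` {u \<in> vecs E. vnorm E u \<le> 1}))}"

definition operator_norm :: "'u cnormed \<Rightarrow> 'v cnormed \<Rightarrow> ('u \<Rightarrow> 'v) \<Rightarrow> real" where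
  "operator_norm E F T = Sup {vnorm F (T u) | u. u \<in> vecs E \<and> vnorm E u \<le> 1}"

definition compact_operator_space :: "'u cnormed \<Rightarrow> 'v cnormed \<Rightarrow> ('u \<Rightarrow> 'v) cnormed" where
  "compact_operator_space E F = \<lparr>
     vecs = compact_operators E F,
     vadd = (\<lambda>S T. \<lambda>u\<in>vecs E. vadd F (S u) (T u)),
     vscale = (\<lambda>c T. \<lambda>u\<in>vecs E. vscale F c (T u)),
     vnorm = operator_norm E F\<rparr>"

text \<open>Possibly unbounded operators \<open>E \<rightarrow> F\<close> with domain a linear subspace \<open>D\<close> of \<open>E\<close>:\<close>

definition is_operator_graph :: "'u cnormed \<Rightarrow> 'v cnormed \<Rightarrow> ('u \<times> 'v) set \<Rightarrow> bool" where
  "is_operator_graph E F G \<longleftrightarrow> (\<exists>D T. linear_on E F D T \<and> G = (\<lambda>u. (u, T u)) ` D)"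

definition closable_graph :: "'u cnormed \<Rightarrow> 'v cnormed \<Rightarrow> ('u \<times> 'v) set \<Rightarrow> bool" where
  "closable_graph E F G \<longleftrightarrow>
     is_operator_graph E F (prod_topology (norm_topology E) (norm_topology F) closure_of G)"


section \<open>The spaces \<open>L\<^sup>2\<close>\<close>

definition square_integrable :: "'a measure \<Rightarrow> ('a \<Rightarrow> complex) set" where
  "square_integrable M = {f \<in> borel_measurable M. integrable M (\<lambda>x. (cmod (f x))\<^sup>2)}"

definition ae_eq :: "'a measure \<Rightarrow> (('a \<Rightarrow> complex) \<times> ('a \<Rightarrow> complex)) set" where
  "ae_eq M = {(f, g). f \<in> square_integrable M \<and> g \<in> square_integrable M \<and> (AE x in M. f x = g x)}"

definition L2_class :: "'a measure \<Rightarrow> ('a \<Rightarrow> complex) \<Rightarrow> ('a \<Rightarrow> complex) set" where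
  "L2_class M f = ae_eq M `` {f}"

definition rep :: "('a \<Rightarrow> complex) set \<Rightarrow> 'a \<Rightarrow> complex" where
  "rep \<xi> = (SOME f. f \<in> \<xi>)"

definition L2 :: "'a measure \<Rightarrow> ('a \<Rightarrow> complex) set cnormed" where
  "L2 M = \<lparr>
     vecs = square_integrable M // ae_eq M,
     vadd = (\<lambda>\<xi> \<eta>. L2_class M (\<lambda>x. rep \<xi> x + rep \<eta> x)),
     vscale = (\<lambda>c \<xi>. L2_class M (\<lambda>x. c * rep \<xi> x)),
     vnorm = (\<lambda>\<xi>. sqrt (\<integral>x. (cmod (rep \<xi> x))\<^sup>2 \<partial>M))\<rparr>"


section \<open>Closable multipliers\<close>

text \<open>Kernels are square-integrable functions rather than classes; the operator depends only on
  the class of the kernel.\<close>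

definition HS_operator ::
  "'a measure \<Rightarrow> 'b measure \<Rightarrow> ('a \<times> 'b \<Rightarrow> complex) \<Rightarrow> ('a \<Rightarrow> complex) set \<Rightarrow> ('b \<Rightarrow> complex) set"
  where "HS_operator M N k =
    (\<lambda>\<xi>\<in>vecs (L2 M). L2_class N (\<lambda>y. \<integral>x. k (x, y) * rep \<xi> x \<partial>M))"

definition multiplier_kernels ::
  "'a measure \<Rightarrow> 'b measure \<Rightarrow> ('a \<times> 'b \<Rightarrow> complex) \<Rightarrow> ('a \<times> 'b \<Rightarrow> complex) set" where
  "multiplier_kernels M N \<phi> = {k \<in> square_integrable (M \<Otimes>\<^sub>M N).
     (\<lambda>z. \<phi> z * k z) \<in> square_integrable (M \<Otimes>\<^sub>M N)}"

definition multiplier_graph ::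
  "'a measure \<Rightarrow> 'b measure \<Rightarrow> ('a \<times> 'b \<Rightarrow> complex) \<Rightarrow>
    ((('a \<Rightarrow> complex) set \<Rightarrow> ('b \<Rightarrow> complex) set) \<times>
     (('a \<Rightarrow> complex) set \<Rightarrow> ('b \<Rightarrow> complex) set)) set" where
  "multiplier_graph M N \<phi> =
     (\<lambda>k. (HS_operator M N k, HS_operator M N (\<lambda>z. \<phi> z * k z))) ` multiplier_kernels M N \<phi>"

definition measurable_functions :: "'a measure \<Rightarrow> 'b measure \<Rightarrow> ('a \<times> 'b \<Rightarrow> complex) set" where
  "measurable_functions M N = borel_measurable (M \<Otimes>\<^sub>M N)"

definition closable_multipliers :: "'a measure \<Rightarrow> 'b measure \<Rightarrow> ('a \<times> 'b \<Rightarrow> complex) set" where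
  "closable_multipliers M N = {\<phi> \<in> measurable_functions M N.
     closable_graph (compact_operator_space (L2 M) (L2 N)) (compact_operator_space (L2 M) (L2 N))
       (multiplier_graph M N \<phi>)}"

definition pointwise_algebra :: "('z \<Rightarrow> complex) set \<Rightarrow> bool" where
  "pointwise_algebra A \<longleftrightarrow> (\<lambda>_. 0) \<in> A \<and>
     (\<forall>f\<in>A. \<forall>g\<in>A. (\<lambda>z. f z + g z) \<in> A \<and> (\<lambda>z. f z * g z) \<in> A) \<and>
     (\<forall>c. \<forall>f\<in>A. (\<lambda>z. c * f z) \<in> A)"

definition pointwise_subalgebra :: "('z \<Rightarrow> complex) set \<Rightarrow> ('z \<Rightarrow> complex) set \<Rightarrow> bool" where
  "pointwise_subalgebra A B \<longleftrightarrow> pointwise_algebra A \<and> pointwise_algebra B \<and> A \<subseteq> B"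

end

theory Submission
  imports Defs
begin

text \<open>
  Why sums and products of closable multipliers are closable. Write \<open>p(k)\<close> for the operator norm of
  the Hilbert-Schmidt operator \<open>I\<^sub>k\<close> (\<open>kernel_norm\<close> below). Since the compact operators are complete,
  \<open>\<phi>\<close> is closable iff \<open>p(k\<^sub>n) \<rightarrow> 0\<close> implies \<open>p(\<phi> k\<^sub>n) \<rightarrow> 0\<close> whenever \<open>(\<phi> k\<^sub>n)\<close> is a Cauchy sequence
  for \<open>p\<close> (\<open>closable_multipliers_iff\<close>).

  Call \<open>\<sigma>\<close> a Schur multiplier if it is bounded and \<open>p(\<sigma> k) \<le> c p(k)\<close> for all \<open>k\<close>. The central fact
  (\<open>tendsto_0_of_multipliers\<close>) is that a closable \<open>\<phi>\<close> has many Schur multipliers \<open>\<sigma>\<close> for which \<open>\<phi> \<sigma>\<close>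
  is a Schur multiplier too: a Cauchy sequence \<open>(r\<^sub>n)\<close> tends to 0 as soon as \<open>p(\<sigma> r\<^sub>n) \<rightarrow> 0\<close> for every
  such \<open>\<sigma>\<close>. Granted this, let \<open>p(k\<^sub>n) \<rightarrow> 0\<close> and let \<open>r\<^sub>n = (\<phi>\<^sub>1 + \<phi>\<^sub>2) k\<^sub>n\<close> be Cauchy. Then
  \<open>\<sigma> r\<^sub>n = \<phi>\<^sub>2 (\<sigma> k\<^sub>n) + (\<phi>\<^sub>1 \<sigma>) k\<^sub>n\<close>, where \<open>\<sigma> k\<^sub>n\<close> and \<open>(\<phi>\<^sub>1 \<sigma>) k\<^sub>n\<close> tend to 0; so \<open>\<phi>\<^sub>2 (\<sigma> k\<^sub>n)\<close> is
  Cauchy, tends to 0 because \<open>\<phi>\<^sub>2\<close> is closable, and \<open>p(\<sigma> r\<^sub>n) \<rightarrow> 0\<close>. For \<open>r\<^sub>n = \<phi>\<^sub>1 \<phi>\<^sub>2 k\<^sub>n\<close> the identity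
  \<open>\<sigma> r\<^sub>n = \<phi>\<^sub>2 ((\<phi>\<^sub>1 \<sigma>) k\<^sub>n)\<close> does the same.

  The multipliers come from a separation argument. If \<open>(r\<^sub>n)\<close> does not tend to 0, closability keeps
  the pair \<open>(0, t)\<close>, for some \<open>t = r\<^sub>N\<close>, at a distance \<open>\<epsilon>\<close> from the graph of \<open>k \<mapsto> \<phi> k\<close>. A functional that
  separates them is a trace class kernel \<open>\<psi>\<close> for which \<open>\<theta> = \<phi> \<psi>\<close> is trace class as well. Instead of
  the duality of compact and trace class operators, the proof uses a convex set of
  pairs \<open>(\<psi>, \<theta>)\<close> with integrable bounds \<open>a(x), b(y)\<close> (\<open>dominated\<close>; for \<open>\<psi> = \<Sum>\<^sub>i u\<^sub>i \<otimes> v\<^sub>i\<close> these are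
  \<open>\<Sum>\<^sub>i |u\<^sub>i|\<^sup>2\<close> and \<open>\<Sum>\<^sub>i |v\<^sub>i|\<^sup>2\<close>). Minimising a penalty for \<open>\<phi> \<psi> \<noteq> \<theta>\<close> minus \<open>Re \<integral> t \<psi>\<close> over it,
  the first order condition exhibits a kernel \<open>k\<close> in the domain of \<open>\<phi>\<close>, and the distance \<open>\<epsilon>\<close>
  forces \<open>Re \<integral> t \<psi> \<ge> \<epsilon> / 2\<close> with small penalty (\<open>separating_pair\<close>). Near-minimisers of a strictly
  convex functional on the pairs with ever smaller penalty converge almost everywhere, together with
  the functions \<open>exp (- a / 2)\<close> and \<open>exp (- b / 2)\<close>; so the bounds \<open>a, b\<close> stay bounded almost
  everywhere (\<open>separating_sequence\<close>). Where they are at most \<open>m\<close>, the limit of \<open>\<psi>\<close> is a Schur multiplier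
  with constant \<open>m\<close>, and so is its product with \<open>\<phi>\<close> (\<open>separating_multiplier\<close>).
\<close>


section \<open>Square-integrable functions\<close>

definition norm2 :: "'a measure \<Rightarrow> ('a \<Rightarrow> complex) \<Rightarrow> real" where
  "norm2 M f = sqrt (\<integral>x. (cmod (f x))\<^sup>2 \<partial>M)"

lemma sqint_measurable [measurable_dest]:
  "f \<in> square_integrable M \<Longrightarrow> f \<in> borel_measurable M"
  by (simp add: square_integrable_def)

lemma sqint_integrable_square:
  "f \<in> square_integrable M \<Longrightarrow> integrable M (\<lambda>x. (cmod (f x))\<^sup>2)"
  by (simp add: square_integrable_def)

lemma norm2_nonneg [simp]: "0 \<le> norm2 M f"
  by (simp add: norm2_def)

lemma norm2_square: "(norm2 M f)\<^sup>2 = (\<integral>x. (cmod (f x))\<^sup>2 \<partial>M)"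
  by (simp add: norm2_def)

lemma sqint_bounded_by:
  assumes g: "g \<in> square_integrable M" and f [measurable]: "f \<in> borel_measurable M"
    and le: "AE x in M. cmod (f x) \<le> c * cmod (g x)"
  shows "f \<in> square_integrable M"
proof -
  have "integrable M (\<lambda>x. (cmod (f x))\<^sup>2)"
  proof (rule Bochner_Integration.integrable_bound)
    show "integrable M (\<lambda>x. c\<^sup>2 * (cmod (g x))\<^sup>2)"
      using sqint_integrable_square[OF g] by simp
    show "AE x in M. norm ((cmod (f x))\<^sup>2) \<le> norm (c\<^sup>2 * (cmod (g x))\<^sup>2)"
      using le
    proof eventually_elim
      case (elim x)
      have "(cmod (f x))\<^sup>2 \<le> (c * cmod (g x))\<^sup>2"
        by (intro power_mono elim) auto
      then show ?case by (simp add: power_mult_distrib)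
    qed
  qed simp
  then show ?thesis by (simp add: square_integrable_def)
qed

lemma norm2_mono:
  assumes g: "g \<in> square_integrable M" and f: "f \<in> borel_measurable M" and "0 \<le> c"
    and le: "AE x in M. cmod (f x) \<le> c * cmod (g x)"
  shows "norm2 M f \<le> c * norm2 M g"
proof -
  have f': "f \<in> square_integrable M" by (rule sqint_bounded_by[OF g f le])
  have "(norm2 M f)\<^sup>2 \<le> (\<integral>x. c\<^sup>2 * (cmod (g x))\<^sup>2 \<partial>M)"
    unfolding norm2_square
  proof (rule integral_mono_AE)
    show "AE x in M. (cmod (f x))\<^sup>2 \<le> c\<^sup>2 * (cmod (g x))\<^sup>2"
      using le
    proof eventually_elim
      case (elim x)
      have "(cmod (f x))\<^sup>2 \<le> (c * cmod (g x))\<^sup>2"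
        by (intro power_mono elim) auto
      then show ?case by (simp add: power_mult_distrib)
    qed
  qed (use sqint_integrable_square[OF g] sqint_integrable_square[OF f'] in auto)
  also have "\<dots> = (c * norm2 M g)\<^sup>2"
    by (simp add: norm2_square power_mult_distrib)
  finally show ?thesis
    using \<open>0 \<le> c\<close> by (simp add: power2_le_iff_abs_le)
qed

lemma sqint_AE_cong:
  assumes "f \<in> square_integrable M" "g \<in> borel_measurable M" "AE x in M. f x = g x"
  shows "g \<in> square_integrable M"
proof (rule sqint_bounded_by[OF assms(1,2)])
  show "AE x in M. cmod (g x) \<le> 1 * cmod (f x)" using assms(3) by eventually_elim simp
qed

lemma norm2_AE_cong:
  assumes "f \<in> borel_measurable M" "g \<in> borel_measurable M" "AE x in M. f x = g x"
  shows "norm2 M f = norm2 M g"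
  unfolding norm2_def using assms
  by (intro arg_cong[where f = sqrt] integral_cong_AE) (auto elim: eventually_mono)

lemma norm2_eq_0_iff:
  assumes "f \<in> square_integrable M"
  shows "norm2 M f = 0 \<longleftrightarrow> (AE x in M. f x = 0)"
  unfolding norm2_def
  by (simp add: integral_nonneg_eq_0_iff_AE sqint_integrable_square[OF assms])

lemma sqint_zero [simp]: "(\<lambda>_. 0) \<in> square_integrable M"
  by (simp add: square_integrable_def)

lemma norm2_zero [simp]: "norm2 M (\<lambda>_. 0) = 0"
  by (simp add: norm2_def)

lemma sqint_scale [simp]:
  "f \<in> square_integrable M \<Longrightarrow> (\<lambda>x. c * f x) \<in> square_integrable M"
  by (rule sqint_bounded_by[where g = f and c = "cmod c"]) (auto simp: norm_mult)

lemma norm2_scale: "norm2 M (\<lambda>x. c * f x) = cmod c * norm2 M f"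
  by (simp add: norm2_def norm_mult power_mult_distrib real_sqrt_mult)

lemma borel_measurable_cnj [measurable]:
  "f \<in> borel_measurable M \<Longrightarrow> (\<lambda>x. cnj (f x)) \<in> borel_measurable M"
  by (rule borel_measurable_continuous_on[where f = cnj]) (auto intro: continuous_intros)

lemma sqint_cnj [simp]:
  "f \<in> square_integrable M \<Longrightarrow> (\<lambda>x. cnj (f x)) \<in> square_integrable M"
  by (rule sqint_bounded_by[where g = f and c = 1]) auto

lemma norm2_cnj [simp]: "norm2 M (\<lambda>x. cnj (f x)) = norm2 M f"
  by (simp add: norm2_def)

lemma sqint_add [simp]:
  assumes f: "f \<in> square_integrable M" and g: "g \<in> square_integrable M"
  shows "(\<lambda>x. f x + g x) \<in> square_integrable M"
proof -
  note [measurable] = sqint_measurable[OF f] sqint_measurable[OF g]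
  have "integrable M (\<lambda>x. (cmod (f x + g x))\<^sup>2)"
  proof (rule Bochner_Integration.integrable_bound)
    show "integrable M (\<lambda>x. 2 * (cmod (f x))\<^sup>2 + 2 * (cmod (g x))\<^sup>2)"
      using sqint_integrable_square[OF f] sqint_integrable_square[OF g] by simp
    show "AE x in M. norm ((cmod (f x + g x))\<^sup>2) \<le> norm (2 * (cmod (f x))\<^sup>2 + 2 * (cmod (g x))\<^sup>2)"
    proof (rule AE_I2)
      fix x
      have "(cmod (f x + g x))\<^sup>2 \<le> (cmod (f x) + cmod (g x))\<^sup>2"
        by (intro power_mono norm_triangle_ineq) auto
      also have "\<dots> \<le> 2 * (cmod (f x))\<^sup>2 + 2 * (cmod (g x))\<^sup>2"
        using zero_le_power2[of "cmod (f x) - cmod (g x)"] by (simp add: power2_eq_square algebra_simps)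
      finally show "norm ((cmod (f x + g x))\<^sup>2) \<le> norm (2 * (cmod (f x))\<^sup>2 + 2 * (cmod (g x))\<^sup>2)"
        by simp
    qed
  qed simp
  then show ?thesis by (simp add: square_integrable_def)
qed

lemma sqint_diff [simp]:
  assumes "f \<in> square_integrable M" "g \<in> square_integrable M"
  shows "(\<lambda>x. f x - g x) \<in> square_integrable M"
  using sqint_add[OF assms(1) sqint_scale[OF assms(2), of "-1"]] by simp

lemma sqint_integrable_mult_cmod:
  assumes f: "f \<in> square_integrable M" and g: "g \<in> square_integrable M"
  shows "integrable M (\<lambda>x. cmod (f x) * cmod (g x))"
proof (rule Bochner_Integration.integrable_bound)
  note [measurable] = sqint_measurable[OF f] sqint_measurable[OF g]
  show "(\<lambda>x. cmod (f x) * cmod (g x)) \<in> borel_measurable M" by measurable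
  show "integrable M (\<lambda>x. (cmod (f x))\<^sup>2 + (cmod (g x))\<^sup>2)"
    using sqint_integrable_square[OF f] sqint_integrable_square[OF g] by simp
  show "AE x in M. norm (cmod (f x) * cmod (g x)) \<le> norm ((cmod (f x))\<^sup>2 + (cmod (g x))\<^sup>2)"
  proof (rule AE_I2)
    fix x
    have "2 * (cmod (f x) * cmod (g x)) \<le> (cmod (f x))\<^sup>2 + (cmod (g x))\<^sup>2"
      using sum_squares_bound[of "cmod (f x)" "cmod (g x)"] by simp
    moreover have "0 \<le> cmod (f x) * cmod (g x)" by simp
    ultimately have "cmod (f x) * cmod (g x) \<le> (cmod (f x))\<^sup>2 + (cmod (g x))\<^sup>2" by linarith
    then show "norm (cmod (f x) * cmod (g x)) \<le> norm ((cmod (f x))\<^sup>2 + (cmod (g x))\<^sup>2)"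
      by simp
  qed
qed

lemma sqint_integrable_mult:
  assumes f: "f \<in> square_integrable M" and g: "g \<in> square_integrable M"
  shows "integrable M (\<lambda>x. f x * g x)"
proof (rule Bochner_Integration.integrable_bound[OF sqint_integrable_mult_cmod[OF f g]])
  note [measurable] = sqint_measurable[OF f] sqint_measurable[OF g]
  show "(\<lambda>x. f x * g x) \<in> borel_measurable M" by measurable
qed (simp add: norm_mult)

text \<open>The pointwise inequality \<open>2 |f g| \<le> s |f|\<^sup>2 + |g|\<^sup>2 / s\<close>, integrated, is sharp when \<open>s\<close> is the ratio
  of the two norms.\<close>

lemma Cauchy_Schwarz_cmod:
  assumes f: "f \<in> square_integrable M" and g: "g \<in> square_integrable M"
  shows "(\<integral>x. cmod (f x) * cmod (g x) \<partial>M) \<le> norm2 M f * norm2 M g"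
proof (cases "norm2 M f = 0 \<or> norm2 M g = 0")
  case True
  then have "AE x in M. cmod (f x) * cmod (g x) = 0"
    using norm2_eq_0_iff[OF f] norm2_eq_0_iff[OF g] by (auto elim: eventually_mono)
  then have "(\<integral>x. cmod (f x) * cmod (g x) \<partial>M) = 0"
    by (rule integral_eq_zero_AE)
  then show ?thesis by simp
next
  case False
  define s where "s = norm2 M g / norm2 M f"
  have pos: "norm2 M f > 0" "norm2 M g > 0" "s > 0"
    using False norm2_nonneg[of M f] norm2_nonneg[of M g] by (auto simp: s_def less_le)
  have "(\<integral>x. cmod (f x) * cmod (g x) \<partial>M)
    \<le> (\<integral>x. s / 2 * (cmod (f x))\<^sup>2 + 1 / (2 * s) * (cmod (g x))\<^sup>2 \<partial>M)"
  proof (rule integral_mono)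
    show "integrable M (\<lambda>x. s / 2 * (cmod (f x))\<^sup>2 + 1 / (2 * s) * (cmod (g x))\<^sup>2)"
      using sqint_integrable_square[OF f] sqint_integrable_square[OF g] by simp
    show "cmod (f x) * cmod (g x) \<le> s / 2 * (cmod (f x))\<^sup>2 + 1 / (2 * s) * (cmod (g x))\<^sup>2" for x
    proof -
      have "0 \<le> (s * cmod (f x) - cmod (g x))\<^sup>2 / (2 * s)" using pos by simp
      also have "\<dots> = s / 2 * (cmod (f x))\<^sup>2 + 1 / (2 * s) * (cmod (g x))\<^sup>2 - cmod (f x) * cmod (g x)"
        using pos by (simp add: field_simps power2_eq_square)
      finally show ?thesis by simp
    qed
  qed (rule sqint_integrable_mult_cmod[OF f g])
  also have "\<dots> = s / 2 * (norm2 M f)\<^sup>2 + 1 / (2 * s) * (norm2 M g)\<^sup>2"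
    using sqint_integrable_square[OF f] sqint_integrable_square[OF g] by (simp add: norm2_square)
  also have "\<dots> = norm2 M f * norm2 M g"
    using pos by (simp add: s_def field_simps power2_eq_square)
  finally show ?thesis .
qed

lemma Cauchy_Schwarz_L2:
  assumes f: "f \<in> square_integrable M" and g: "g \<in> square_integrable M"
  shows "cmod (\<integral>x. f x * g x \<partial>M) \<le> norm2 M f * norm2 M g"
proof -
  have "cmod (\<integral>x. f x * g x \<partial>M) \<le> (\<integral>x. cmod (f x * g x) \<partial>M)"
    by (rule integral_norm_bound)
  also have "\<dots> \<le> norm2 M f * norm2 M g"
    using Cauchy_Schwarz_cmod[OF f g] by (simp add: norm_mult)
  finally show ?thesis .
qed

lemma norm2_triangle:
  assumes f: "f \<in> square_integrable M" and g: "g \<in> square_integrable M"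
  shows "norm2 M (\<lambda>x. f x + g x) \<le> norm2 M f + norm2 M g"
proof -
  note fg = sqint_integrable_mult_cmod[OF f g]
  have "(norm2 M (\<lambda>x. f x + g x))\<^sup>2 \<le>
     (\<integral>x. (cmod (f x))\<^sup>2 + (cmod (g x))\<^sup>2 + 2 * (cmod (f x) * cmod (g x)) \<partial>M)"
    unfolding norm2_square
  proof (rule integral_mono)
    fix x
    have "(cmod (f x + g x))\<^sup>2 \<le> (cmod (f x) + cmod (g x))\<^sup>2"
      by (intro power_mono norm_triangle_ineq) auto
    then show "(cmod (f x + g x))\<^sup>2 \<le> (cmod (f x))\<^sup>2 + (cmod (g x))\<^sup>2 + 2 * (cmod (f x) * cmod (g x))"
      by (simp add: power2_eq_square algebra_simps)
  qed (use fg sqint_integrable_square[OF f] sqint_integrable_square[OF g]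
      sqint_integrable_square[OF sqint_add[OF f g]] in auto)
  also have "\<dots> = (norm2 M f)\<^sup>2 + (norm2 M g)\<^sup>2 + 2 * (\<integral>x. cmod (f x) * cmod (g x) \<partial>M)"
    using fg sqint_integrable_square[OF f] sqint_integrable_square[OF g] by (simp add: norm2_square)
  also have "\<dots> \<le> (norm2 M f + norm2 M g)\<^sup>2"
    using Cauchy_Schwarz_cmod[OF f g] by (simp add: power2_eq_square algebra_simps)
  finally show ?thesis
    by (simp add: power2_le_iff_abs_le)
qed

lemma norm2_triangle_diff:
  assumes "f \<in> square_integrable M" "g \<in> square_integrable M"
  shows "norm2 M (\<lambda>x. f x - g x) \<le> norm2 M f + norm2 M g"
  using norm2_triangle[OF assms(1) sqint_scale[OF assms(2), of "-1"]] norm2_scale[of M "-1" g]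
  by simp

lemma norm2_dominated_convergence:
  assumes [measurable]: "\<And>i. f i \<in> borel_measurable M" "h \<in> borel_measurable M"
    and g: "g \<in> square_integrable M"
    and lim: "AE x in M. (\<lambda>i. f i x) \<longlonglongrightarrow> h x"
    and le: "\<And>i. AE x in M. cmod (f i x - h x) \<le> c * cmod (g x)"
  shows "(\<lambda>i. norm2 M (\<lambda>x. f i x - h x)) \<longlonglongrightarrow> 0"
proof -
  have "(\<lambda>i. \<integral>x. (cmod (f i x - h x))\<^sup>2 \<partial>M) \<longlonglongrightarrow> (\<integral>x. 0 \<partial>M)"
  proof (rule integral_dominated_convergence)
    show "integrable M (\<lambda>x. c\<^sup>2 * (cmod (g x))\<^sup>2)"
      using sqint_integrable_square[OF g] by simp
    show "AE x in M. (\<lambda>i. (cmod (f i x - h x))\<^sup>2) \<longlonglongrightarrow> 0"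
      using lim
    proof eventually_elim
      case (elim x)
      then have "(\<lambda>i. f i x - h x) \<longlonglongrightarrow> 0" by (simp add: LIM_zero_iff)
      then have "(\<lambda>i. (cmod (f i x - h x))\<^sup>2) \<longlonglongrightarrow> (cmod 0)\<^sup>2" by (intro tendsto_intros)
      then show ?case by simp
    qed
    show "AE x in M. norm ((cmod (f i x - h x))\<^sup>2) \<le> c\<^sup>2 * (cmod (g x))\<^sup>2" for i
      using le[of i]
    proof eventually_elim
      case (elim x)
      have "(cmod (f i x - h x))\<^sup>2 \<le> (c * cmod (g x))\<^sup>2"
        by (intro power_mono elim) auto
      then show ?case by (simp add: power_mult_distrib)
    qed
  qed auto
  then have "(\<lambda>i. sqrt (\<integral>x. (cmod (f i x - h x))\<^sup>2 \<partial>M)) \<longlonglongrightarrow> sqrt (\<integral>x. 0 \<partial>M)"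
    by (intro tendsto_intros)
  then show ?thesis by (simp add: norm2_def)
qed

text \<open>The form of Fatou's lemma that is used for \<open>L\<^sup>2\<close> bounds: they survive almost everywhere
  convergence.\<close>

lemma Fatou_integral_bound:
  fixes f :: "nat \<Rightarrow> 'a \<Rightarrow> real"
  assumes int: "\<And>n. integrable M (f n)" and nonneg: "\<And>n x. 0 \<le> f n x"
    and bound: "\<And>n. integral\<^sup>L M (f n) \<le> C"
    and h [measurable]: "h \<in> borel_measurable M"
    and lim: "AE x in M. (\<lambda>n. f n x) \<longlonglongrightarrow> h x"
  shows "integrable M h" and "integral\<^sup>L M h \<le> C"
proof -
  have [measurable]: "\<And>n. f n \<in> borel_measurable M" using int by auto
  have C: "0 \<le> C" using bound[of 0] Bochner_Integration.integral_nonneg[of M "f 0"] nonneg by (meson order_trans)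
  have h0: "AE x in M. 0 \<le> h x"
    using lim by eventually_elim (auto intro: LIMSEQ_le_const nonneg)
  have "(\<integral>\<^sup>+x. ennreal (h x) \<partial>M) = (\<integral>\<^sup>+x. liminf (\<lambda>n. ennreal (f n x)) \<partial>M)"
  proof (rule nn_integral_cong_AE)
    show "AE x in M. ennreal (h x) = liminf (\<lambda>n. ennreal (f n x))"
      using lim
    proof eventually_elim
      case (elim x)
      then have "(\<lambda>n. ennreal (f n x)) \<longlonglongrightarrow> ennreal (h x)" by (rule tendsto_ennrealI)
      then show ?case using lim_imp_Liminf[of sequentially] by (metis sequentially_bot)
    qed
  qed
  also have "\<dots> \<le> liminf (\<lambda>n. \<integral>\<^sup>+x. ennreal (f n x) \<partial>M)"
    by (rule nn_integral_liminf) auto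
  also have "\<dots> \<le> liminf (\<lambda>n. ennreal C)"
  proof (rule Liminf_mono, rule eventuallyI)
    fix n show "(\<integral>\<^sup>+x. ennreal (f n x) \<partial>M) \<le> ennreal C"
      using nn_integral_eq_integral[OF int[of n]] nonneg bound[of n] by (simp add: ennreal_leI)
  qed
  also have "\<dots> = ennreal C" by (simp add: Liminf_const)
  finally have le: "(\<integral>\<^sup>+x. ennreal (h x) \<partial>M) \<le> ennreal C" .
  show i: "integrable M h"
    by (rule integrableI_nonneg[OF h h0]) (use le in \<open>simp add: le_less_trans\<close>)
  have "ennreal (integral\<^sup>L M h) \<le> ennreal C"
    using nn_integral_eq_integral[OF i h0] le by simp
  then show "integral\<^sup>L M h \<le> C"
    using C by (simp add: ennreal_le_iff)
qed

lemma sqint_AE_limit: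
  assumes f: "\<And>n. f n \<in> square_integrable M" and b: "\<And>n. norm2 M (f n) \<le> C"
    and h [measurable]: "h \<in> borel_measurable M"
    and lim: "AE x in M. (\<lambda>n. f n x) \<longlonglongrightarrow> h x"
  shows "h \<in> square_integrable M" and "norm2 M h \<le> C"
proof -
  have C: "0 \<le> C" using b[of 0] norm2_nonneg order_trans by blast
  have *: "(\<integral>x. (cmod (f n x))\<^sup>2 \<partial>M) \<le> C\<^sup>2" for n
    using power_mono[OF b norm2_nonneg, of n 2] by (simp add: norm2_square)
  have l: "AE x in M. (\<lambda>n. (cmod (f n x))\<^sup>2) \<longlonglongrightarrow> (cmod (h x))\<^sup>2"
    using lim by eventually_elim (intro tendsto_intros)
  have m: "(\<lambda>x. (cmod (h x))\<^sup>2) \<in> borel_measurable M" by measurable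
  note F = Fatou_integral_bound[of M "\<lambda>n x. (cmod (f n x))\<^sup>2", OF sqint_integrable_square[OF f] _ * m l]
  show "h \<in> square_integrable M" using F(1) h by (simp add: square_integrable_def)
  have "(norm2 M h)\<^sup>2 \<le> C\<^sup>2" using F(2) by (simp add: norm2_square)
  then show "norm2 M h \<le> C" using C by (simp add: power2_le_iff_abs_le)
qed

text \<open>Square distances that decay like \<open>8\<^sup>-\<^sup>n\<close> give \<open>\<Sum>n. 2\<^sup>n |f (n + 1) - f n|\<^sup>2 < \<infinity>\<close> almost
  everywhere, so that the increments are at most a multiple of \<open>2\<^sup>-\<^sup>n\<^sup>/\<^sup>2\<close>.\<close>

lemma AE_convergent_of_fast_Cauchy:
  fixes f :: "nat \<Rightarrow> 'a \<Rightarrow> 'b :: {banach, second_countable_topology}"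
  assumes [measurable]: "\<And>n. f n \<in> borel_measurable M"
    and int: "\<And>n. integrable M (\<lambda>x. (norm (f (Suc n) x - f n x))\<^sup>2)"
    and le: "\<And>n. (\<integral>x. (norm (f (Suc n) x - f n x))\<^sup>2 \<partial>M) \<le> C / 8 ^ n"
  shows "AE x in M. convergent (\<lambda>n. f n x)"
proof -
  define g where "g n x = 2 ^ n * (norm (f (Suc n) x - f n x))\<^sup>2" for n x
  have [measurable]: "\<And>n. g n \<in> borel_measurable M" unfolding g_def by measurable
  have g0: "0 \<le> g n x" for n x by (simp add: g_def)
  have gi: "integrable M (g n)" for n unfolding g_def using int[of n] by simp
  have C: "0 \<le> C" using order_trans[OF _ le[of 0], of 0] by simp
  have gle: "integral\<^sup>L M (g n) \<le> C * (1/4) ^ n" for n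
  proof -
    have "integral\<^sup>L M (g n) = 2 ^ n * (\<integral>x. (norm (f (Suc n) x - f n x))\<^sup>2 \<partial>M)"
      unfolding g_def by simp
    also have "\<dots> \<le> 2 ^ n * (C / 8 ^ n)" by (intro mult_left_mono le) simp
    also have "\<dots> = C * (1/4) ^ n"
    proof -
      have "(8::real) ^ n = 2 ^ n * 4 ^ n" by (simp flip: power_mult_distrib)
      then show ?thesis by (simp add: field_simps power_one_over)
    qed
    finally show ?thesis .
  qed
  have "(\<integral>\<^sup>+x. (\<Sum>n. ennreal (g n x)) \<partial>M) = (\<Sum>n. \<integral>\<^sup>+x. ennreal (g n x) \<partial>M)"
    by (rule nn_integral_suminf) simp
  also have "\<dots> \<le> (\<Sum>n. ennreal (C * (1/4) ^ n))"
  proof (rule suminf_le)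
    show "(\<integral>\<^sup>+x. ennreal (g n x) \<partial>M) \<le> ennreal (C * (1/4) ^ n)" for n
      using nn_integral_eq_integral[OF gi[of n]] g0 gle[of n] by (simp add: ennreal_leI)
  qed auto
  also have "\<dots> = ennreal (\<Sum>n. C * (1/4) ^ n)"
    using C by (intro suminf_ennreal2) (auto intro!: summable_mult summable_geometric)
  finally have fin: "(\<integral>\<^sup>+x. (\<Sum>n. ennreal (g n x)) \<partial>M) \<noteq> \<infinity>"
    by (auto simp: top_unique)
  have "AE x in M. (\<Sum>n. ennreal (g n x)) \<noteq> \<infinity>"
    by (rule nn_integral_noteq_infinite) (use fin in auto)
  then show ?thesis
  proof eventually_elim
    case (elim x)
    have "summable (\<lambda>n. g n x)"
      using elim g0 by (intro summable_suminf_not_top) auto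
    then have "(\<lambda>n. g n x) \<longlonglongrightarrow> 0" by (rule summable_LIMSEQ_zero)
    then have "Bseq (\<lambda>n. g n x)" using convergent_imp_Bseq convergentI by blast
    then obtain K where K: "K > 0" "\<And>n. norm (g n x) \<le> K" by (auto elim: BseqE)
    define r :: real where "r = 1 / sqrt 2"
    have r: "0 < r" "r < 1" "r\<^sup>2 = 1/2" by (auto simp: r_def power_divide)
    have inc: "norm (f (Suc n) x - f n x) \<le> sqrt K * r ^ n" for n
    proof -
      have "(norm (f (Suc n) x - f n x))\<^sup>2 = g n x * (1/2) ^ n"
        by (simp add: g_def field_simps power_one_over)
      also have "\<dots> \<le> K * (1/2) ^ n"
        using K(2)[of n] g0[of n x] by (intro mult_right_mono) auto
      also have "\<dots> = (sqrt K * r ^ n)\<^sup>2"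
      proof -
        have "(r ^ n)\<^sup>2 = (r\<^sup>2) ^ n" by (simp flip: power_mult add: mult.commute)
        then show ?thesis using K(1) by (simp add: r(3) power_mult_distrib)
      qed
      finally show ?thesis
        using K(1) r(1) by (simp add: power2_le_iff_abs_le)
    qed
    have "summable (\<lambda>n. f (Suc n) x - f n x)"
    proof (rule summable_comparison_test')
      show "summable (\<lambda>n. sqrt K * r ^ n)"
        using r by (intro summable_mult summable_geometric) auto
      show "norm (f (Suc n) x - f n x) \<le> sqrt K * r ^ n" for n by (rule inc)
    qed
    then have "convergent (\<lambda>n. f n x - f 0 x)"
      by (simp add: summable_iff_convergent sum_lessThan_telescope[where f = "\<lambda>n. f n x"])
    then show ?case by (simp add: convergent_diff_const_right_iff)
  qed
qed

lemma fast_subsequence: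
  fixes d :: "nat \<Rightarrow> nat \<Rightarrow> real"
  assumes "\<And>e. e > 0 \<Longrightarrow> \<exists>N. \<forall>m\<ge>N. \<forall>n\<ge>N. d m n < e"
    and "\<And>j. 0 < e j"
  obtains r :: "nat \<Rightarrow> nat" where "strict_mono r" "\<And>j m n. r j \<le> m \<Longrightarrow> r j \<le> n \<Longrightarrow> d m n < e j"
proof -
  have "\<forall>j. \<exists>N. \<forall>m\<ge>N. \<forall>n\<ge>N. d m n < e j" using assms by blast
  then obtain N where N: "\<And>j m n. N j \<le> m \<Longrightarrow> N j \<le> n \<Longrightarrow> d m n < e j"
    by metis
  define r where "r j = (\<Sum>i\<le>j. Suc (N i))" for j
  have "strict_mono r" by (rule strict_mono_Suc_iff[THEN iffD2]) (simp add: r_def)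
  moreover have "N j \<le> r j" for j
    unfolding r_def using member_le_sum[of j "{..j}" "\<lambda>i. Suc (N i)"] by simp
  ultimately show ?thesis using N that by (meson order_trans)
qed

text \<open>A fast subsequence converges almost everywhere, and by Fatou's lemma its limit satisfies the same
  Cauchy estimates as the members of the sequence.\<close>

theorem Riesz_Fischer:
  assumes f: "\<And>n. f n \<in> square_integrable M"
    and Cau: "\<And>e. e > 0 \<Longrightarrow> \<exists>N. \<forall>m\<ge>N. \<forall>n\<ge>N. norm2 M (\<lambda>x. f m x - f n x) < e"
  obtains h where "h \<in> square_integrable M" "(\<lambda>n. norm2 M (\<lambda>x. f n x - h x)) \<longlonglongrightarrow> 0"
proof -
  note [measurable] = sqint_measurable[OF f]
  obtain r :: "nat \<Rightarrow> nat" where r: "strict_mono r"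
    and rd: "\<And>j m n. r j \<le> m \<Longrightarrow> r j \<le> n \<Longrightarrow> norm2 M (\<lambda>x. f m x - f n x) < sqrt (1 / 8 ^ j)"
    using fast_subsequence[OF Cau, of "\<lambda>j. sqrt (1 / 8 ^ j)"] by auto
  have "AE x in M. convergent (\<lambda>j. f (r j) x)"
  proof (rule AE_convergent_of_fast_Cauchy[where C = 1])
    show "integrable M (\<lambda>x. (norm (f (r (Suc n)) x - f (r n) x))\<^sup>2)" for n
      using sqint_integrable_square[OF sqint_diff[OF f f]] .
    fix n
    have "norm2 M (\<lambda>x. f (r (Suc n)) x - f (r n) x) \<le> sqrt (1 / 8 ^ n)"
      using rd[of n "r (Suc n)" "r n"] strict_mono_less_eq[OF r] by simp
    then show "(\<integral>x. (norm (f (r (Suc n)) x - f (r n) x))\<^sup>2 \<partial>M) \<le> 1 / 8 ^ n"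
      unfolding norm2_def by simp
  qed auto
  then have lim: "AE x in M. (\<lambda>j. f (r j) x) \<longlonglongrightarrow> lim (\<lambda>j. f (r j) x)"
    by eventually_elim (simp add: convergent_LIMSEQ_iff)
  define h where "h x = lim (\<lambda>j. f (r j) x)" for x
  have [measurable]: "h \<in> borel_measurable M" unfolding h_def by measurable
  have key: "(\<lambda>x. f n x - h x) \<in> square_integrable M \<and> norm2 M (\<lambda>x. f n x - h x) \<le> sqrt (1 / 8 ^ i)"
    if "r i \<le> n" for n i
  proof -
    have l: "AE x in M. (\<lambda>j. f n x - f (r (i + j)) x) \<longlonglongrightarrow> f n x - h x"
      using lim
    proof eventually_elim
      case (elim x)
      have "(\<lambda>j. f (r (j + i)) x) \<longlonglongrightarrow> h x"
        unfolding h_def using elim by (rule LIMSEQ_ignore_initial_segment)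
      then show ?case by (auto intro!: tendsto_intros simp: add.commute)
    qed
    have "norm2 M (\<lambda>x. f n x - f (r (i + j)) x) \<le> sqrt (1 / 8 ^ i)" for j
      using rd[of i n "r (i + j)"] that strict_mono_less_eq[OF r, of i "i + j"] by simp
    from sqint_AE_limit[OF sqint_diff[OF f f] this _ l] show ?thesis by simp
  qed
  have "h \<in> square_integrable M"
    using sqint_diff[OF f[of "r 0"] key[THEN conjunct1, of 0 "r 0"]] by simp
  moreover have "(\<lambda>n. norm2 M (\<lambda>x. f n x - h x)) \<longlonglongrightarrow> 0"
  proof (rule LIMSEQ_I)
    fix e :: real assume e: "e > 0"
    have "(\<lambda>i. sqrt ((1 / 8) ^ i)) \<longlonglongrightarrow> sqrt 0"
      by (intro tendsto_intros LIMSEQ_realpow_zero) auto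
    then have "eventually (\<lambda>i. sqrt ((1 / 8) ^ i) < e) sequentially"
      using e by (auto dest: order_tendstoD(2))
    then obtain i where i: "sqrt (1 / 8 ^ i) < e"
      by (auto simp: eventually_sequentially power_one_over)
    have "norm (norm2 M (\<lambda>x. f n x - h x) - 0) < e" if "n \<ge> r i" for n
      using key[OF that] i by auto
    then show "\<exists>no. \<forall>n\<ge>no. norm (norm2 M (\<lambda>x. f n x - h x) - 0) < e" by blast
  qed
  ultimately show ?thesis using that by blast
qed

section \<open>Complex normed spaces and their compact operators\<close>

lemma tendsto_0_of_less_inverse_Suc:
  fixes f :: "nat \<Rightarrow> real"
  assumes "\<And>n. 0 \<le> f n" "\<And>n. f n < 1 / real (Suc n)"
  shows "f \<longlonglongrightarrow> 0"
proof (rule real_tendsto_sandwich[OF _ _ tendsto_const LIMSEQ_inverse_real_of_nat])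
  show "\<forall>\<^sub>F n in sequentially. f n \<le> inverse (real (Suc n))"
    using assms(2) by (intro always_eventually allI less_imp_le) (simp add: inverse_eq_divide)
qed (use assms in simp)

text \<open>The zero vector is not a component of the record; \<open>0 \<cdot> v\<close> takes its place in the axioms.\<close>

locale normed_carrier =
  fixes E :: "'v cnormed"
  assumes nonempty: "vecs E \<noteq> {}"
    and add_closed [simp]: "u \<in> vecs E \<Longrightarrow> v \<in> vecs E \<Longrightarrow> vadd E u v \<in> vecs E"
    and scale_closed [simp]: "u \<in> vecs E \<Longrightarrow> vscale E c u \<in> vecs E"
    and add_assoc: "u \<in> vecs E \<Longrightarrow> v \<in> vecs E \<Longrightarrow> w \<in> vecs E \<Longrightarrow>
      vadd E (vadd E u v) w = vadd E u (vadd E v w)"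
    and add_commute: "u \<in> vecs E \<Longrightarrow> v \<in> vecs E \<Longrightarrow> vadd E u v = vadd E v u"
    and add_zero: "u \<in> vecs E \<Longrightarrow> v \<in> vecs E \<Longrightarrow> vadd E u (vscale E 0 v) = u"
    and scale_add: "u \<in> vecs E \<Longrightarrow> v \<in> vecs E \<Longrightarrow>
      vscale E c (vadd E u v) = vadd E (vscale E c u) (vscale E c v)"
    and scale_add_left: "u \<in> vecs E \<Longrightarrow>
      vscale E (c + d) u = vadd E (vscale E c u) (vscale E d u)"
    and scale_scale: "u \<in> vecs E \<Longrightarrow> vscale E c (vscale E d u) = vscale E (c * d) u"
    and scale_one: "u \<in> vecs E \<Longrightarrow> vscale E 1 u = u"
    and norm_triangle: "u \<in> vecs E \<Longrightarrow> v \<in> vecs E \<Longrightarrow>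
      vnorm E (vadd E u v) \<le> vnorm E u + vnorm E v"
    and norm_scale: "u \<in> vecs E \<Longrightarrow> vnorm E (vscale E c u) = cmod c * vnorm E u"
    and norm_zero_imp: "u \<in> vecs E \<Longrightarrow> vnorm E u = 0 \<Longrightarrow> u = vscale E 0 u"
begin

lemma add_left_commute:
  "u \<in> vecs E \<Longrightarrow> v \<in> vecs E \<Longrightarrow> w \<in> vecs E \<Longrightarrow> vadd E u (vadd E v w) = vadd E v (vadd E u w)"
  by (metis add_assoc add_commute)

lemmas add_ac = add_assoc add_commute add_left_commute

lemma scale_zero_unique:
  assumes "u \<in> vecs E" "v \<in> vecs E"
  shows "vscale E 0 u = vscale E 0 v"
  by (metis add_commute add_zero assms scale_closed)

definition zero where "zero = vscale E 0 (SOME u. u \<in> vecs E)"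

lemma zero_eq: "u \<in> vecs E \<Longrightarrow> vscale E 0 u = zero"
  unfolding zero_def by (rule scale_zero_unique) (simp_all add: someI[of "\<lambda>u. u \<in> vecs E"])

lemma zero_closed [simp]: "zero \<in> vecs E"
  unfolding zero_def using nonempty some_in_eq[of "vecs E"] by (intro scale_closed) simp

lemma add_zero_right [simp]: "u \<in> vecs E \<Longrightarrow> vadd E u zero = u"
  using add_zero[of u u] zero_eq[of u] by simp

lemma add_zero_left [simp]: "u \<in> vecs E \<Longrightarrow> vadd E zero u = u"
  using add_commute[of u zero] by simp

lemma add_minus [simp]: "u \<in> vecs E \<Longrightarrow> vadd E u (vscale E (-1) u) = zero"
  using scale_add_left[of u 1 "-1"] by (simp add: scale_one zero_eq)

lemma norm_zero [simp]: "vnorm E zero = 0"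
  using norm_scale[of zero 0] zero_eq[of zero] by simp

lemma norm_nonneg [simp]: "u \<in> vecs E \<Longrightarrow> 0 \<le> vnorm E u"
  using norm_triangle[of u "vscale E (-1) u"] by (simp add: norm_scale)

lemma norm_eq_zero: "u \<in> vecs E \<Longrightarrow> vnorm E u = 0 \<longleftrightarrow> u = zero"
  using norm_zero_imp zero_eq by auto

abbreviation sub where "sub u v \<equiv> vadd E u (vscale E (-1) v)"

lemma dist_eq: "u \<in> vecs E \<Longrightarrow> v \<in> vecs E \<Longrightarrow> vdist E u v = vnorm E (sub u v)"
  by (simp add: vdist_def)

lemma sub_swap: "u \<in> vecs E \<Longrightarrow> v \<in> vecs E \<Longrightarrow> sub v u = vscale E (-1) (sub u v)"
  by (simp add: scale_add scale_scale scale_one add_commute)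

lemma sub_add_sub:
  assumes "u \<in> vecs E" "v \<in> vecs E" "w \<in> vecs E"
  shows "vadd E (sub u v) (sub v w) = sub u w"
proof -
  have "vadd E (sub u v) (sub v w) = vadd E (sub u w) (sub v v)"
    using assms by (simp add: add_ac del: add_minus)
  then show ?thesis using assms by simp
qed

lemma sub_add_distrib:
  assumes "u \<in> vecs E" "v \<in> vecs E" "u' \<in> vecs E" "v' \<in> vecs E"
  shows "sub (vadd E u u') (vadd E v v') = vadd E (sub u v) (sub u' v')"
  using assms by (simp add: scale_add add_ac)

lemma sub_scale_distrib:
  assumes "u \<in> vecs E" "v \<in> vecs E"
  shows "sub (vscale E c u) (vscale E c v) = vscale E c (sub u v)"
  using assms by (simp add: scale_add scale_scale)

lemma sub_eq_zero_imp:
  assumes "u \<in> vecs E" "v \<in> vecs E" "sub u v = zero"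
  shows "u = v"
proof -
  have "v = vadd E (sub u v) v" using assms by simp
  also have "\<dots> = vadd E u (sub v v)" using assms(1,2) by (simp add: add_ac del: add_minus)
  also have "\<dots> = u" using assms by simp
  finally show ?thesis by simp
qed

sublocale Metric_space "vecs E" "vdist E"
proof
  fix x y z
  show "0 \<le> vdist E x y" by (auto simp: vdist_def)
  show "vdist E x y = vdist E y x"
    by (auto simp: vdist_def sub_swap[of x y] norm_scale)
  assume xy: "x \<in> vecs E" "y \<in> vecs E"
  show "vdist E x y = 0 \<longleftrightarrow> x = y"
    using xy sub_eq_zero_imp[of x y] by (auto simp: dist_eq norm_eq_zero)
  assume z: "z \<in> vecs E"
  show "vdist E x z \<le> vdist E x y + vdist E y z"
    using xy z norm_triangle[of "sub x y" "sub y z"] by (simp add: dist_eq sub_add_sub)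
qed

lemma norm_topology_eq: "norm_topology E = mtopology"
  by (simp add: norm_topology_def)

lemma dist_add:
  assumes "u \<in> vecs E" "v \<in> vecs E" "u' \<in> vecs E" "v' \<in> vecs E"
  shows "vdist E (vadd E u u') (vadd E v v') \<le> vdist E u v + vdist E u' v'"
  using assms norm_triangle[of "sub u v" "sub u' v'"] by (simp add: dist_eq sub_add_distrib)

lemma dist_scale:
  assumes "u \<in> vecs E" "v \<in> vecs E"
  shows "vdist E (vscale E c u) (vscale E c v) = cmod c * vdist E u v"
  using assms by (simp add: dist_eq sub_scale_distrib norm_scale)

lemma scale_zero_vec: "vscale E c zero = zero"
  by (metis mult_zero_right scale_scale zero_closed zero_eq)

lemma dist_zero: "u \<in> vecs E \<Longrightarrow> vdist E u zero = vnorm E u"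
  by (simp add: dist_eq scale_zero_vec)

lemma norm_le_dist: "u \<in> vecs E \<Longrightarrow> v \<in> vecs E \<Longrightarrow> vnorm E u \<le> vdist E u v + vnorm E v"
  using triangle[of u v zero] by (simp add: dist_zero)

end

locale normed_carriers = E: normed_carrier E + F: normed_carrier F for E :: "'u cnormed" and F :: "'v cnormed"
begin

lemma in_closure_of_graph_iff:
  assumes G: "G \<subseteq> vecs E \<times> vecs F"
  shows "(u, v) \<in> prod_topology (norm_topology E) (norm_topology F) closure_of G \<longleftrightarrow>
    u \<in> vecs E \<and> v \<in> vecs F \<and>
    (\<forall>e>0. \<exists>u' v'. (u', v') \<in> G \<and> vdist E u' u < e \<and> vdist F v' v < e)" (is "?l \<longleftrightarrow> ?r")
proof
  assume l: ?l
  then have uv: "u \<in> vecs E" "v \<in> vecs F"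
    using subsetD[OF closure_of_subset_topspace l]
    by (simp_all add: E.norm_topology_eq F.norm_topology_eq)
  have "\<exists>u' v'. (u', v') \<in> G \<and> vdist E u' u < e \<and> vdist F v' v < e" if "e > 0" for e
  proof -
    have "openin (prod_topology E.mtopology F.mtopology) (E.mball u e \<times> F.mball v e)"
      by (simp add: openin_prod_Times_iff)
    moreover have "(u, v) \<in> E.mball u e \<times> F.mball v e"
      using uv that by simp
    ultimately obtain z where "z \<in> G" "z \<in> E.mball u e \<times> F.mball v e"
      using l[unfolded in_closure_of E.norm_topology_eq F.norm_topology_eq, THEN conjunct2,
          rule_format, of "E.mball u e \<times> F.mball v e"] by metis
    then show ?thesis using E.commute[of u "fst z"] F.commute[of v "snd z"]
      by (intro exI[of _ "fst z"] exI[of _ "snd z"]) (auto simp: mem_Times_iff)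
  qed
  with uv show ?r by blast
next
  assume r: ?r
  show ?l
    unfolding in_closure_of E.norm_topology_eq F.norm_topology_eq
  proof (intro conjI allI impI)
    show "(u, v) \<in> topspace (prod_topology E.mtopology F.mtopology)" using r by simp
    fix T assume T: "(u, v) \<in> T \<and> openin (prod_topology E.mtopology F.mtopology) T"
    then obtain A B where AB: "openin E.mtopology A" "openin F.mtopology B" "u \<in> A" "v \<in> B" "A \<times> B \<subseteq> T"
      unfolding openin_prod_topology_alt by meson
    obtain a where a: "a > 0" "E.mball u a \<subseteq> A" using AB(1,3) by (auto simp: E.openin_mtopology)
    obtain b where b: "b > 0" "F.mball v b \<subseteq> B" using AB(2,4) by (auto simp: F.openin_mtopology)
    obtain u' v' where uv: "(u', v') \<in> G" "vdist E u' u < min a b" "vdist F v' v < min a b"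
    proof -
      have "0 < min a b" using a(1) b(1) by simp
      then show ?thesis using r that by blast
    qed
    have "u' \<in> vecs E" "v' \<in> vecs F" using uv(1) G by auto
    then have "u' \<in> E.mball u a" "v' \<in> F.mball v b"
      using uv(2,3) r E.commute[of u u'] F.commute[of v v'] by auto
    then have "u' \<in> A" "v' \<in> B" using a(2) b(2) by auto
    with AB(5) uv(1) show "\<exists>y. y \<in> G \<and> y \<in> T" by blast
  qed
qed

text \<open>The closure of a linear graph is linear, hence single-valued as soon as it is so above the
  zero vector, where it can be tested by sequences.\<close>

lemma closable_graph_iff_sequences:
  assumes G: "G \<subseteq> vecs E \<times> vecs F" "G \<noteq> {}"
    and G_add: "\<And>u v u' v'. (u, v) \<in> G \<Longrightarrow> (u', v') \<in> G \<Longrightarrow> (vadd E u u', vadd F v v') \<in> G"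
    and G_scale: "\<And>u v c. (u, v) \<in> G \<Longrightarrow> (vscale E c u, vscale F c v) \<in> G"
  shows "closable_graph E F G \<longleftrightarrow>
    (\<forall>s t w. (\<forall>n::nat. (s n, t n) \<in> G) \<longrightarrow> (\<lambda>n. vnorm E (s n)) \<longlonglongrightarrow> 0 \<longrightarrow>
       w \<in> vecs F \<longrightarrow> (\<lambda>n. vdist F (t n) w) \<longlonglongrightarrow> 0 \<longrightarrow> w = F.zero)"
    (is "?l \<longleftrightarrow> ?r")
proof -
  define C where "C = prod_topology (norm_topology E) (norm_topology F) closure_of G"
  note C_iff = in_closure_of_graph_iff[OF G(1), folded C_def]
  have C_sub: "u \<in> vecs E" "v \<in> vecs F" if "(u, v) \<in> C" for u v using that C_iff by auto
  have C_add: "(vadd E u u', vadd F v v') \<in> C" if uv: "(u, v) \<in> C" and uv': "(u', v') \<in> C" for u v u' v'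
    unfolding C_iff
  proof (intro conjI allI impI)
    fix e :: real assume e: "e > 0"
    from uv obtain p q where pq: "(p, q) \<in> G" "vdist E p u < e/2" "vdist F q v < e/2"
      using e unfolding C_iff by (meson half_gt_zero)
    from uv' obtain p' q' where pq': "(p', q') \<in> G" "vdist E p' u' < e/2" "vdist F q' v' < e/2"
      using e unfolding C_iff by (meson half_gt_zero)
    have in_vecs: "p \<in> vecs E" "q \<in> vecs F" "p' \<in> vecs E" "q' \<in> vecs F" using pq pq' G by auto
    have "vdist E (vadd E p p') (vadd E u u') < e" "vdist F (vadd F q q') (vadd F v v') < e"
      using E.dist_add[of p u p' u'] F.dist_add[of q v q' v'] pq pq' in_vecs C_sub[OF uv] C_sub[OF uv'] by auto
    then show "\<exists>p q. (p, q) \<in> G \<and> vdist E p (vadd E u u') < e \<and> vdist F q (vadd F v v') < e"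
      using G_add[OF pq(1) pq'(1)] by blast
  qed (use C_sub[OF uv] C_sub[OF uv'] in auto)
  have C_scale: "(vscale E c u, vscale F c v) \<in> C" if uv: "(u, v) \<in> C" for u v c
    unfolding C_iff
  proof (intro conjI allI impI)
    fix e :: real assume e: "e > 0"
    define e' where "e' = e / (cmod c + 1)"
    have "0 < cmod c + 1" using norm_ge_zero[of c] by linarith
    then have e': "e' > 0" "cmod c * e' < e"
      using e by (auto simp: e'_def field_simps)
    from uv e' obtain p q where pq: "(p, q) \<in> G" "vdist E p u < e'" "vdist F q v < e'"
      unfolding C_iff by blast
    have in_vecs: "p \<in> vecs E" "q \<in> vecs F" using pq G by auto
    have "cmod c * vdist E p u \<le> cmod c * e'" "cmod c * vdist F q v \<le> cmod c * e'"
      using pq by (auto intro!: mult_left_mono)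
    then have "vdist E (vscale E c p) (vscale E c u) < e" "vdist F (vscale F c q) (vscale F c v) < e"
      using e' in_vecs C_sub[OF uv] by (auto simp: E.dist_scale F.dist_scale)
    then show "\<exists>p q. (p, q) \<in> G \<and> vdist E p (vscale E c u) < e \<and> vdist F q (vscale F c v) < e"
      using G_scale[OF pq(1)] by blast
  qed (use C_sub[OF uv] in auto)
  have G_sub_C: "G \<subseteq> C"
  proof
    fix z assume z: "z \<in> G"
    obtain u v where [simp]: "z = (u, v)" by (cases z)
    have "u \<in> vecs E" "v \<in> vecs F" using z G by auto
    then show "z \<in> C" using z by (auto simp: C_iff intro!: exI[of _ u] exI[of _ v])
  qed
  have zero_C: "(E.zero, F.zero) \<in> C"
  proof -
    obtain u v where uv: "(u, v) \<in> G" using G(2) by auto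
    then have "(vscale E 0 u, vscale F 0 v) \<in> C" using G_scale G_sub_C by blast
    then show ?thesis using uv G by (auto simp: E.zero_eq F.zero_eq)
  qed
  have r_iff: "?r \<longleftrightarrow> (\<forall>w. (E.zero, w) \<in> C \<longrightarrow> w = F.zero)"
  proof safe
    fix w assume r: ?r and w: "(E.zero, w) \<in> C"
    have "\<exists>u v. (u, v) \<in> G \<and> vdist E u E.zero < 1 / real (Suc n) \<and> vdist F v w < 1 / real (Suc n)" for n
    proof -
      have "0 < 1 / real (Suc n)" by simp
      then show ?thesis using w unfolding C_iff by blast
    qed
    then obtain s t where st: "\<And>n. (s n, t n) \<in> G" "\<And>n. vdist E (s n) E.zero < 1 / real (Suc n)"
        "\<And>n. vdist F (t n) w < 1 / real (Suc n)"
      by metis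
    have sv: "s n \<in> vecs E" for n using st(1)[of n] G by auto
    have l1: "(\<lambda>n. vnorm E (s n)) \<longlonglongrightarrow> 0"
      by (rule tendsto_0_of_less_inverse_Suc) (use sv st(2) in \<open>auto simp: E.dist_zero\<close>)
    have l2: "(\<lambda>n. vdist F (t n) w) \<longlonglongrightarrow> 0"
      by (rule tendsto_0_of_less_inverse_Suc) (use st(3) in auto)
    show "w = F.zero" using r st(1) l1 l2 C_sub[OF w] by blast
  next
    fix s t w
    assume u: "\<forall>w. (E.zero, w) \<in> C \<longrightarrow> w = F.zero" and st: "\<forall>n::nat. (s n, t n) \<in> G"
      and l: "(\<lambda>n. vnorm E (s n)) \<longlonglongrightarrow> 0" "(\<lambda>n. vdist F (t n) w) \<longlonglongrightarrow> 0" and w: "w \<in> vecs F"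
    have sv: "s n \<in> vecs E" for n using st[rule_format, of n] G by auto
    have "(E.zero, w) \<in> C"
      unfolding C_iff
    proof (intro conjI allI impI)
      fix e :: real assume "e > 0"
      then have "eventually (\<lambda>n. vnorm E (s n) < e \<and> vdist F (t n) w < e) sequentially"
        using l by (intro eventually_conj) (auto dest: order_tendstoD(2))
      then obtain n where "vnorm E (s n) < e" "vdist F (t n) w < e"
        by (auto simp: eventually_sequentially)
      then show "\<exists>u v. (u, v) \<in> G \<and> vdist E u E.zero < e \<and> vdist F v w < e"
        using st sv by (metis E.dist_zero)
    qed (use w in auto)
    then show "w = F.zero" using u by blast
  qed
  show ?thesis
    unfolding r_iff
  proof
    assume ?l
    then obtain D T where T: "linear_on E F D T" "C = (\<lambda>u. (u, T u)) ` D"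
      unfolding closable_graph_def is_operator_graph_def C_def by blast
    show "\<forall>w. (E.zero, w) \<in> C \<longrightarrow> w = F.zero"
      using zero_C T(2) by auto
  next
    assume u: "\<forall>w. (E.zero, w) \<in> C \<longrightarrow> w = F.zero"
    have uniq: "v = v'" if "(u, v) \<in> C" "(u, v') \<in> C" for u v v'
    proof -
      have "(E.sub u u, F.sub v v') \<in> C" using C_add C_scale that by blast
      then have "F.sub v v' = F.zero" using u C_sub(1)[OF that(1)] by simp
      then show ?thesis using F.sub_eq_zero_imp C_sub(2) that by blast
    qed
    define T where "T u = (THE v. (u, v) \<in> C)" for u
    have T_eq: "T u = v" if "(u, v) \<in> C" for u v
      unfolding T_def using that uniq by blast
    have "linear_on E F (fst ` C) T"
      unfolding linear_on_def linear_subspace_def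
    proof (intro conjI ballI allI)
      show "fst ` C \<subseteq> vecs E" using C_sub by auto
      show "fst ` C \<noteq> {}" using zero_C by auto
      show "T ` fst ` C \<subseteq> vecs F" using C_sub T_eq by auto
    next
      fix u u' assume "u \<in> fst ` C" "u' \<in> fst ` C"
      then obtain v v' where v: "(u, v) \<in> C" "(u', v') \<in> C" by auto
      show "vadd E u u' \<in> fst ` C" using C_add[OF v] by force
      show "T (vadd E u u') = vadd F (T u) (T u')"
        using T_eq[OF C_add[OF v]] T_eq[OF v(1)] T_eq[OF v(2)] by simp
    next
      fix c u assume "u \<in> fst ` C"
      then obtain v where v: "(u, v) \<in> C" by auto
      show "vscale E c u \<in> fst ` C" using C_scale[OF v] by force
      show "T (vscale E c u) = vscale F c (T u)"
        using T_eq[OF C_scale[OF v]] T_eq[OF v] by simp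
    qed
    moreover have "C = (\<lambda>u. (u, T u)) ` fst ` C"
      using T_eq by (force simp: image_iff)
    ultimately show ?l
      unfolding closable_graph_def is_operator_graph_def C_def[symmetric] by blast
  qed
qed


lemma linear_onD:
  assumes "linear_on E F (vecs E) T"
  shows "u \<in> vecs E \<Longrightarrow> T u \<in> vecs F"
    and "u \<in> vecs E \<Longrightarrow> v \<in> vecs E \<Longrightarrow> T (vadd E u v) = vadd F (T u) (T v)"
    and "u \<in> vecs E \<Longrightarrow> T (vscale E c u) = vscale F c (T u)"
  using assms by (auto simp: linear_on_def)

lemma linear_onI:
  assumes "\<And>u. u \<in> vecs E \<Longrightarrow> T u \<in> vecs F"
    and "\<And>u v. u \<in> vecs E \<Longrightarrow> v \<in> vecs E \<Longrightarrow> T (vadd E u v) = vadd F (T u) (T v)"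
    and "\<And>c u. u \<in> vecs E \<Longrightarrow> T (vscale E c u) = vscale F c (T u)"
  shows "linear_on E F (vecs E) T"
  using assms E.nonempty by (auto simp: linear_on_def linear_subspace_def)

lemma linear_on_zero:
  assumes "linear_on E F (vecs E) T"
  shows "T E.zero = F.zero"
  using linear_onD(3)[OF assms, of E.zero 0] linear_onD(1)[OF assms, of E.zero]
  by (simp add: E.zero_eq F.zero_eq)

abbreviation unit_ball where "unit_ball \<equiv> {u \<in> vecs E. vnorm E u \<le> 1}"

lemma zero_in_unit_ball: "E.zero \<in> unit_ball" by simp

end

text \<open>For a complete target, compactness of the closure of the image of the unit ball amounts to total
  boundedness of the image, which can be checked by sequences or by finite nets.\<close>

locale operators_into_complete = normed_carriers +
  assumes complete: "F.mcomplete"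
begin

lemma compact_operators_iff:
  "T \<in> compact_operators E F \<longleftrightarrow>
    T \<in> extensional (vecs E) \<and> linear_on E F (vecs E) T \<and> F.mtotally_bounded (T ` unit_ball)"
proof -
  have "T ` unit_ball \<subseteq> vecs F" if "linear_on E F (vecs E) T"
    using linear_onD(1)[OF that] by auto
  then show ?thesis
    by (auto simp: compact_operators_def F.norm_topology_eq F.mtotally_bounded_eq_compact_closure_of[OF complete])
qed

lemma compact_linear: "T \<in> compact_operators E F \<Longrightarrow> linear_on E F (vecs E) T"
  by (simp add: compact_operators_iff)

lemma compact_extensional: "T \<in> compact_operators E F \<Longrightarrow> T \<in> extensional (vecs E)"
  by (simp add: compact_operators_iff)

lemmas compact_closed [simp] = linear_onD(1)[OF compact_linear]

lemma compact_bounded: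
  assumes T: "T \<in> compact_operators E F"
  shows "\<exists>B. \<forall>u\<in>unit_ball. vnorm F (T u) \<le> B"
proof -
  have "F.mbounded (T ` unit_ball)"
    using T F.mtotally_bounded_imp_mbounded by (auto simp: compact_operators_iff)
  then obtain x B where sub: "T ` unit_ball \<subseteq> F.mcball x B" by (auto simp: F.mbounded_def)
  have "vnorm F (T u) \<le> B + vnorm F x" if u: "u \<in> unit_ball" for u
  proof -
    have "T u \<in> F.mcball x B" using sub u by blast
    then show ?thesis
      using F.norm_le_dist[of "T u" x] F.commute[of x "T u"] by auto
  qed
  then show ?thesis by blast
qed

lemma operator_norm_upper_unit_ball:
  assumes T: "T \<in> compact_operators E F" and u: "u \<in> unit_ball"
  shows "vnorm F (T u) \<le> operator_norm E F T"
  unfolding operator_norm_def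
proof (rule cSup_upper)
  obtain B where "\<forall>u\<in>unit_ball. vnorm F (T u) \<le> B" using compact_bounded[OF T] by blast
  then show "bdd_above {vnorm F (T u) |u. u \<in> vecs E \<and> vnorm E u \<le> 1}"
    by (intro bdd_aboveI[of _ B]) auto
qed (use u in auto)

lemma operator_norm_least:
  assumes "\<And>u. u \<in> unit_ball \<Longrightarrow> vnorm F (T u) \<le> C"
  shows "operator_norm E F T \<le> C"
  unfolding operator_norm_def
  by (rule cSup_least) (use assms in \<open>auto intro!: exI[of _ E.zero]\<close>)

lemma operator_norm_nonneg:
  assumes T: "T \<in> compact_operators E F"
  shows "0 \<le> operator_norm E F T"
  using operator_norm_upper_unit_ball[OF T zero_in_unit_ball]
  by (simp add: linear_on_zero[OF compact_linear[OF T]])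

text \<open>A vector of norm 0 is the zero vector; every other vector is a multiple of a unit vector.\<close>

lemma operator_norm_upper:
  assumes T: "T \<in> compact_operators E F" and u: "u \<in> vecs E"
  shows "vnorm F (T u) \<le> operator_norm E F T * vnorm E u"
proof (cases "vnorm E u = 0")
  case True
  then show ?thesis
    using u by (simp add: E.norm_eq_zero linear_on_zero[OF compact_linear[OF T]])
next
  case False
  define r where "r = vnorm E u"
  have r: "r > 0" using False E.norm_nonneg[OF u] by (simp add: r_def)
  let ?v = "vscale E (complex_of_real (1 / r)) u"
  have "?v \<in> unit_ball"
    using u r by (simp add: E.norm_scale r_def[symmetric] norm_divide)
  then have "vnorm F (T ?v) \<le> operator_norm E F T" by (rule operator_norm_upper_unit_ball[OF T])
  moreover have "vnorm F (T ?v) = vnorm F (T u) / r"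
    using r u T by (simp add: linear_onD(3)[OF compact_linear[OF T]] F.norm_scale norm_divide)
  ultimately show ?thesis using r by (simp add: field_simps r_def)
qed

text \<open>Total boundedness of the image of the unit ball passes to uniform limits.\<close>

lemma compact_of_approx:
  assumes ext: "T \<in> extensional (vecs E)" and lin: "linear_on E F (vecs E) T"
    and approx: "\<And>e. e > 0 \<Longrightarrow> \<exists>S\<in>compact_operators E F. \<forall>u\<in>unit_ball. vdist F (T u) (S u) \<le> e"
  shows "T \<in> compact_operators E F"
  unfolding compact_operators_iff
proof (intro conjI ext lin)
  note T_closed = linear_onD(1)[OF lin]
  show "F.mtotally_bounded (T ` unit_ball)"
    unfolding F.mtotally_bounded_def
  proof (intro allI impI)
    fix e :: real assume e: "e > 0"
    then obtain S where S: "S \<in> compact_operators E F" "\<And>u. u \<in> unit_ball \<Longrightarrow> vdist F (T u) (S u) \<le> e / 4"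
      using approx[of "e/4"] by auto
    then have tb: "F.mtotally_bounded (S ` unit_ball)" by (simp add: compact_operators_iff)
    obtain K where K: "finite K" "K \<subseteq> S ` unit_ball" "S ` unit_ball \<subseteq> (\<Union>x\<in>K. F.mball x (e/4))"
      using tb e unfolding F.mtotally_bounded_def by (meson divide_pos_pos zero_less_numeral)
    obtain C where C: "C \<subseteq> unit_ball" "finite C" "K = S ` C"
      using finite_subset_image[OF K(1,2)] by blast
    have "T ` unit_ball \<subseteq> (\<Union>x\<in>T ` C. F.mball x e)"
    proof
      fix y assume "y \<in> T ` unit_ball"
      then obtain u where u: "y = T u" "u \<in> unit_ball" by blast
      then have "S u \<in> (\<Union>x\<in>K. F.mball x (e/4))" using K(3) by blast
      then obtain c where c: "c \<in> C" "S u \<in> F.mball (S c) (e/4)" using C(3) by blast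
      have cb: "c \<in> unit_ball" using c C by blast
      have "vdist F (T c) (T u) \<le> vdist F (T c) (S c) + vdist F (S c) (T u)"
        using cb u S(1) by (intro F.triangle) (auto simp: T_closed)
      also have "vdist F (S c) (T u) \<le> vdist F (S c) (S u) + vdist F (S u) (T u)"
        using cb u S(1) by (intro F.triangle) (auto simp: T_closed)
      finally have "vdist F (T c) (T u) < e"
        using S(2)[OF cb] S(2)[OF u(2)] c(2) e F.commute[of "S u" "T u"] by auto
      then show "y \<in> (\<Union>x\<in>T ` C. F.mball x e)"
        using c(1) cb u T_closed by auto
    qed
    then show "\<exists>K. finite K \<and> K \<subseteq> T ` unit_ball \<and> T ` unit_ball \<subseteq> (\<Union>x\<in>K. F.mball x e)"
      using C by (intro exI[of _ "T ` C"]) auto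
  qed
qed

text \<open>Cauchy subsequences of the images under \<open>S\<close> and \<open>T\<close> are chosen one after the other.\<close>

lemma compact_linear_combination:
  assumes S: "S \<in> compact_operators E F" and T: "T \<in> compact_operators E F"
  shows "(\<lambda>u\<in>vecs E. vadd F (vscale F c (S u)) (T u)) \<in> compact_operators E F" (is "?U \<in> _")
  unfolding compact_operators_iff
proof (intro conjI)
  note lS = linear_onD[OF compact_linear[OF S]] and lT = linear_onD[OF compact_linear[OF T]]
  show "?U \<in> extensional (vecs E)" by simp
  show "linear_on E F (vecs E) ?U"
    by (rule linear_onI) (auto simp: lS lT F.add_ac F.scale_add F.scale_scale mult.commute)
  show "F.mtotally_bounded (?U ` unit_ball)"
    unfolding F.mtotally_bounded_sequentially
  proof (intro conjI allI impI)
    show "?U ` unit_ball \<subseteq> vecs F" using lS lT by auto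
    fix \<sigma> :: "nat \<Rightarrow> _" assume "range \<sigma> \<subseteq> ?U ` unit_ball"
    then have "\<forall>n. \<exists>u. u \<in> unit_ball \<and> \<sigma> n = ?U u" by (auto simp: image_subset_iff image_iff Bex_def)
    then obtain u where u: "\<And>n. u n \<in> unit_ball" "\<And>n. \<sigma> n = ?U (u n)" by metis
    have tS: "\<forall>\<sigma>::nat \<Rightarrow> _. range \<sigma> \<subseteq> S ` unit_ball \<longrightarrow> (\<exists>r. strict_mono r \<and> F.MCauchy (\<sigma> \<circ> r))"
      and tT: "\<forall>\<sigma>::nat \<Rightarrow> _. range \<sigma> \<subseteq> T ` unit_ball \<longrightarrow> (\<exists>r. strict_mono r \<and> F.MCauchy (\<sigma> \<circ> r))"
      using S T by (auto simp: compact_operators_iff F.mtotally_bounded_sequentially)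
    obtain r where r: "strict_mono r" "F.MCauchy ((\<lambda>n. S (u n)) \<circ> r)"
      using tS[rule_format, of "\<lambda>n. S (u n)"] u(1) by blast
    obtain r' where r': "strict_mono r'" "F.MCauchy ((\<lambda>n. T (u (r n))) \<circ> r')"
      using tT[rule_format, of "\<lambda>n. T (u (r n))"] u(1) by blast
    have 1: "F.MCauchy (((\<lambda>n. S (u n)) \<circ> r) \<circ> r')" by (rule F.MCauchy_subsequence[OF r'(1) r(2)])
    have uv: "u n \<in> vecs E" for n using u(1) by blast
    have "F.MCauchy (\<sigma> \<circ> (r \<circ> r'))"
      unfolding F.MCauchy_def
    proof (intro conjI allI impI)
      show "range (\<sigma> \<circ> (r \<circ> r')) \<subseteq> vecs F" using u lS lT by auto
      fix e :: real assume e: "e > 0"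
      define e' where "e' = e / (cmod c + 1)"
      have c: "0 < cmod c + 1" using norm_ge_zero[of c] by linarith
      have "cmod c * e' + e' = (cmod c + 1) * e'" by (simp add: algebra_simps)
      also have "\<dots> = e" using c by (simp add: e'_def)
      finally have e': "0 < e'" "cmod c * e' + e' = e" using e c by (simp_all add: e'_def)
      obtain N1 where N1: "\<And>n n'. N1 \<le> n \<Longrightarrow> N1 \<le> n' \<Longrightarrow> vdist F (S (u (r (r' n)))) (S (u (r (r' n')))) < e'"
        using 1 e'(1) unfolding F.MCauchy_def o_def by meson
      obtain N2 where N2: "\<And>n n'. N2 \<le> n \<Longrightarrow> N2 \<le> n' \<Longrightarrow> vdist F (T (u (r (r' n)))) (T (u (r (r' n')))) < e'"
        using r'(2) e'(1) unfolding F.MCauchy_def o_def by meson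
      have "vdist F ((\<sigma> \<circ> (r \<circ> r')) n) ((\<sigma> \<circ> (r \<circ> r')) n') < e" if n: "max N1 N2 \<le> n" "max N1 N2 \<le> n'" for n n'
      proof -
        let ?S = "\<lambda>n. S (u (r (r' n)))" and ?T = "\<lambda>n. T (u (r (r' n)))"
        have "vdist F ((\<sigma> \<circ> (r \<circ> r')) n) ((\<sigma> \<circ> (r \<circ> r')) n') \<le> cmod c * vdist F (?S n) (?S n') + vdist F (?T n) (?T n')"
          using F.dist_add[of "vscale F c (?S n)" "vscale F c (?S n')" "?T n" "?T n'"] uv
          by (simp add: u(2) lS(1) lT(1) F.dist_scale)
        also have "\<dots> < cmod c * e' + e'"
          using N1[of n n'] N2[of n n'] n by (intro add_le_less_mono mult_left_mono) auto
        finally show ?thesis using e'(2) by simp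
      qed
      then show "\<exists>N. \<forall>n n'. N \<le> n \<longrightarrow> N \<le> n' \<longrightarrow> vdist F ((\<sigma> \<circ> (r \<circ> r')) n) ((\<sigma> \<circ> (r \<circ> r')) n') < e"
        by blast
    qed
    then show "\<exists>r. strict_mono r \<and> F.MCauchy (\<sigma> \<circ> r)"
      using r(1) r'(1) strict_mono_o by blast
  qed
qed

lemma compact_add:
  assumes S: "S \<in> compact_operators E F" and T: "T \<in> compact_operators E F"
  shows "(\<lambda>u\<in>vecs E. vadd F (S u) (T u)) \<in> compact_operators E F"
proof -
  have "(\<lambda>u\<in>vecs E. vadd F (vscale F 1 (S u)) (T u)) = (\<lambda>u\<in>vecs E. vadd F (S u) (T u))"
    using S by (intro restrict_ext) (simp add: F.scale_one)
  with compact_linear_combination[OF S T, of 1] show ?thesis by (simp only:)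
qed

lemma compact_zero: "(\<lambda>u\<in>vecs E. F.zero) \<in> compact_operators E F"
  unfolding compact_operators_iff
proof (intro conjI)
  show "linear_on E F (vecs E) (\<lambda>u\<in>vecs E. F.zero)"
    by (rule linear_onI) (auto simp: F.scale_zero_vec)
  have "(\<lambda>u\<in>vecs E. F.zero) ` unit_ball = {F.zero}"
    using zero_in_unit_ball by (auto simp: image_iff intro!: exI[of _ E.zero])
  then show "F.mtotally_bounded ((\<lambda>u\<in>vecs E. F.zero) ` unit_ball)" by simp
qed simp

lemma compact_scale:
  assumes T: "T \<in> compact_operators E F"
  shows "(\<lambda>u\<in>vecs E. vscale F c (T u)) \<in> compact_operators E F"
proof -
  have "(\<lambda>u\<in>vecs E. vadd F (vscale F c (T u)) ((\<lambda>u\<in>vecs E. F.zero) u)) = (\<lambda>u\<in>vecs E. vscale F c (T u))"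
    using T by (intro restrict_ext) simp
  with compact_linear_combination[OF T compact_zero, of c] show ?thesis by (simp only:)
qed

abbreviation "K \<equiv> compact_operator_space E F"

lemma compact_operator_space_simps [simp]:
  "vecs K = compact_operators E F"
  "vadd K S T = (\<lambda>u\<in>vecs E. vadd F (S u) (T u))"
  "vscale K c T = (\<lambda>u\<in>vecs E. vscale F c (T u))"
  "vnorm K T = operator_norm E F T"
  by (simp_all add: compact_operator_space_def)

lemma normed_carrier_compact_operators: "normed_carrier K"
proof
  show "vecs K \<noteq> {}" using compact_zero by auto
next
  fix S T U :: "'a \<Rightarrow> 'b" and c d :: complex
  assume S: "S \<in> vecs K"
  then have S': "S \<in> compact_operators E F" by simp
  show "vscale K c S \<in> vecs K" using S by (simp add: compact_scale)
  show "vscale K 1 S = S"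
    using S' compact_extensional[OF S']
    by (intro ext) (auto simp: extensional_def F.scale_one)
  show "vscale K (c + d) S = vadd K (vscale K c S) (vscale K d S)"
    using S' by (auto intro!: restrict_ext simp: F.scale_add_left)
  show "vscale K c (vscale K d S) = vscale K (c * d) S"
    using S' by (auto intro!: restrict_ext simp: F.scale_scale)
  show "vnorm K (vscale K c S) = cmod c * vnorm K S"
  proof (rule antisym)
    show "vnorm K (vscale K c S) \<le> cmod c * vnorm K S"
      using operator_norm_upper_unit_ball[OF S'] S'
      by (auto intro!: operator_norm_least mult_left_mono simp: F.norm_scale)
    show "cmod c * vnorm K S \<le> vnorm K (vscale K c S)"
    proof (cases "c = 0")
      case True
      then show ?thesis using operator_norm_nonneg[OF compact_scale[OF S', of c]] by simp
    next
      case False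
      have "vnorm K S \<le> vnorm K (vscale K c S) / cmod c"
        unfolding compact_operator_space_simps(4)
      proof (rule operator_norm_least)
        fix u assume u: "u \<in> unit_ball"
        have "vnorm F (vscale K c S u) \<le> vnorm K (vscale K c S)"
          using operator_norm_upper_unit_ball[OF compact_scale[OF S', of c] u] by simp
        then show "vnorm F (S u) \<le> operator_norm E F (vscale K c S) / cmod c"
          using u S' False by (simp add: F.norm_scale field_simps)
      qed
      then show ?thesis using False by (simp add: field_simps)
    qed
  qed
  show "S = vscale K 0 S" if "vnorm K S = 0"
  proof
    fix u
    show "S u = vscale K 0 S u"
    proof (cases "u \<in> vecs E")
      case True
      then have "vnorm F (S u) \<le> 0"
        using operator_norm_upper[OF S' True] that by simp
      then have "vnorm F (S u) = 0" using True S' by (intro antisym) simp_all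
      then have "S u = F.zero" using True S' F.norm_eq_zero[of "S u"] by simp
      then show ?thesis using True S' by (simp add: F.scale_zero_vec)
    next
      case False
      then show ?thesis using compact_extensional[OF S'] by (simp add: extensional_def)
    qed
  qed
  assume T: "T \<in> vecs K"
  then have T': "T \<in> compact_operators E F" by simp
  show "vadd K S T \<in> vecs K" using S T by (simp add: compact_add)
  show "vadd K S T = vadd K T S"
    using S' T' by (auto intro!: restrict_ext simp: F.add_commute)
  show "vadd K S (vscale K 0 T) = S"
    using S' T' compact_extensional[OF S']
    by (intro ext) (auto simp: extensional_def F.add_zero)
  show "vscale K c (vadd K S T) = vadd K (vscale K c S) (vscale K c T)"
    using S' T' by (auto intro!: restrict_ext simp: F.scale_add)
  show "vnorm K (vadd K S T) \<le> vnorm K S + vnorm K T"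
    unfolding compact_operator_space_simps(4)
  proof (rule operator_norm_least)
    fix u assume u: "u \<in> unit_ball"
    show "vnorm F (vadd K S T u) \<le> operator_norm E F S + operator_norm E F T"
      using operator_norm_upper_unit_ball[OF S' u] operator_norm_upper_unit_ball[OF T' u]
        F.norm_triangle[of "S u" "T u"] u S' T' by simp
  qed
  assume U: "U \<in> vecs K"
  then have U': "U \<in> compact_operators E F" by simp
  show "vadd K (vadd K S T) U = vadd K S (vadd K T U)"
    using S' T' U' by (auto intro!: restrict_ext simp: F.add_assoc)
qed

sublocale K: normed_carrier K by (rule normed_carrier_compact_operators)

lemma dist_apply_le:
  assumes S: "S \<in> compact_operators E F" and T: "T \<in> compact_operators E F" and u: "u \<in> vecs E"
  shows "vdist F (S u) (T u) \<le> vdist K S T * vnorm E u"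
proof -
  have "K.sub S T \<in> compact_operators E F" using S T K.add_closed[of S "vscale K (-1) T"] K.scale_closed[of T "-1"] by simp
  from operator_norm_upper[OF this u] show ?thesis
    using S T u K.dist_eq[of S T] by (simp add: F.dist_eq)
qed

lemma dist_compact_least:
  assumes S: "S \<in> compact_operators E F" and T: "T \<in> compact_operators E F"
    and le: "\<And>u. u \<in> unit_ball \<Longrightarrow> vdist F (S u) (T u) \<le> e"
  shows "vdist K S T \<le> e"
proof -
  have "vnorm K (K.sub S T) \<le> e"
    unfolding compact_operator_space_simps(4)
  proof (rule operator_norm_least)
    fix u assume u: "u \<in> unit_ball"
    then show "vnorm F (K.sub S T u) \<le> e"
      using le[OF u] S T by (simp add: F.dist_eq)
  qed
  then show ?thesis using S T K.dist_eq[of S T] by simp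
qed

text \<open>A Cauchy sequence of operators converges pointwise because \<open>F\<close> is complete, and then uniformly on the
  unit ball, so that compactness passes to the limit.\<close>

theorem compact_operators_complete: "K.mcomplete"
  unfolding K.mcomplete_def
proof (intro allI impI)
  fix T assume Cau: "K.MCauchy T"
  have Tc: "T n \<in> compact_operators E F" for n
    using Cau unfolding K.MCauchy_def by auto
  note lT = linear_onD[OF compact_linear[OF Tc]]
  have ball: "\<exists>N. \<forall>m n. N \<le> m \<longrightarrow> N \<le> n \<longrightarrow> vdist F (T m u) (T n u) < e" if u: "u \<in> vecs E" and e: "e > 0" for u e
  proof -
    have r: "0 < vnorm E u + 1" using E.norm_nonneg[OF u] by linarith
    then have "0 < e / (vnorm E u + 1)" using e by simp
    then obtain N where N: "\<And>m n. N \<le> m \<Longrightarrow> N \<le> n \<Longrightarrow> vdist K (T m) (T n) < e / (vnorm E u + 1)"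
      using Cau unfolding K.MCauchy_def by meson
    have "vdist F (T m u) (T n u) < e" if "N \<le> m" "N \<le> n" for m n
    proof -
      have "vdist F (T m u) (T n u) \<le> vdist K (T m) (T n) * vnorm E u"
        by (rule dist_apply_le[OF Tc Tc u])
      also have "\<dots> \<le> e / (vnorm E u + 1) * vnorm E u"
        using N[OF that] E.norm_nonneg[OF u] by (intro mult_right_mono) auto
      also have "\<dots> < e" using r e by (simp add: field_simps)
      finally show ?thesis .
    qed
    then show ?thesis by blast
  qed
  have "\<exists>v. limitin F.mtopology (\<lambda>n. T n u) v sequentially" if u: "u \<in> vecs E" for u
  proof -
    have "F.MCauchy (\<lambda>n. T n u)" using ball[OF u] lT(1)[OF u] by (auto simp: F.MCauchy_def)
    then show ?thesis using complete by (simp add: F.mcomplete_def)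
  qed
  then obtain L where L: "\<And>u. u \<in> vecs E \<Longrightarrow> limitin F.mtopology (\<lambda>n. T n u) (L u) sequentially" by metis
  then have L_closed: "L u \<in> vecs F" and L_lim: "(\<lambda>n. vdist F (T n u) (L u)) \<longlonglongrightarrow> 0" if "u \<in> vecs E" for u
    using that by (auto simp: F.limitin_metric_dist_null)
  have eq_of_limit: "v = w" if "(\<lambda>n. vdist F (s n) v) \<longlonglongrightarrow> 0" "(\<lambda>n. vdist F (s n) w) \<longlonglongrightarrow> 0"
    "v \<in> vecs F" "w \<in> vecs F" "\<And>n. s n \<in> vecs F" for s v w
  proof -
    have "limitin F.mtopology s v sequentially" "limitin F.mtopology s w sequentially"
      using that by (auto simp: F.limitin_metric_dist_null)
    then show ?thesis using F.limitin_metric_unique by (metis sequentially_bot)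
  qed
  define U where "U = (\<lambda>u\<in>vecs E. L u)"
  have lin: "linear_on E F (vecs E) U"
  proof (rule linear_onI)
    fix u v assume uv: "u \<in> vecs E" "v \<in> vecs E"
    have "(\<lambda>n. vdist F (T n (vadd E u v)) (vadd F (L u) (L v))) \<longlonglongrightarrow> 0"
    proof (rule real_tendsto_sandwich[OF _ _ tendsto_const])
      show "(\<lambda>n. vdist F (T n u) (L u) + vdist F (T n v) (L v)) \<longlonglongrightarrow> 0"
        using tendsto_add[OF L_lim[OF uv(1)] L_lim[OF uv(2)]] by simp
      show "\<forall>\<^sub>F n in sequentially. vdist F (T n (vadd E u v)) (vadd F (L u) (L v))
          \<le> vdist F (T n u) (L u) + vdist F (T n v) (L v)"
        using uv by (simp add: lT L_closed F.dist_add)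
    qed simp
    then have "L (vadd E u v) = vadd F (L u) (L v)"
      using uv by (intro eq_of_limit[OF L_lim]) (auto simp: L_closed lT)
    then show "U (vadd E u v) = vadd F (U u) (U v)" using uv by (simp add: U_def)
  next
    fix c u assume u: "u \<in> vecs E"
    have "(\<lambda>n. vdist F (T n (vscale E c u)) (vscale F c (L u))) \<longlonglongrightarrow> 0"
      using tendsto_mult_left[OF L_lim[OF u], of "cmod c"] u by (simp add: lT L_closed F.dist_scale)
    then have "L (vscale E c u) = vscale F c (L u)"
      using u by (intro eq_of_limit[OF L_lim]) (auto simp: L_closed lT)
    then show "U (vscale E c u) = vscale F c (U u)" using u by (simp add: U_def)
  qed (simp add: U_def L_closed)
  have unif: "\<exists>N. \<forall>n\<ge>N. \<forall>u\<in>unit_ball. vdist F (U u) (T n u) \<le> e" if e: "e > 0" for e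
  proof -
    obtain N where N: "\<And>m n. N \<le> m \<Longrightarrow> N \<le> n \<Longrightarrow> vdist K (T m) (T n) < e"
      using Cau e unfolding K.MCauchy_def by meson
    have "vdist F (U u) (T n u) \<le> e" if n: "n \<ge> N" and u: "u \<in> unit_ball" for n u
    proof -
      have uv: "u \<in> vecs E" using u by simp
      have "vdist F (U u) (T n u) \<le> vdist F (T m u) (L u) + e" if m: "m \<ge> N" for m
      proof -
        have "vdist F (U u) (T n u) \<le> vdist F (L u) (T m u) + vdist F (T m u) (T n u)"
          using uv by (auto simp: U_def intro!: F.triangle L_closed lT(1))
        moreover have "vdist F (T m u) (T n u) \<le> vdist K (T m) (T n) * vnorm E u"
          by (rule dist_apply_le[OF Tc Tc uv])
        moreover have "vdist K (T m) (T n) * vnorm E u \<le> e * 1"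
          using N[OF m n] u e by (intro mult_mono) auto
        ultimately show ?thesis using F.commute[of "L u" "T m u"] by simp
      qed
      then have "\<exists>N. \<forall>m\<ge>N. vdist F (U u) (T n u) \<le> vdist F (T m u) (L u) + e" by blast
      moreover have "(\<lambda>m. vdist F (T m u) (L u) + e) \<longlonglongrightarrow> 0 + e"
        by (intro tendsto_add L_lim[OF uv] tendsto_const)
      ultimately show ?thesis using LIMSEQ_le_const by fastforce
    qed
    then show ?thesis by blast
  qed
  have U: "U \<in> compact_operators E F"
  proof (rule compact_of_approx[OF _ lin])
    fix e :: real assume "e > 0"
    then show "\<exists>S\<in>compact_operators E F. \<forall>u\<in>unit_ball. vdist F (U u) (S u) \<le> e"
      using unif[of e] Tc by blast
  qed (simp add: U_def)
  have "limitin K.mtopology T U sequentially"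
    unfolding K.limitin_metric
  proof (intro conjI allI impI)
    fix e :: real assume e: "e > 0"
    obtain N where N: "\<forall>n\<ge>N. \<forall>u\<in>unit_ball. vdist F (U u) (T n u) \<le> e/2" using unif[of "e/2"] e by auto
    have "vdist K (T n) U < e" if "n \<ge> N" for n
      using dist_compact_least[OF U Tc, of n "e/2"] N that e K.commute[of U "T n"] by auto
    then show "\<forall>\<^sub>F n in sequentially. T n \<in> vecs K \<and> vdist K (T n) U < e"
      using Tc by (auto simp: eventually_sequentially)
  qed (use U in simp)
  then show "\<exists>U. limitin K.mtopology T U sequentially" by blast
qed

end

section \<open>The normed space \<open>L\<^sup>2\<close>\<close>

lemma equiv_ae_eq: "equiv (square_integrable M) (ae_eq M)"
proof (rule equivI)
  show "trans (ae_eq M)"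
  proof (rule transI)
    fix f g h assume "(f, g) \<in> ae_eq M" "(g, h) \<in> ae_eq M"
    then show "(f, h) \<in> ae_eq M" unfolding ae_eq_def by (auto elim!: eventually_elim2)
  qed
  show "sym (ae_eq M)"
    by (rule symI) (auto simp: ae_eq_def elim: eventually_mono)
qed (auto simp: ae_eq_def refl_on_def)

lemma L2_class_eq_iff:
  assumes "f \<in> square_integrable M" "g \<in> square_integrable M"
  shows "L2_class M f = L2_class M g \<longleftrightarrow> (AE x in M. f x = g x)"
  using eq_equiv_class_iff[OF equiv_ae_eq assms] assms by (simp add: L2_class_def ae_eq_def)

lemma L2_class_AE_cong:
  assumes "f \<in> square_integrable M" "g \<in> borel_measurable M" "AE x in M. f x = g x"
  shows "L2_class M f = L2_class M g"
  using L2_class_eq_iff[OF assms(1) sqint_AE_cong[OF assms]] assms(3) by simp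

lemma L2_class_in_vecs [simp]:
  "f \<in> square_integrable M \<Longrightarrow> L2_class M f \<in> vecs (L2 M)"
  by (simp add: L2_def L2_class_def quotientI)

lemma rep_L2_class:
  assumes "f \<in> square_integrable M"
  shows "rep (L2_class M f) \<in> square_integrable M" and "AE x in M. rep (L2_class M f) x = f x"
proof -
  have "f \<in> L2_class M f" using assms by (simp add: L2_class_def ae_eq_def)
  then have "rep (L2_class M f) \<in> L2_class M f" unfolding rep_def
    by (rule someI[of "\<lambda>f'. f' \<in> L2_class M f"])
  then show "rep (L2_class M f) \<in> square_integrable M" and "AE x in M. rep (L2_class M f) x = f x"
    by (auto simp: L2_class_def ae_eq_def elim: eventually_mono)
qed

lemma vecs_L2_cases:
  assumes "u \<in> vecs (L2 M)"
  obtains f where "f \<in> square_integrable M" "u = L2_class M f"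
  using assms by (auto simp: L2_def L2_class_def quotient_def)

lemma vadd_L2 [simp]:
  assumes "f \<in> square_integrable M" "g \<in> square_integrable M"
  shows "vadd (L2 M) (L2_class M f) (L2_class M g) = L2_class M (\<lambda>x. f x + g x)"
proof -
  note r = rep_L2_class[OF assms(1)] rep_L2_class[OF assms(2)]
  have "L2_class M (\<lambda>x. rep (L2_class M f) x + rep (L2_class M g) x) = L2_class M (\<lambda>x. f x + g x)"
    by (subst L2_class_eq_iff) (use r assms in \<open>auto elim: eventually_elim2\<close>)
  then show ?thesis by (simp add: L2_def)
qed

lemma vscale_L2 [simp]:
  assumes "f \<in> square_integrable M"
  shows "vscale (L2 M) c (L2_class M f) = L2_class M (\<lambda>x. c * f x)"
proof -
  have "L2_class M (\<lambda>x. c * rep (L2_class M f) x) = L2_class M (\<lambda>x. c * f x)"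
    by (subst L2_class_eq_iff) (use rep_L2_class[OF assms] assms in \<open>auto elim: eventually_mono\<close>)
  then show ?thesis by (simp add: L2_def)
qed

lemma vnorm_L2 [simp]:
  assumes "f \<in> square_integrable M"
  shows "vnorm (L2 M) (L2_class M f) = norm2 M f"
  using norm2_AE_cong[OF _ _ rep_L2_class(2)[OF assms]] rep_L2_class(1)[OF assms] assms
  by (simp add: L2_def norm2_def sqint_measurable)

lemma normed_carrier_L2: "normed_carrier (L2 M)"
proof
  show "vecs (L2 M) \<noteq> {}" using L2_class_in_vecs[OF sqint_zero] by blast
next
  fix u v w c d
  assume "u \<in> vecs (L2 M)"
  then obtain f where f: "f \<in> square_integrable M" "u = L2_class M f" by (rule vecs_L2_cases)
  show "vscale (L2 M) c u \<in> vecs (L2 M)" using f by simp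
  show "vscale (L2 M) (c + d) u = vadd (L2 M) (vscale (L2 M) c u) (vscale (L2 M) d u)"
    "vscale (L2 M) c (vscale (L2 M) d u) = vscale (L2 M) (c * d) u"
    "vscale (L2 M) 1 u = u"
    using f by (simp_all add: algebra_simps)
  show "vnorm (L2 M) (vscale (L2 M) c u) = cmod c * vnorm (L2 M) u"
    using f by (simp add: norm2_scale)
  show "u = vscale (L2 M) 0 u" if "vnorm (L2 M) u = 0"
    using that f by (simp add: L2_class_eq_iff norm2_eq_0_iff)
  assume "v \<in> vecs (L2 M)"
  then obtain g where g: "g \<in> square_integrable M" "v = L2_class M g" by (rule vecs_L2_cases)
  show "vadd (L2 M) u v \<in> vecs (L2 M)" "vadd (L2 M) u v = vadd (L2 M) v u"
    "vadd (L2 M) u (vscale (L2 M) 0 v) = u"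
    "vscale (L2 M) c (vadd (L2 M) u v) = vadd (L2 M) (vscale (L2 M) c u) (vscale (L2 M) c v)"
    using f g by (simp_all add: algebra_simps)
  show "vnorm (L2 M) (vadd (L2 M) u v) \<le> vnorm (L2 M) u + vnorm (L2 M) v"
    using f g by (simp add: norm2_triangle)
  assume "w \<in> vecs (L2 M)"
  then obtain h where h: "h \<in> square_integrable M" "w = L2_class M h" by (rule vecs_L2_cases)
  show "vadd (L2 M) (vadd (L2 M) u v) w = vadd (L2 M) u (vadd (L2 M) v w)"
    using f g h by (simp add: algebra_simps)
qed

lemma vdist_L2 [simp]:
  assumes "f \<in> square_integrable M" "g \<in> square_integrable M"
  shows "vdist (L2 M) (L2_class M f) (L2_class M g) = norm2 M (\<lambda>x. f x - g x)"
  using assms vadd_L2[OF assms(1) sqint_scale[OF assms(2), of "-1"]] vscale_L2[OF assms(2), of "-1"]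
    vnorm_L2[OF sqint_diff[OF assms]]
  by (simp add: vdist_def)

lemma L2_complete: "Metric_space.mcomplete (vecs (L2 M)) (vdist (L2 M))"
proof -
  interpret normed_carrier "L2 M" by (rule normed_carrier_L2)
  show ?thesis
    unfolding mcomplete_def
  proof (intro allI impI)
    fix s assume s: "MCauchy s"
    then have "s n \<in> vecs (L2 M)" for n by (auto simp: MCauchy_def)
    then have "\<forall>n. \<exists>f. f \<in> square_integrable M \<and> s n = L2_class M f"
      by (metis vecs_L2_cases)
    then obtain f where f: "\<And>n. f n \<in> square_integrable M" "\<And>n. s n = L2_class M (f n)" by metis
    have "\<exists>N. \<forall>m\<ge>N. \<forall>n\<ge>N. norm2 M (\<lambda>x. f m x - f n x) < e" if "e > 0" for e
    proof -
      obtain N where "\<And>m n. N \<le> m \<Longrightarrow> N \<le> n \<Longrightarrow> vdist (L2 M) (s m) (s n) < e"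
        using s \<open>e > 0\<close> unfolding MCauchy_def by meson
      then show ?thesis using f by auto
    qed
    from Riesz_Fischer[OF f(1) this] obtain h where
      h: "h \<in> square_integrable M" "(\<lambda>n. norm2 M (\<lambda>x. f n x - h x)) \<longlonglongrightarrow> 0" by blast
    have "limitin mtopology s (L2_class M h) sequentially"
      unfolding limitin_metric_dist_null using h f by simp
    then show "\<exists>x. limitin mtopology s x sequentially" by blast
  qed
qed


section \<open>Hilbert-Schmidt operators\<close>

definition tensor :: "('a \<Rightarrow> complex) \<Rightarrow> ('b \<Rightarrow> complex) \<Rightarrow> 'a \<times> 'b \<Rightarrow> complex" where
  "tensor f g z = f (fst z) * g (snd z)"

locale measure_pair = pair_sigma_finite M N for M :: "'a measure" and N :: "'b measure"
begin

abbreviation P where "P \<equiv> M \<Otimes>\<^sub>M N"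

sublocale H: operators_into_complete "L2 M" "L2 N"
  by (intro operators_into_complete.intro normed_carriers.intro normed_carrier_L2
      operators_into_complete_axioms.intro L2_complete)

lemma tensor_measurable [measurable]:
  assumes [measurable]: "f \<in> borel_measurable M" "g \<in> borel_measurable N"
  shows "tensor f g \<in> borel_measurable P"
  unfolding tensor_def by measurable

lemma integrable_times:
  fixes f :: "'a \<Rightarrow> real" and g :: "'b \<Rightarrow> real"
  assumes "integrable M f" "integrable N g"
  shows "integrable P (\<lambda>z. f (fst z) * g (snd z))"
    and "(\<integral>z. f (fst z) * g (snd z) \<partial>P) = (\<integral>x. f x \<partial>M) * (\<integral>y. g y \<partial>N)"
proof -
  have [measurable]: "f \<in> borel_measurable M" "g \<in> borel_measurable N" using assms by auto
  show i: "integrable P (\<lambda>z. f (fst z) * g (snd z))"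
    by (rule Fubini_integrable) (use assms in \<open>simp_all add: abs_mult\<close>)
  show "(\<integral>z. f (fst z) * g (snd z) \<partial>P) = (\<integral>x. f x \<partial>M) * (\<integral>y. g y \<partial>N)"
    using integral_fst'[OF i] by simp
qed

lemma tensor_sqint [simp]:
  assumes f: "f \<in> square_integrable M" and g: "g \<in> square_integrable N"
  shows "tensor f g \<in> square_integrable P"
proof -
  have "integrable P (\<lambda>z. (cmod (f (fst z)))\<^sup>2 * (cmod (g (snd z)))\<^sup>2)"
    by (rule integrable_times(1)) (use f g in \<open>auto simp: square_integrable_def\<close>)
  then show ?thesis
    using f g by (simp add: square_integrable_def tensor_def norm_mult power_mult_distrib)
      (measurable; simp)
qed

lemma norm2_tensor:
  assumes f: "f \<in> square_integrable M" and g: "g \<in> square_integrable N"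
  shows "norm2 P (tensor f g) = norm2 M f * norm2 N g"
proof -
  have "(\<integral>z. (cmod (f (fst z)))\<^sup>2 * (cmod (g (snd z)))\<^sup>2 \<partial>P) = (\<integral>x. (cmod (f x))\<^sup>2 \<partial>M) * (\<integral>y. (cmod (g y))\<^sup>2 \<partial>N)"
    by (rule integrable_times(2)) (use f g in \<open>auto simp: square_integrable_def\<close>)
  then show ?thesis
    by (simp add: norm2_def tensor_def norm_mult power_mult_distrib real_sqrt_mult)
qed

text \<open>The operator with kernel \<open>k\<close> is studied through its bilinear form, which only involves functions;
  \<open>operator_norm_HS\<close> below identifies \<open>kernel_norm\<close> with the operator norm.\<close>

definition pairing :: "('a \<times> 'b \<Rightarrow> complex) \<Rightarrow> ('a \<Rightarrow> complex) \<Rightarrow> ('b \<Rightarrow> complex) \<Rightarrow> complex" where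
  "pairing k f g = (\<integral>z. k z * tensor f g z \<partial>P)"

definition kernel_norm :: "('a \<times> 'b \<Rightarrow> complex) \<Rightarrow> real" where
  "kernel_norm k = Sup {cmod (pairing k f g) | f g.
     f \<in> square_integrable M \<and> norm2 M f \<le> 1 \<and> g \<in> square_integrable N \<and> norm2 N g \<le> 1}"

definition kernel_apply :: "('a \<times> 'b \<Rightarrow> complex) \<Rightarrow> ('a \<Rightarrow> complex) \<Rightarrow> 'b \<Rightarrow> complex" where
  "kernel_apply k f y = (\<integral>x. k (x, y) * f x \<partial>M)"

lemma pairing_integrable:
  assumes "k \<in> square_integrable P" "f \<in> square_integrable M" "g \<in> square_integrable N"
  shows "integrable P (\<lambda>z. k z * tensor f g z)"
  using assms by (intro sqint_integrable_mult tensor_sqint)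

lemma pairing_le_norm2:
  assumes "k \<in> square_integrable P" "f \<in> square_integrable M" "g \<in> square_integrable N"
  shows "cmod (pairing k f g) \<le> norm2 P k * (norm2 M f * norm2 N g)"
  unfolding pairing_def using Cauchy_Schwarz_L2[of k P "tensor f g"] assms by (simp add: norm2_tensor)

lemma pairing_le_norm2_ball:
  assumes "k \<in> square_integrable P" "f \<in> square_integrable M" "g \<in> square_integrable N"
    and "norm2 M f \<le> 1" "norm2 N g \<le> 1"
  shows "cmod (pairing k f g) \<le> norm2 P k"
proof -
  have "norm2 M f * norm2 N g \<le> 1 * 1" using assms by (intro mult_mono) auto
  then have "norm2 P k * (norm2 M f * norm2 N g) \<le> norm2 P k * 1" by (intro mult_left_mono) auto
  then show ?thesis using pairing_le_norm2[OF assms(1-3)] by simp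
qed

lemma pairing_le_kernel_norm_ball:
  assumes "k \<in> square_integrable P" "f \<in> square_integrable M" "g \<in> square_integrable N"
    and "norm2 M f \<le> 1" "norm2 N g \<le> 1"
  shows "cmod (pairing k f g) \<le> kernel_norm k"
  unfolding kernel_norm_def
proof (rule cSup_upper)
  show "bdd_above {cmod (pairing k f g) | f g.
     f \<in> square_integrable M \<and> norm2 M f \<le> 1 \<and> g \<in> square_integrable N \<and> norm2 N g \<le> 1}"
    using pairing_le_norm2_ball[OF assms(1)] by (intro bdd_aboveI[of _ "norm2 P k"]) auto
qed (use assms in auto)

lemma kernel_norm_least:
  assumes "\<And>f g. f \<in> square_integrable M \<Longrightarrow> norm2 M f \<le> 1 \<Longrightarrow> g \<in> square_integrable N \<Longrightarrow> norm2 N g \<le> 1 \<Longrightarrow>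
    cmod (pairing k f g) \<le> C"
  shows "kernel_norm k \<le> C"
  unfolding kernel_norm_def
  by (rule cSup_least) (use assms in \<open>auto intro!: exI[of _ "\<lambda>_. 0"]\<close>)

lemma kernel_norm_le_norm2:
  "k \<in> square_integrable P \<Longrightarrow> kernel_norm k \<le> norm2 P k"
  by (rule kernel_norm_least) (rule pairing_le_norm2_ball)

lemma kernel_norm_nonneg:
  assumes "k \<in> square_integrable P" shows "0 \<le> kernel_norm k"
  using order_trans[OF norm_ge_zero pairing_le_kernel_norm_ball[OF assms sqint_zero sqint_zero]] by simp

lemma pairing_scale: "pairing k (\<lambda>x. c * f x) (\<lambda>y. d * g y) = c * d * pairing k f g"
proof -
  have "(\<lambda>z. k z * tensor (\<lambda>x. c * f x) (\<lambda>y. d * g y) z) = (\<lambda>z. (c * d) * (k z * tensor f g z))"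
    by (auto simp: tensor_def)
  then show ?thesis unfolding pairing_def by (simp only: integral_mult_right_zero)
qed

lemma pairing_le_kernel_norm:
  assumes k: "k \<in> square_integrable P" and f: "f \<in> square_integrable M" and g: "g \<in> square_integrable N"
  shows "cmod (pairing k f g) \<le> kernel_norm k * (norm2 M f * norm2 N g)"
proof (cases "norm2 M f = 0 \<or> norm2 N g = 0")
  case True
  then have "norm2 P k * (norm2 M f * norm2 N g) = 0" "kernel_norm k * (norm2 M f * norm2 N g) = 0" by auto
  with pairing_le_norm2[OF assms] show ?thesis by linarith
next
  case False
  then have pos: "norm2 M f > 0" "norm2 N g > 0"
    using norm2_nonneg[of M f] norm2_nonneg[of N g] by linarith+
  let ?c = "complex_of_real (1 / norm2 M f)" and ?d = "complex_of_real (1 / norm2 N g)"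
  have "cmod (pairing k (\<lambda>x. ?c * f x) (\<lambda>y. ?d * g y)) \<le> kernel_norm k"
    using pos by (intro pairing_le_kernel_norm_ball k sqint_scale f g)
      (simp_all only: norm2_scale norm_of_real, simp_all)
  moreover have "cmod (?c * ?d) = 1 / (norm2 M f * norm2 N g)"
    using pos by (simp add: norm_mult norm_divide)
  ultimately have "cmod (pairing k f g) / (norm2 M f * norm2 N g) \<le> kernel_norm k"
    by (simp only: pairing_scale norm_mult[of "?c * ?d"]) (simp add: divide_inverse mult.commute)
  then show ?thesis using pos by (simp add: field_simps)
qed

lemma pairing_add:
  assumes "k \<in> square_integrable P" "l \<in> square_integrable P" "f \<in> square_integrable M" "g \<in> square_integrable N"
  shows "pairing (\<lambda>z. k z + l z) f g = pairing k f g + pairing l f g"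
  unfolding pairing_def
  using pairing_integrable[OF assms(1,3,4)] pairing_integrable[OF assms(2,3,4)] by (simp add: distrib_right)

lemma pairing_scale_left: "pairing (\<lambda>z. c * k z) f g = c * pairing k f g"
  unfolding pairing_def by (simp add: mult.assoc)

lemma kernel_norm_triangle:
  assumes "k \<in> square_integrable P" "l \<in> square_integrable P"
  shows "kernel_norm (\<lambda>z. k z + l z) \<le> kernel_norm k + kernel_norm l"
proof (rule kernel_norm_least)
  fix f g assume fg: "f \<in> square_integrable M" "norm2 M f \<le> 1" "g \<in> square_integrable N" "norm2 N g \<le> 1"
  have "cmod (pairing k f g + pairing l f g) \<le> cmod (pairing k f g) + cmod (pairing l f g)"
    by (rule norm_triangle_ineq)
  also have "\<dots> \<le> kernel_norm k + kernel_norm l"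
    using fg assms by (intro add_mono pairing_le_kernel_norm_ball)
  finally show "cmod (pairing (\<lambda>z. k z + l z) f g) \<le> kernel_norm k + kernel_norm l"
    using pairing_add[OF assms fg(1,3)] by simp
qed

lemma kernel_norm_scale_le:
  assumes "k \<in> square_integrable P"
  shows "kernel_norm (\<lambda>z. c * k z) \<le> cmod c * kernel_norm k"
  by (rule kernel_norm_least)
    (auto simp: pairing_scale_left norm_mult intro!: mult_left_mono pairing_le_kernel_norm_ball assms)

lemma kernel_norm_minus:
  assumes k: "k \<in> square_integrable P"
  shows "kernel_norm (\<lambda>z. - k z) = kernel_norm k"
proof (rule antisym)
  show "kernel_norm (\<lambda>z. - k z) \<le> kernel_norm k" using kernel_norm_scale_le[OF k, of "-1"] by simp
  show "kernel_norm k \<le> kernel_norm (\<lambda>z. - k z)"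
    using kernel_norm_scale_le[OF sqint_scale[OF k, of "-1"], of "-1"] by simp
qed

lemma kernel_norm_diff_commute:
  assumes "k \<in> square_integrable P" "l \<in> square_integrable P"
  shows "kernel_norm (\<lambda>z. k z - l z) = kernel_norm (\<lambda>z. l z - k z)"
  using kernel_norm_minus[OF sqint_diff[OF assms(2,1)]] by simp

lemma kernel_norm_triangle_diff:
  assumes "k \<in> square_integrable P" "l \<in> square_integrable P"
  shows "kernel_norm (\<lambda>z. k z - l z) \<le> kernel_norm k + kernel_norm l"
  using kernel_norm_triangle[OF assms(1) sqint_scale[OF assms(2), of "-1"]] kernel_norm_minus[OF assms(2)]
  by simp

lemma kernel_apply_measurable [measurable]:
  assumes [measurable]: "k \<in> borel_measurable P" "f \<in> borel_measurable M"
  shows "kernel_apply k f \<in> borel_measurable N"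
  unfolding kernel_apply_def by measurable

lemma AE_section_sqint:
  assumes k: "k \<in> square_integrable P"
  shows "AE y in N. (\<lambda>x. k (x, y)) \<in> square_integrable M"
proof -
  have [measurable]: "k \<in> borel_measurable P" using k by (rule sqint_measurable)
  have "integrable P (case_prod (\<lambda>x y. (cmod (k (x, y)))\<^sup>2))"
    using sqint_integrable_square[OF k] by (simp add: case_prod_unfold)
  from AE_integrable_snd[OF this] AE_space show ?thesis
    by eventually_elim (simp add: square_integrable_def)
qed

lemma kernel_apply_sqint:
  assumes k: "k \<in> square_integrable P" and f: "f \<in> square_integrable M"
  shows "kernel_apply k f \<in> square_integrable N"
proof -
  note [measurable] = sqint_measurable[OF k] sqint_measurable[OF f]
  have i: "integrable P (case_prod (\<lambda>x y. (cmod (k (x, y)))\<^sup>2))"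
    using sqint_integrable_square[OF k] by (simp add: case_prod_unfold)
  have "integrable N (\<lambda>y. (cmod (kernel_apply k f y))\<^sup>2)"
  proof (rule Bochner_Integration.integrable_bound)
    show "integrable N (\<lambda>y. (norm2 M f)\<^sup>2 * (\<integral>x. (cmod (k (x, y)))\<^sup>2 \<partial>M))"
      using integrable_snd[OF i] by simp
    show "AE y in N. norm ((cmod (kernel_apply k f y))\<^sup>2) \<le> norm ((norm2 M f)\<^sup>2 * (\<integral>x. (cmod (k (x, y)))\<^sup>2 \<partial>M))"
      using AE_section_sqint[OF k]
    proof eventually_elim
      case (elim y)
      have "(cmod (kernel_apply k f y))\<^sup>2 \<le> (norm2 M (\<lambda>x. k (x, y)) * norm2 M f)\<^sup>2"
        unfolding kernel_apply_def by (intro power_mono Cauchy_Schwarz_L2 elim f) simp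
      then show ?case by (simp add: power_mult_distrib norm2_square mult.commute)
    qed
  qed measurable
  then show ?thesis by (simp add: square_integrable_def)
qed

lemma pairing_eq_kernel_apply:
  assumes k: "k \<in> square_integrable P" and f: "f \<in> square_integrable M" and g: "g \<in> square_integrable N"
  shows "pairing k f g = (\<integral>y. kernel_apply k f y * g y \<partial>N)"
proof -
  have i: "integrable P (case_prod (\<lambda>x y. k (x, y) * tensor f g (x, y)))"
    using pairing_integrable[OF assms] by (simp add: case_prod_unfold)
  have "pairing k f g = (\<integral>y. (\<integral>x. k (x, y) * tensor f g (x, y) \<partial>M) \<partial>N)"
    using integral_snd[OF i] by (simp add: pairing_def case_prod_unfold)
  also have "\<dots> = (\<integral>y. kernel_apply k f y * g y \<partial>N)"
    by (simp add: kernel_apply_def tensor_def mult.assoc flip: integral_mult_left_zero)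
  finally show ?thesis .
qed

text \<open>The norm of \<open>h = I\<^sub>k f\<close> is attained by pairing \<open>h\<close> with its complex conjugate.\<close>

lemma norm2_kernel_apply_le:
  assumes k: "k \<in> square_integrable P" and f: "f \<in> square_integrable M"
  shows "norm2 N (kernel_apply k f) \<le> kernel_norm k * norm2 M f"
proof (cases "norm2 N (kernel_apply k f) = 0")
  case True
  then show ?thesis using kernel_norm_nonneg[OF k] by simp
next
  case False
  let ?h = "kernel_apply k f"
  have h: "?h \<in> square_integrable N" by (rule kernel_apply_sqint[OF k f])
  have "pairing k f (\<lambda>y. cnj (?h y)) = complex_of_real ((norm2 N ?h)\<^sup>2)"
    unfolding pairing_eq_kernel_apply[OF k f sqint_cnj[OF h]] norm2_square
    by (simp only: complex_norm_square[symmetric] integral_complex_of_real)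
  then have "(norm2 N ?h)\<^sup>2 \<le> kernel_norm k * (norm2 M f * norm2 N ?h)"
    using pairing_le_kernel_norm[OF k f sqint_cnj[OF h]] by (simp add: norm_power)
  then show ?thesis using False norm2_nonneg[of N ?h] by (simp add: power2_eq_square)
qed

lemma kernel_apply_add:
  assumes k: "k \<in> square_integrable P" and l: "l \<in> square_integrable P" and f: "f \<in> square_integrable M"
  shows "AE y in N. kernel_apply (\<lambda>z. k z + l z) f y = kernel_apply k f y + kernel_apply l f y"
  using AE_section_sqint[OF k] AE_section_sqint[OF l]
  by eventually_elim (simp add: kernel_apply_def distrib_right sqint_integrable_mult f)

lemma kernel_apply_add_right:
  assumes k: "k \<in> square_integrable P" and f: "f \<in> square_integrable M" and g: "g \<in> square_integrable M"
  shows "AE y in N. kernel_apply k (\<lambda>x. f x + g x) y = kernel_apply k f y + kernel_apply k g y"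
  using AE_section_sqint[OF k]
  by eventually_elim (simp add: kernel_apply_def distrib_left sqint_integrable_mult f g)

lemma HS_operator_class:
  assumes k: "k \<in> square_integrable P" and f: "f \<in> square_integrable M"
  shows "HS_operator M N k (L2_class M f) = L2_class N (kernel_apply k f)"
proof -
  note [measurable] = sqint_measurable[OF k] sqint_measurable[OF f] sqint_measurable[OF rep_L2_class(1)[OF f]]
  have "(\<integral>x. k (x, y) * rep (L2_class M f) x \<partial>M) = kernel_apply k f y" if "y \<in> space N" for y
    unfolding kernel_apply_def
  proof (rule integral_cong_AE)
    show "(\<lambda>x. k (x, y) * rep (L2_class M f) x) \<in> borel_measurable M" using that by measurable
    show "(\<lambda>x. k (x, y) * f x) \<in> borel_measurable M" using that by measurable
    show "AE x in M. k (x, y) * rep (L2_class M f) x = k (x, y) * f x"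
      using rep_L2_class(2)[OF f] by eventually_elim simp
  qed
  then have "AE y in N. kernel_apply k f y = (\<integral>x. k (x, y) * rep (L2_class M f) x \<partial>M)" by simp
  from L2_class_AE_cong[OF kernel_apply_sqint[OF k f] _ this]
  show ?thesis using f by (simp add: HS_operator_def)
qed

lemma HS_linear:
  assumes k: "k \<in> square_integrable P"
  shows "linear_on (L2 M) (L2 N) (vecs (L2 M)) (HS_operator M N k)"
proof (rule H.linear_onI)
  fix u v c assume "u \<in> vecs (L2 M)"
  then obtain f where f: "f \<in> square_integrable M" "u = L2_class M f" by (rule vecs_L2_cases)
  note kf = kernel_apply_sqint[OF k f(1)]
  show "HS_operator M N k u \<in> vecs (L2 N)" using f kf by (simp add: HS_operator_class k)
  have "kernel_apply k (\<lambda>x. c * f x) = (\<lambda>y. c * kernel_apply k f y)"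
  proof
    fix y
    have "(\<lambda>x. k (x, y) * (c * f x)) = (\<lambda>x. c * (k (x, y) * f x))" by (auto simp: algebra_simps)
    then show "kernel_apply k (\<lambda>x. c * f x) y = c * kernel_apply k f y"
      unfolding kernel_apply_def by (simp only: integral_mult_right_zero)
  qed
  then show "HS_operator M N k (vscale (L2 M) c u) = vscale (L2 N) c (HS_operator M N k u)"
    using f kf by (simp add: HS_operator_class k)
  assume "v \<in> vecs (L2 M)"
  then obtain g where g: "g \<in> square_integrable M" "v = L2_class M g" by (rule vecs_L2_cases)
  have "L2_class N (kernel_apply k (\<lambda>x. f x + g x)) = L2_class N (\<lambda>y. kernel_apply k f y + kernel_apply k g y)"
    by (subst L2_class_eq_iff) (use kernel_apply_add_right[OF k f(1) g(1)] f g k in \<open>auto intro!: sqint_add kernel_apply_sqint\<close>)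
  then show "HS_operator M N k (vadd (L2 M) u v) = vadd (L2 N) (HS_operator M N k u) (HS_operator M N k v)"
    using f g by (simp add: HS_operator_class k kernel_apply_sqint)
qed

lemma HS_extensional: "HS_operator M N k \<in> extensional (vecs (L2 M))"
  by (simp add: HS_operator_def)

lemma HS_eqI:
  assumes "T \<in> extensional (vecs (L2 M))"
    and "\<And>f. f \<in> square_integrable M \<Longrightarrow> HS_operator M N k (L2_class M f) = T (L2_class M f)"
  shows "HS_operator M N k = T"
  using HS_extensional assms(1)
proof (rule extensionalityI)
  fix u assume "u \<in> vecs (L2 M)"
  then show "HS_operator M N k u = T u" using assms(2) by (auto elim: vecs_L2_cases)
qed

lemma HS_add:
  assumes k: "k \<in> square_integrable P" and l: "l \<in> square_integrable P"
  shows "HS_operator M N (\<lambda>z. k z + l z) = vadd H.K (HS_operator M N k) (HS_operator M N l)"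
proof (rule HS_eqI)
  fix f assume f: "f \<in> square_integrable M"
  have "L2_class N (kernel_apply (\<lambda>z. k z + l z) f) = L2_class N (\<lambda>y. kernel_apply k f y + kernel_apply l f y)"
    by (subst L2_class_eq_iff) (use kernel_apply_add[OF k l f] k l f in \<open>auto intro!: sqint_add kernel_apply_sqint\<close>)
  then show "HS_operator M N (\<lambda>z. k z + l z) (L2_class M f) = vadd H.K (HS_operator M N k) (HS_operator M N l) (L2_class M f)"
    using f k l by (simp add: HS_operator_class kernel_apply_sqint)
qed simp

lemma HS_scale:
  assumes k: "k \<in> square_integrable P"
  shows "HS_operator M N (\<lambda>z. c * k z) = vscale H.K c (HS_operator M N k)"
proof (rule HS_eqI)
  fix f assume f: "f \<in> square_integrable M"
  have "kernel_apply (\<lambda>z. c * k z) f = (\<lambda>y. c * kernel_apply k f y)"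
    by (simp add: kernel_apply_def mult.assoc fun_eq_iff)
  then show "HS_operator M N (\<lambda>z. c * k z) (L2_class M f) = vscale H.K c (HS_operator M N k) (L2_class M f)"
    using f k by (simp add: HS_operator_class kernel_apply_sqint)
qed simp

lemma dist_HS_le:
  assumes k: "k \<in> square_integrable P" and l: "l \<in> square_integrable P" and u: "u \<in> H.unit_ball"
  shows "vdist (L2 N) (HS_operator M N k u) (HS_operator M N l u) \<le> kernel_norm (\<lambda>z. k z - l z)"
proof -
  obtain f where f: "f \<in> square_integrable M" "u = L2_class M f" using u by (auto elim: vecs_L2_cases)
  have "vdist (L2 N) (HS_operator M N k u) (HS_operator M N l u)
      = norm2 N (\<lambda>y. kernel_apply k f y - kernel_apply l f y)"
    using f k l by (simp add: HS_operator_class kernel_apply_sqint)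
  also have "\<dots> = norm2 N (kernel_apply (\<lambda>z. k z - l z) f)"
  proof (rule norm2_AE_cong)
    have "AE y in N. kernel_apply (\<lambda>z. k z - l z + l z) f y = kernel_apply (\<lambda>z. k z - l z) f y + kernel_apply l f y"
      by (rule kernel_apply_add[OF sqint_diff[OF k l] l f(1)])
    then show "AE y in N. kernel_apply k f y - kernel_apply l f y = kernel_apply (\<lambda>z. k z - l z) f y"
      by eventually_elim simp
    show "(\<lambda>y. kernel_apply k f y - kernel_apply l f y) \<in> borel_measurable N"
      by (intro sqint_measurable sqint_diff kernel_apply_sqint k l f)
    show "kernel_apply (\<lambda>z. k z - l z) f \<in> borel_measurable N"
      by (intro sqint_measurable sqint_diff kernel_apply_sqint k l f)
  qed
  also have "\<dots> \<le> kernel_norm (\<lambda>z. k z - l z) * norm2 M f"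
    by (rule norm2_kernel_apply_le[OF sqint_diff[OF k l] f(1)])
  also have "\<dots> \<le> kernel_norm (\<lambda>z. k z - l z) * 1"
    using u f kernel_norm_nonneg[OF sqint_diff[OF k l]] by (intro mult_left_mono) auto
  finally show ?thesis by simp
qed


text \<open>Kernels whose operator is compact form a linear space that is closed for the \<open>L\<^sup>2\<close> norm. It
  contains the indicators of rectangles, hence, by a monotone class argument, every
  square-integrable kernel.\<close>

definition compact_kernels :: "('a \<times> 'b \<Rightarrow> complex) set" where
  "compact_kernels = {k \<in> square_integrable P. HS_operator M N k \<in> compact_operators (L2 M) (L2 N)}"

lemma compact_kernels_add:
  "k \<in> compact_kernels \<Longrightarrow> l \<in> compact_kernels \<Longrightarrow> (\<lambda>z. k z + l z) \<in> compact_kernels"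
  using H.compact_add by (auto simp: compact_kernels_def HS_add)

lemma compact_kernels_scale:
  "k \<in> compact_kernels \<Longrightarrow> (\<lambda>z. c * k z) \<in> compact_kernels"
  using H.compact_scale by (auto simp: compact_kernels_def HS_scale)

lemma compact_kernels_limit:
  assumes l: "\<And>n. l n \<in> compact_kernels" and k: "k \<in> square_integrable P"
    and lim: "(\<lambda>n. norm2 P (\<lambda>z. l n z - k z)) \<longlonglongrightarrow> 0"
  shows "k \<in> compact_kernels"
proof -
  have l': "l n \<in> square_integrable P" "HS_operator M N (l n) \<in> compact_operators (L2 M) (L2 N)" for n
    using l[of n] by (auto simp: compact_kernels_def)
  have "HS_operator M N k \<in> compact_operators (L2 M) (L2 N)"
  proof (rule H.compact_of_approx[OF HS_extensional HS_linear[OF k]])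
    fix e :: real assume "e > 0"
    then have "eventually (\<lambda>n. norm2 P (\<lambda>z. l n z - k z) < e) sequentially"
      using lim by (auto dest: order_tendstoD(2))
    then obtain n where n: "norm2 P (\<lambda>z. l n z - k z) < e" by (auto simp: eventually_sequentially)
    have "vdist (L2 N) (HS_operator M N k u) (HS_operator M N (l n) u) \<le> e" if "u \<in> H.unit_ball" for u
      using dist_HS_le[OF k l'(1) that, of n] kernel_norm_le_norm2[OF sqint_diff[OF l'(1) k], of n]
        kernel_norm_diff_commute[OF l'(1) k, of n] n by simp
    then show "\<exists>S\<in>compact_operators (L2 M) (L2 N). \<forall>u\<in>H.unit_ball. vdist (L2 N) (HS_operator M N k u) (S u) \<le> e"
      using l'(2) by blast
  qed
  with k show ?thesis by (simp add: compact_kernels_def)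
qed

lemma kernel_apply_tensor: "kernel_apply (tensor f g) h = (\<lambda>y. (\<integral>x. f x * h x \<partial>M) * g y)"
  by (auto simp: kernel_apply_def tensor_def fun_eq_iff mult_ac simp flip: integral_mult_right_zero)

text \<open>The operator of \<open>f \<otimes> g\<close> has rank one; the coefficients of the image vectors form a bounded sequence of
  complex numbers.\<close>

lemma tensor_compact_kernel:
  assumes f: "f \<in> square_integrable M" and g: "g \<in> square_integrable N"
  shows "tensor f g \<in> compact_kernels"
proof -
  let ?T = "HS_operator M N (tensor f g)"
  have "H.F.mtotally_bounded (?T ` H.unit_ball)"
    unfolding H.F.mtotally_bounded_sequentially
  proof (intro conjI allI impI)
    show "?T ` H.unit_ball \<subseteq> vecs (L2 N)"
      using H.linear_onD(1)[OF HS_linear[OF tensor_sqint[OF f g]]] by auto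
    fix s :: "nat \<Rightarrow> _" assume "range s \<subseteq> ?T ` H.unit_ball"
    then have "\<forall>n. \<exists>u. u \<in> H.unit_ball \<and> s n = ?T u" by (auto simp: image_subset_iff image_iff Bex_def)
    then have "\<forall>n. \<exists>h. h \<in> square_integrable M \<and> norm2 M h \<le> 1 \<and> s n = ?T (L2_class M h)"
      by (metis (mono_tags, lifting) mem_Collect_eq vecs_L2_cases vnorm_L2)
    then obtain h where h: "\<And>n. h n \<in> square_integrable M" "\<And>n. norm2 M (h n) \<le> 1"
      "\<And>n. s n = ?T (L2_class M (h n))" by metis
    define c where "c n = (\<integral>x. f x * h n x \<partial>M)" for n
    have s: "s n = L2_class N (\<lambda>y. c n * g y)" for n
      using h f g by (simp add: HS_operator_class kernel_apply_tensor c_def)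
    have "cmod (c n) \<le> norm2 M f" for n
    proof -
      have "cmod (c n) \<le> norm2 M f * norm2 M (h n)"
        unfolding c_def by (rule Cauchy_Schwarz_L2[OF f h(1)])
      also have "\<dots> \<le> norm2 M f * 1" using h(2) by (intro mult_left_mono) auto
      finally show ?thesis by simp
    qed
    then have "bounded (range c)" by (auto simp: bounded_iff)
    then obtain l r where r: "strict_mono (r :: nat \<Rightarrow> nat)" "(c \<circ> r) \<longlonglongrightarrow> l"
      using bounded_imp_convergent_subsequence by blast
    have "H.F.MCauchy (s \<circ> r)"
      unfolding H.F.MCauchy_def
    proof (intro conjI allI impI)
      show "range (s \<circ> r) \<subseteq> vecs (L2 N)" using s g by auto
      fix e :: real assume e: "e > 0"
      have d: "vdist (L2 N) ((s \<circ> r) n) ((s \<circ> r) m) = cmod (c (r n) - c (r m)) * norm2 N g" for n m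
        using g norm2_scale[of N "c (r n) - c (r m)" g] by (simp add: s left_diff_distrib)
      have g1: "norm2 N g + 1 > 0" using norm2_nonneg[of N g] by linarith
      have "Cauchy (c \<circ> r)" using r(2) by (rule LIMSEQ_imp_Cauchy)
      then obtain K where K: "\<And>m n. m \<ge> K \<Longrightarrow> n \<ge> K \<Longrightarrow> cmod ((c \<circ> r) m - (c \<circ> r) n) < e / (norm2 N g + 1)"
        using CauchyD[of "c \<circ> r" "e / (norm2 N g + 1)"] e g1 by auto
      have "vdist (L2 N) ((s \<circ> r) n) ((s \<circ> r) m) < e" if "K \<le> n" "K \<le> m" for n m
      proof -
        have "cmod (c (r n) - c (r m)) * norm2 N g \<le> e / (norm2 N g + 1) * norm2 N g"
          using K[OF that] by (intro mult_right_mono) auto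
        also have "\<dots> < e" using e g1 by (simp add: field_simps)
        finally show ?thesis unfolding d .
      qed
      then show "\<exists>K. \<forall>n m. K \<le> n \<longrightarrow> K \<le> m \<longrightarrow> vdist (L2 N) ((s \<circ> r) n) ((s \<circ> r) m) < e" by blast
    qed
    then show "\<exists>r. strict_mono r \<and> H.F.MCauchy (s \<circ> r)" using r(1) by blast
  qed
  then show ?thesis
    using f g HS_extensional HS_linear by (simp add: compact_kernels_def H.compact_operators_iff)
qed

lemma sqint_indicator:
  assumes "A \<in> sets Q" "emeasure Q A < \<infinity>"
  shows "(indicator A :: _ \<Rightarrow> complex) \<in> square_integrable Q"
proof -
  have "(\<lambda>x. (cmod (indicator A x))\<^sup>2) = (\<lambda>x. indicator A x :: real)"
    by (auto simp: indicator_def)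
  then show ?thesis
    using assms by (simp add: square_integrable_def integrable_indicator_iff)
qed

text \<open>Measurable sets are generated by rectangles. The intersection with a fixed rectangle of finite
  measure keeps complements and countable unions square-integrable.\<close>

lemma indicator_compact_kernel:
  assumes E: "E \<in> sets P" and A: "A \<in> sets M" "emeasure M A < \<infinity>" and B: "B \<in> sets N" "emeasure N B < \<infinity>"
  shows "(indicator (E \<inter> A \<times> B) :: _ \<Rightarrow> complex) \<in> compact_kernels"
proof -
  have rect: "(indicator (A' \<times> B') :: _ \<Rightarrow> complex) \<in> compact_kernels"
    if "A' \<in> sets M" "B' \<in> sets N" "emeasure M A' < \<infinity>" "emeasure N B' < \<infinity>" for A' B'
  proof -
    have "tensor (indicator A') (indicator B') = (indicator (A' \<times> B') :: _ \<Rightarrow> complex)"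
      by (auto simp: tensor_def indicator_def fun_eq_iff)
    then show ?thesis using tensor_compact_kernel[OF sqint_indicator sqint_indicator, of A' B'] that by simp
  qed
  have AB: "A \<times> B \<in> sets P" "A \<times> B \<subseteq> space P"
    using A B sets.sets_into_space[OF A(1)] sets.sets_into_space[OF B(1)] by (auto simp: space_pair_measure)
  have box: "(indicator (A \<times> B) :: _ \<Rightarrow> complex) \<in> compact_kernels"
    using rect[OF A(1) B(1)] A B by simp
  show ?thesis
    using Int_stable_pair_measure_generator pair_measure_closed E
    unfolding sets_pair_measure
  proof (induct rule: sigma_sets_induct_disjoint)
    case (basic E)
    then obtain a b where ab: "E = a \<times> b" "a \<in> sets M" "b \<in> sets N" by auto
    have "emeasure M (a \<inter> A) < \<infinity>" "emeasure N (b \<inter> B) < \<infinity>"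
      using emeasure_mono[of "a \<inter> A" A M] emeasure_mono[of "b \<inter> B" B N] A B by (auto simp: le_less_trans)
    then show ?case using rect[of "a \<inter> A" "b \<inter> B"] ab A B by (simp add: Times_Int_Times)
  next
    case empty
    show ?case using compact_kernels_scale[OF box, of 0] by simp
  next
    case (compl E)
    have "(indicator ((space M \<times> space N - E) \<inter> A \<times> B) :: _ \<Rightarrow> complex)
        = (\<lambda>z. indicator (A \<times> B) z + (-1) * indicator (E \<inter> A \<times> B) z)"
      using AB(2) by (auto simp: indicator_def fun_eq_iff space_pair_measure)
    then show ?case using compact_kernels_add[OF box compact_kernels_scale[OF compl(2)], of "-1"] by simp
  next
    case (union E)
    have Em: "E n \<in> sets P" for n using union(2) by (auto simp: sets_pair_measure)
    define U where "U n = (\<Union>i<n. E i)" for n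
    have Um [measurable]: "U n \<in> sets P" for n using Em by (auto simp: U_def)
    have part: "(indicator (U n \<inter> A \<times> B) :: _ \<Rightarrow> complex) \<in> compact_kernels" for n
    proof (induction n)
      case 0
      show ?case using compact_kernels_scale[OF box, of 0] by (simp add: U_def)
    next
      case (Suc n)
      have "E i \<inter> E n = {}" if "i < n" for i
        using union(1) that by (simp add: disjoint_family_on_def)
      then have "U n \<inter> E n = {}" unfolding U_def by blast
      then have "(indicator (U (Suc n) \<inter> A \<times> B) :: _ \<Rightarrow> complex)
          = (\<lambda>z. indicator (U n \<inter> A \<times> B) z + indicator (E n \<inter> A \<times> B) z)"
        by (auto simp: U_def indicator_def fun_eq_iff lessThan_Suc)
      then show ?case using compact_kernels_add[OF Suc union(3)[of n]] by simp
    qed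
    have E_meas: "(\<Union>(range E)) \<inter> A \<times> B \<in> sets P" using Em AB by auto
    show ?case
    proof (rule compact_kernels_limit[OF part])
      have "emeasure P ((\<Union>(range E)) \<inter> A \<times> B) \<le> emeasure P (A \<times> B)"
        using AB by (intro emeasure_mono) auto
      also have "\<dots> < \<infinity>" using A B by (simp add: M2.emeasure_pair_measure_Times ennreal_mult_less_top)
      finally show "(indicator ((\<Union>(range E)) \<inter> A \<times> B) :: _ \<Rightarrow> complex) \<in> square_integrable P"
        using E_meas by (intro sqint_indicator)
      show "(\<lambda>n. norm2 P (\<lambda>z. indicator (U n \<inter> A \<times> B) z - indicator ((\<Union>(range E)) \<inter> A \<times> B) z)) \<longlonglongrightarrow> 0"
      proof (rule norm2_dominated_convergence[where c = 1])
        show "(indicator (A \<times> B) :: _ \<Rightarrow> complex) \<in> square_integrable P"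
          using box by (simp add: compact_kernels_def)
        show "AE z in P. cmod (indicator (U n \<inter> A \<times> B) z - indicator ((\<Union>(range E)) \<inter> A \<times> B) z) \<le>
            1 * cmod (indicator (A \<times> B) z)" for n
          by (rule AE_I2) (auto simp: indicator_def U_def)
        show "AE z in P. (\<lambda>n. indicator (U n \<inter> A \<times> B) z :: complex) \<longlonglongrightarrow> indicator ((\<Union>(range E)) \<inter> A \<times> B) z"
        proof (rule AE_I2)
          fix z
          show "(\<lambda>n. indicator (U n \<inter> A \<times> B) z :: complex) \<longlonglongrightarrow> indicator ((\<Union>(range E)) \<inter> A \<times> B) z"
          proof (cases "z \<in> (\<Union>(range E)) \<inter> A \<times> B")
            case True
            then obtain i where i: "z \<in> E i" "z \<in> A \<times> B" by auto
            have "\<forall>n\<ge>Suc i. (indicator (U n \<inter> A \<times> B) z :: complex) = 1"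
              using i by (auto simp: U_def indicator_def)
            then have "\<forall>\<^sub>F n in sequentially. (indicator (U n \<inter> A \<times> B) z :: complex) = 1"
              unfolding eventually_sequentially by blast
            then show ?thesis using True by (simp add: tendsto_eventually)
          next
            case False
            then show ?thesis by (auto simp: U_def indicator_def intro!: tendsto_eventually)
          qed
        qed
      qed (use AB E_meas in \<open>auto intro!: borel_measurable_indicator\<close>)
    qed
  qed
qed

lemma exhausting_rectangles:
  obtains A B where "\<And>i::nat. A i \<in> sets M" "\<And>i. emeasure M (A i) < \<infinity>" "incseq A" "(\<Union>i. A i) = space M"
    "\<And>i. B i \<in> sets N" "\<And>i. emeasure N (B i) < \<infinity>" "incseq B" "(\<Union>i. B i) = space N"
proof -
  obtain A where "range A \<subseteq> sets M" "(\<Union>i. A i) = space M" "\<And>i. emeasure M (A i) \<noteq> \<infinity>" "incseq A"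
    using M1.sigma_finite_incseq by blast
  moreover obtain B where "range B \<subseteq> sets N" "(\<Union>i. B i) = space N" "\<And>i. emeasure N (B i) \<noteq> \<infinity>" "incseq B"
    using M2.sigma_finite_incseq by blast
  ultimately show ?thesis by (intro that[of A B]) (auto simp: less_top)
qed

lemma eventually_in_rectangles:
  assumes "incseq A" "(\<Union>i. A i) = space M" "incseq B" "(\<Union>i. B i) = space N" "z \<in> space P"
  shows "\<forall>\<^sub>F i in sequentially. z \<in> A i \<times> B i"
proof -
  have "fst z \<in> (\<Union>i. A i)" "snd z \<in> (\<Union>i. B i)" using assms by (auto simp: space_pair_measure)
  then obtain i j where "fst z \<in> A i" "snd z \<in> B j" by blast
  then have "z \<in> A n \<times> B n" if "n \<ge> max i j" for n
    using that incseqD[OF assms(1), of i n] incseqD[OF assms(3), of j n] by (auto simp: mem_Times_iff)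
  then show ?thesis unfolding eventually_sequentially by blast
qed

text \<open>Simple functions cut off to an exhausting sequence of rectangles approximate the kernel in \<open>L\<^sup>2\<close>.\<close>

theorem sqint_compact_kernels:
  assumes k: "k \<in> square_integrable P"
  shows "k \<in> compact_kernels"
proof -
  note [measurable] = sqint_measurable[OF k]
  obtain A B where AB: "\<And>i::nat. A i \<in> sets M" "\<And>i. emeasure M (A i) < \<infinity>" "incseq A" "(\<Union>i. A i) = space M"
    "\<And>i. B i \<in> sets N" "\<And>i. emeasure N (B i) < \<infinity>" "incseq B" "(\<Union>i. B i) = space N"
    using exhausting_rectangles by blast
  obtain s where s: "\<And>i. simple_function P (s i)" "\<And>z. z \<in> space P \<Longrightarrow> (\<lambda>i. s i z) \<longlonglongrightarrow> k z"
    "\<And>i z. z \<in> space P \<Longrightarrow> cmod (s i z) \<le> 2 * cmod (k z)"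
  proof -
    have "\<exists>s. (\<forall>i. simple_function P (s i)) \<and> (\<forall>z\<in>space P. (\<lambda>i. s i z) \<longlonglongrightarrow> k z) \<and>
        (\<forall>i. \<forall>z\<in>space P. cmod (s i z) \<le> 2 * cmod (k z))"
      using borel_measurable_implies_sequence_metric[of k P 0] by simp
    then show ?thesis using that by metis
  qed
  define l where "l i z = (\<Sum>c\<in>s i ` space P. c * indicator (s i -` {c} \<inter> space P \<inter> A i \<times> B i) z)" for i z
  have fin: "finite (s i ` space P)" and sm: "s i -` {c} \<inter> space P \<in> sets P" for i c
    using simple_functionD[OF s(1)[of i]] by auto
  have zero: "(\<lambda>_. 0) \<in> compact_kernels"
    using compact_kernels_scale[OF indicator_compact_kernel[OF sets.empty_sets AB(1,2,5,6)], of 0] by simp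
  have l_compact: "l i \<in> compact_kernels" for i
  proof -
    have "(\<lambda>z. \<Sum>c\<in>C. c * indicator (s i -` {c} \<inter> space P \<inter> A i \<times> B i) z) \<in> compact_kernels" if "finite C" for C
      using that
    proof induction
      case (insert c C)
      have "(\<lambda>z. c * indicator (s i -` {c} \<inter> space P \<inter> A i \<times> B i) z) \<in> compact_kernels"
        by (intro compact_kernels_scale indicator_compact_kernel sm AB)
      from compact_kernels_add[OF this insert.IH] show ?case
        by (simp only: sum.insert[OF insert.hyps(1,2)])
    qed (simp add: zero)
    moreover have "l i = (\<lambda>z. \<Sum>c\<in>s i ` space P. c * indicator (s i -` {c} \<inter> space P \<inter> A i \<times> B i) z)"
      by (simp only: l_def fun_eq_iff) simp
    ultimately show ?thesis using fin[of i] by simp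
  qed
  have l_eq: "l i z = indicator (A i \<times> B i) z * s i z" if z: "z \<in> space P" for i z
  proof -
    have "l i z = (\<Sum>c\<in>s i ` space P. if c = s i z then c * indicator (A i \<times> B i) z else 0)"
      unfolding l_def using z by (intro sum.cong) (auto simp: indicator_def)
    also have "\<dots> = indicator (A i \<times> B i) z * s i z" using z fin[of i] by simp
    finally show ?thesis .
  qed
  have l_sq: "l i \<in> square_integrable P" for i using l_compact[of i] by (simp add: compact_kernels_def)
  have "(\<lambda>i. norm2 P (\<lambda>z. l i z - k z)) \<longlonglongrightarrow> 0"
  proof (rule norm2_dominated_convergence[OF _ _ k, where c = 3])
    show "l i \<in> borel_measurable P" for i using l_sq by (rule sqint_measurable)
    show "AE z in P. (\<lambda>i. l i z) \<longlonglongrightarrow> k z"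
    proof (rule AE_I2)
      fix z assume z: "z \<in> space P"
      have "\<forall>\<^sub>F i in sequentially. s i z = l i z"
        using eventually_in_rectangles[OF AB(3,4,7,8) z] by eventually_elim (use l_eq[OF z] in auto)
      then show "(\<lambda>i. l i z) \<longlonglongrightarrow> k z" using s(2)[OF z] by (rule Lim_transform_eventually[rotated])
    qed
    show "AE z in P. cmod (l i z - k z) \<le> 3 * cmod (k z)" for i
    proof (rule AE_I2)
      fix z assume z: "z \<in> space P"
      have "cmod (l i z) \<le> 2 * cmod (k z)"
        unfolding l_eq[OF z] using s(3)[OF z, of i] by (auto simp: indicator_def)
      then show "cmod (l i z - k z) \<le> 3 * cmod (k z)" using norm_triangle_ineq4[of "l i z" "k z"] by simp
    qed
  qed simp
  then show ?thesis by (rule compact_kernels_limit[OF l_compact k])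
qed

lemma HS_compact [simp]:
  "k \<in> square_integrable P \<Longrightarrow> HS_operator M N k \<in> compact_operators (L2 M) (L2 N)"
  using sqint_compact_kernels by (simp add: compact_kernels_def)

lemma operator_norm_HS:
  assumes k: "k \<in> square_integrable P"
  shows "operator_norm (L2 M) (L2 N) (HS_operator M N k) = kernel_norm k"
proof (rule antisym)
  show "operator_norm (L2 M) (L2 N) (HS_operator M N k) \<le> kernel_norm k"
  proof (rule H.operator_norm_least)
    fix u assume u: "u \<in> H.unit_ball"
    then obtain f where f: "f \<in> square_integrable M" "u = L2_class M f" by (auto elim: vecs_L2_cases)
    have "vnorm (L2 N) (HS_operator M N k u) \<le> kernel_norm k * norm2 M f"
      using f k norm2_kernel_apply_le[OF k f(1)] by (simp add: HS_operator_class kernel_apply_sqint)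
    also have "\<dots> \<le> kernel_norm k * 1"
      using u f kernel_norm_nonneg[OF k] by (intro mult_left_mono) auto
    finally show "vnorm (L2 N) (HS_operator M N k u) \<le> kernel_norm k" by simp
  qed
  show "kernel_norm k \<le> operator_norm (L2 M) (L2 N) (HS_operator M N k)"
  proof (rule kernel_norm_least)
    fix f g assume f: "f \<in> square_integrable M" "norm2 M f \<le> 1" and g: "g \<in> square_integrable N" "norm2 N g \<le> 1"
    have "cmod (pairing k f g) \<le> norm2 N (kernel_apply k f) * norm2 N g"
      unfolding pairing_eq_kernel_apply[OF k f(1) g(1)]
      by (rule Cauchy_Schwarz_L2[OF kernel_apply_sqint[OF k f(1)] g(1)])
    also have "\<dots> \<le> norm2 N (kernel_apply k f) * 1" using g by (intro mult_left_mono) auto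
    also have "\<dots> = vnorm (L2 N) (HS_operator M N k (L2_class M f))"
      using f k by (simp add: HS_operator_class kernel_apply_sqint)
    also have "\<dots> \<le> operator_norm (L2 M) (L2 N) (HS_operator M N k)"
      using f k by (intro H.operator_norm_upper_unit_ball) auto
    finally show "cmod (pairing k f g) \<le> operator_norm (L2 M) (L2 N) (HS_operator M N k)" .
  qed
qed

lemma vdist_HS:
  assumes k: "k \<in> square_integrable P" and l: "l \<in> square_integrable P"
  shows "vdist H.K (HS_operator M N k) (HS_operator M N l) = kernel_norm (\<lambda>z. k z - l z)"
proof -
  have "H.K.sub (HS_operator M N k) (HS_operator M N l) = HS_operator M N (\<lambda>z. k z + (-1) * l z)"
    using HS_add[OF k sqint_scale[OF l, of "-1"]] HS_scale[OF l, of "-1"] by simp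
  then have "vnorm H.K (H.K.sub (HS_operator M N k) (HS_operator M N l)) = kernel_norm (\<lambda>z. k z - l z)"
    using operator_norm_HS[OF sqint_diff[OF k l]] by simp
  then show ?thesis using k l H.K.dist_eq[of "HS_operator M N k" "HS_operator M N l"] by simp
qed

end

section \<open>Closability in terms of kernels\<close>

context measure_pair
begin

text \<open>Operators are compared through their kernels: a Cauchy sequence for \<open>kernel_norm\<close> has a limit among
  the compact operators, but that limit need not have a kernel.\<close>

definition kernel_Cauchy :: "(nat \<Rightarrow> 'a \<times> 'b \<Rightarrow> complex) \<Rightarrow> bool" where
  "kernel_Cauchy r \<longleftrightarrow> (\<forall>e>0. \<exists>L. \<forall>m\<ge>L. \<forall>n\<ge>L. kernel_norm (\<lambda>z. r m z - r n z) < e)"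

definition kernel_closable :: "('a \<times> 'b \<Rightarrow> complex) \<Rightarrow> bool" where
  "kernel_closable \<phi> \<longleftrightarrow> (\<forall>k. (\<forall>n. k n \<in> multiplier_kernels M N \<phi>) \<longrightarrow>
     (\<lambda>n. kernel_norm (k n)) \<longlonglongrightarrow> 0 \<longrightarrow> kernel_Cauchy (\<lambda>n z. \<phi> z * k n z) \<longrightarrow>
     (\<lambda>n. kernel_norm (\<lambda>z. \<phi> z * k n z)) \<longlonglongrightarrow> 0)"

lemma multiplier_kernelsD:
  assumes "k \<in> multiplier_kernels M N \<phi>"
  shows "k \<in> square_integrable P" "(\<lambda>z. \<phi> z * k z) \<in> square_integrable P"
  using assms by (auto simp: multiplier_kernels_def)

text \<open>Completeness of the space of compact operators turns a Cauchy sequence \<open>(\<phi> k\<^sub>n)\<close> into a point of the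
  closure of the graph above 0.\<close>

lemma closable_multipliers_iff:
  "\<phi> \<in> closable_multipliers M N \<longleftrightarrow> \<phi> \<in> borel_measurable P \<and> kernel_closable \<phi>"
proof -
  interpret KK: normed_carriers H.K H.K by unfold_locales
  let ?G = "multiplier_graph M N \<phi>" and ?HS = "HS_operator M N"
  have G_iff: "(u, v) \<in> ?G \<longleftrightarrow> (\<exists>k\<in>multiplier_kernels M N \<phi>. u = ?HS k \<and> v = ?HS (\<lambda>z. \<phi> z * k z))" for u v
    by (auto simp: multiplier_graph_def)
  have zero: "H.K.zero = ?HS (\<lambda>_. 0)"
    using H.K.zero_eq[of "?HS (\<lambda>_. 0)"] HS_scale[OF sqint_zero, of 0] by simp
  have "closable_graph H.K H.K ?G \<longleftrightarrow>
    (\<forall>s t w. (\<forall>n::nat. (s n, t n) \<in> ?G) \<longrightarrow> (\<lambda>n. vnorm H.K (s n)) \<longlonglongrightarrow> 0 \<longrightarrow>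
       w \<in> vecs H.K \<longrightarrow> (\<lambda>n. vdist H.K (t n) w) \<longlonglongrightarrow> 0 \<longrightarrow> w = H.K.zero)"
  proof (rule KK.closable_graph_iff_sequences)
    show "?G \<subseteq> vecs H.K \<times> vecs H.K"
      using multiplier_kernelsD by (auto simp: multiplier_graph_def)
    have "(\<lambda>_. 0) \<in> multiplier_kernels M N \<phi>" by (simp add: multiplier_kernels_def)
    then show "?G \<noteq> {}" by (auto simp: multiplier_graph_def)
  next
    fix u v u' v' assume "(u, v) \<in> ?G" "(u', v') \<in> ?G"
    then obtain k l where k: "k \<in> multiplier_kernels M N \<phi>" "u = ?HS k" "v = ?HS (\<lambda>z. \<phi> z * k z)"
      and l: "l \<in> multiplier_kernels M N \<phi>" "u' = ?HS l" "v' = ?HS (\<lambda>z. \<phi> z * l z)"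
      unfolding G_iff by auto
    note kD = multiplier_kernelsD[OF k(1)] and lD = multiplier_kernelsD[OF l(1)]
    have "(\<lambda>z. k z + l z) \<in> multiplier_kernels M N \<phi>"
      using kD lD sqint_add[OF kD(2) lD(2)] by (simp add: multiplier_kernels_def distrib_left)
    moreover have "vadd H.K u u' = ?HS (\<lambda>z. k z + l z)"
      unfolding k l by (rule HS_add[OF kD(1) lD(1), symmetric])
    moreover have "vadd H.K v v' = ?HS (\<lambda>z. \<phi> z * (k z + l z))"
      unfolding k l distrib_left by (rule HS_add[OF kD(2) lD(2), symmetric])
    ultimately show "(vadd H.K u u', vadd H.K v v') \<in> ?G" unfolding G_iff by blast
  next
    fix u v c assume "(u, v) \<in> ?G"
    then obtain k where k: "k \<in> multiplier_kernels M N \<phi>" "u = ?HS k" "v = ?HS (\<lambda>z. \<phi> z * k z)"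
      unfolding G_iff by auto
    note kD = multiplier_kernelsD[OF k(1)]
    have "(\<lambda>z. c * k z) \<in> multiplier_kernels M N \<phi>"
      using kD sqint_scale[OF kD(2), of c] by (simp add: multiplier_kernels_def mult.left_commute)
    moreover have "vscale H.K c u = ?HS (\<lambda>z. c * k z)"
      unfolding k by (rule HS_scale[OF kD(1), symmetric])
    moreover have "vscale H.K c v = ?HS (\<lambda>z. \<phi> z * (c * k z))"
      using HS_scale[OF kD(2), of c] unfolding k by (simp only: mult.left_commute)
    ultimately show "(vscale H.K c u, vscale H.K c v) \<in> ?G" unfolding G_iff by blast
  qed
  also have "\<dots> \<longleftrightarrow> kernel_closable \<phi>"
  proof
    assume lim: "\<forall>s t w. (\<forall>n::nat. (s n, t n) \<in> ?G) \<longrightarrow> (\<lambda>n. vnorm H.K (s n)) \<longlonglongrightarrow> 0 \<longrightarrow>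
       w \<in> vecs H.K \<longrightarrow> (\<lambda>n. vdist H.K (t n) w) \<longlonglongrightarrow> 0 \<longrightarrow> w = H.K.zero"
    show "kernel_closable \<phi>"
      unfolding kernel_closable_def
    proof (intro allI impI)
      fix k assume k: "\<forall>n. k n \<in> multiplier_kernels M N \<phi>" and k0: "(\<lambda>n. kernel_norm (k n)) \<longlonglongrightarrow> 0"
        and Cau: "kernel_Cauchy (\<lambda>n z. \<phi> z * k n z)"
      note kD = multiplier_kernelsD[OF k[rule_format]]
      define t where "t n = ?HS (\<lambda>z. \<phi> z * k n z)" for n
      have tc: "t n \<in> vecs H.K" for n using kD(2) by (simp add: t_def)
      have "H.K.MCauchy t"
        unfolding H.K.MCauchy_def
      proof (intro conjI allI impI)
        fix e :: real assume "e > 0"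
        then show "\<exists>L. \<forall>n n'. L \<le> n \<longrightarrow> L \<le> n' \<longrightarrow> vdist H.K (t n) (t n') < e"
          using Cau unfolding kernel_Cauchy_def t_def by (simp add: vdist_HS[OF kD(2) kD(2)])
      qed (use tc in auto)
      then obtain w where "limitin H.K.mtopology t w sequentially"
        using H.compact_operators_complete unfolding H.K.mcomplete_def by blast
      then have w: "w \<in> vecs H.K" "(\<lambda>n. vdist H.K (t n) w) \<longlonglongrightarrow> 0"
        unfolding H.K.limitin_metric_dist_null by auto
      have "w = H.K.zero"
      proof (rule lim[rule_format, OF _ _ w])
        show "(?HS (k n), t n) \<in> ?G" for n unfolding G_iff t_def using k by blast
        show "(\<lambda>n. vnorm H.K (?HS (k n))) \<longlonglongrightarrow> 0" using k0 kD(1) by (simp add: operator_norm_HS)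
      qed
      then have "(\<lambda>n. vnorm H.K (t n)) \<longlonglongrightarrow> 0" using w(2) tc by (simp only: H.K.dist_zero)
      then show "(\<lambda>n. kernel_norm (\<lambda>z. \<phi> z * k n z)) \<longlonglongrightarrow> 0"
        using kD(2) by (simp add: t_def operator_norm_HS)
    qed
  next
    assume cl: "kernel_closable \<phi>"
    show "\<forall>s t w. (\<forall>n::nat. (s n, t n) \<in> ?G) \<longrightarrow> (\<lambda>n. vnorm H.K (s n)) \<longlonglongrightarrow> 0 \<longrightarrow>
       w \<in> vecs H.K \<longrightarrow> (\<lambda>n. vdist H.K (t n) w) \<longlonglongrightarrow> 0 \<longrightarrow> w = H.K.zero"
    proof (intro allI impI)
      fix s t w
      assume G: "\<forall>n::nat. (s n, t n) \<in> ?G" and s0: "(\<lambda>n. vnorm H.K (s n)) \<longlonglongrightarrow> 0"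
        and w: "w \<in> vecs H.K" and tw: "(\<lambda>n. vdist H.K (t n) w) \<longlonglongrightarrow> 0"
      obtain k where k: "\<And>n. k n \<in> multiplier_kernels M N \<phi>" "\<And>n. s n = ?HS (k n)"
        "\<And>n. t n = ?HS (\<lambda>z. \<phi> z * k n z)"
        using G unfolding G_iff by metis
      note kD = multiplier_kernelsD[OF k(1)]
      have tc: "t n \<in> vecs H.K" for n using kD(2) by (simp add: k)
      have "limitin H.K.mtopology t w sequentially"
        unfolding H.K.limitin_metric_dist_null using w tw tc by auto
      then have "H.K.MCauchy t"
        by (rule H.K.convergent_imp_MCauchy[rotated]) (use tc in auto)
      then have "kernel_Cauchy (\<lambda>n z. \<phi> z * k n z)"
        unfolding kernel_Cauchy_def H.K.MCauchy_def using vdist_HS[OF kD(2) kD(2)] by (simp add: k)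
      moreover have "(\<lambda>n. kernel_norm (k n)) \<longlonglongrightarrow> 0" using s0 kD(1) by (simp add: k operator_norm_HS)
      ultimately have "(\<lambda>n. kernel_norm (\<lambda>z. \<phi> z * k n z)) \<longlonglongrightarrow> 0"
        using cl k(1) unfolding kernel_closable_def by blast
      then have t0: "(\<lambda>n. vnorm H.K (t n)) \<longlonglongrightarrow> 0" using kD(2) by (simp add: k operator_norm_HS)
      have "(\<lambda>n. vdist H.K (t n) w + vnorm H.K (t n)) \<longlonglongrightarrow> 0 + 0" by (rule tendsto_add[OF tw t0])
      moreover have "vnorm H.K w \<le> vdist H.K (t n) w + vnorm H.K (t n)" for n
        using H.K.norm_le_dist[OF w tc, of n] H.K.commute[of w "t n"] by simp
      ultimately have "vnorm H.K w \<le> 0" by (intro LIMSEQ_le_const[of _ 0]) auto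
      then have "vnorm H.K w = 0" using H.K.norm_nonneg[OF w] by linarith
      then show "w = H.K.zero" using H.K.norm_eq_zero[OF w] by blast
    qed
  qed
  finally show ?thesis
    by (simp add: closable_multipliers_def measurable_functions_def)
qed

end

section \<open>Schur multipliers with integrable bounds\<close>

lemma sqint_bounded_mult:
  assumes f: "f \<in> square_integrable M" and [measurable]: "g \<in> borel_measurable M" and b: "\<And>x. cmod (g x) \<le> c"
  shows "(\<lambda>x. g x * f x) \<in> square_integrable M"
proof (rule sqint_bounded_by[OF f, where c = c])
  show "(\<lambda>x. g x * f x) \<in> borel_measurable M" using sqint_measurable[OF f] by measurable
qed (use b in \<open>auto simp: norm_mult intro!: mult_right_mono\<close>)

lemma integrable_mult_bounded_square:
  fixes a :: "'a \<Rightarrow> real" and f :: "'a \<Rightarrow> complex"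
  assumes a: "integrable M a" and [measurable]: "f \<in> borel_measurable M" and b: "bounded (range f)"
  shows "integrable M (\<lambda>x. a x * (cmod (f x))\<^sup>2)"
proof -
  obtain c where c: "\<And>x. cmod (f x) \<le> c" using b by (auto simp: bounded_iff)
  have c0: "0 \<le> c" using order_trans[OF norm_ge_zero c] .
  show ?thesis
  proof (rule Bochner_Integration.integrable_bound)
    show "integrable M (\<lambda>x. c\<^sup>2 * a x)" using a by simp
    show "AE x in M. norm (a x * (cmod (f x))\<^sup>2) \<le> norm (c\<^sup>2 * a x)"
    proof (rule AE_I2)
      fix x
      have "(cmod (f x))\<^sup>2 \<le> c\<^sup>2" using c by (intro power_mono) auto
      then have "\<bar>a x\<bar> * (cmod (f x))\<^sup>2 \<le> \<bar>a x\<bar> * c\<^sup>2" by (intro mult_left_mono) auto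
      then show "norm (a x * (cmod (f x))\<^sup>2) \<le> norm (c\<^sup>2 * a x)" by (simp add: abs_mult mult.commute)
    qed
  qed (use a in measurable)
qed

context measure_pair
begin

text \<open>If \<open>\<psi> = u \<otimes> v\<close>, then multiplying a kernel \<open>k\<close> by \<open>\<psi>\<close> and pairing it with \<open>f \<otimes> g\<close> gives the pairing of \<open>k\<close>
  with \<open>u f \<otimes> v g\<close>, which is at most \<open>p(k) (\<integral>|u f|\<^sup>2)\<^sup>1\<^sup>/\<^sup>2 (\<integral>|v g|\<^sup>2)\<^sup>1\<^sup>/\<^sup>2\<close>. The relation \<open>dominated\<close> retains
  this estimate with densities \<open>a = |u|\<^sup>2\<close> and \<open>b = |v|\<^sup>2\<close>, in the arithmetic mean form that is linear in
  \<open>(\<psi>, a, b)\<close> and therefore survives convex combinations. Bounded test functions keep all integrals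
  finite.\<close>

definition form :: "('a \<times> 'b \<Rightarrow> complex) \<Rightarrow> ('a \<times> 'b \<Rightarrow> complex) \<Rightarrow> ('a \<Rightarrow> complex) \<Rightarrow> ('b \<Rightarrow> complex) \<Rightarrow> complex" where
  "form k \<psi> f g = (\<integral>z. k z * (\<psi> z * tensor f g z) \<partial>P)"

definition dominated :: "('a \<times> 'b \<Rightarrow> complex) \<Rightarrow> ('a \<Rightarrow> real) \<Rightarrow> ('b \<Rightarrow> real) \<Rightarrow> bool" where
  "dominated \<psi> a b \<longleftrightarrow> \<psi> \<in> square_integrable P \<and> integrable M a \<and> integrable N b \<and>
     (\<forall>x. 0 \<le> a x) \<and> (\<forall>y. 0 \<le> b y) \<and> (\<forall>x y. cmod (\<psi> (x, y)) \<le> (a x + b y) / 2) \<and>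
     (\<forall>k\<in>square_integrable P. \<forall>f\<in>borel_measurable M. \<forall>g\<in>borel_measurable N.
        bounded (range f) \<longrightarrow> bounded (range g) \<longrightarrow>
        Re (form k \<psi> f g) \<le> kernel_norm k / 2 * ((\<integral>x. a x * (cmod (f x))\<^sup>2 \<partial>M) + (\<integral>y. b y * (cmod (g y))\<^sup>2 \<partial>N)))"

lemma dominatedD:
  assumes "dominated \<psi> a b"
  shows "\<psi> \<in> square_integrable P" "integrable M a" "integrable N b" "0 \<le> a x" "0 \<le> b y"
    "cmod (\<psi> (x, y)) \<le> (a x + b y) / 2"
  using assms by (auto simp: dominated_def)

lemma dominated_form_le:
  assumes "dominated \<psi> a b" "k \<in> square_integrable P" "f \<in> borel_measurable M" "g \<in> borel_measurable N"
    "bounded (range f)" "bounded (range g)"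
  shows "Re (form k \<psi> f g) \<le> kernel_norm k / 2 * ((\<integral>x. a x * (cmod (f x))\<^sup>2 \<partial>M) + (\<integral>y. b y * (cmod (g y))\<^sup>2 \<partial>N))"
  using assms unfolding dominated_def by blast

lemma form_integrable:
  assumes k: "k \<in> square_integrable P" and p: "\<psi> \<in> square_integrable P"
    and fg [measurable]: "f \<in> borel_measurable M" "g \<in> borel_measurable N" and b: "bounded (range f)" "bounded (range g)"
  shows "integrable P (\<lambda>z. k z * (\<psi> z * tensor f g z))"
proof (rule sqint_integrable_mult[OF k])
  obtain c where c: "\<And>x. cmod (f x) \<le> c" using b by (auto simp: bounded_iff)
  obtain d where d: "\<And>x. cmod (g x) \<le> d" using b by (auto simp: bounded_iff)
  have "cmod (tensor f g z) \<le> c * d" for z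
    unfolding tensor_def norm_mult using c d order_trans[OF norm_ge_zero c] by (intro mult_mono) auto
  from sqint_bounded_mult[OF p tensor_measurable[OF fg] this]
  show "(\<lambda>z. \<psi> z * tensor f g z) \<in> square_integrable P" by (simp add: mult.commute)
qed

lemma dominated_tensor:
  assumes u: "u \<in> square_integrable M" and v: "v \<in> square_integrable N"
  shows "dominated (tensor u v) (\<lambda>x. (cmod (u x))\<^sup>2) (\<lambda>y. (cmod (v y))\<^sup>2)"
  unfolding dominated_def
proof (intro conjI ballI allI impI)
  fix x y
  show "cmod (tensor u v (x, y)) \<le> ((cmod (u x))\<^sup>2 + (cmod (v y))\<^sup>2) / 2"
    using sum_squares_bound[of "cmod (u x)" "cmod (v y)"] by (simp add: tensor_def norm_mult)
next
  fix k and f :: "'a \<Rightarrow> complex" and g :: "'b \<Rightarrow> complex"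
  assume k: "k \<in> square_integrable P" and fg: "f \<in> borel_measurable M" "g \<in> borel_measurable N"
    and b: "bounded (range f)" "bounded (range g)"
  obtain c where c: "\<And>x. cmod (f x) \<le> c" using b by (auto simp: bounded_iff)
  obtain d where d: "\<And>x. cmod (g x) \<le> d" using b by (auto simp: bounded_iff)
  let ?f = "\<lambda>x. f x * u x" and ?g = "\<lambda>y. g y * v y"
  have f: "?f \<in> square_integrable M" by (rule sqint_bounded_mult[OF u fg(1) c])
  have g: "?g \<in> square_integrable N" by (rule sqint_bounded_mult[OF v fg(2) d])
  have "form k (tensor u v) f g = pairing k ?f ?g"
    unfolding form_def pairing_def by (intro Bochner_Integration.integral_cong) (auto simp: tensor_def)
  then have "Re (form k (tensor u v) f g) \<le> cmod (pairing k ?f ?g)"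
    using complex_Re_le_cmod by simp
  also have "\<dots> \<le> kernel_norm k * (norm2 M ?f * norm2 N ?g)"
    by (rule pairing_le_kernel_norm[OF k f g])
  also have "\<dots> \<le> kernel_norm k * (((norm2 M ?f)\<^sup>2 + (norm2 N ?g)\<^sup>2) / 2)"
    using sum_squares_bound[of "norm2 M ?f" "norm2 N ?g"] kernel_norm_nonneg[OF k]
    by (intro mult_left_mono) auto
  finally show "Re (form k (tensor u v) f g) \<le> kernel_norm k / 2 *
      ((\<integral>x. (cmod (u x))\<^sup>2 * (cmod (f x))\<^sup>2 \<partial>M) + (\<integral>y. (cmod (v y))\<^sup>2 * (cmod (g y))\<^sup>2 \<partial>N))"
    by (simp add: norm2_square norm_mult power_mult_distrib mult.commute)
qed (use u v in \<open>auto intro: sqint_integrable_square\<close>)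

lemma dominated_mono:
  assumes p: "dominated \<psi> a b" and a': "integrable M a'" "\<And>x. a x \<le> a' x" and b': "integrable N b'" "\<And>y. b y \<le> b' y"
  shows "dominated \<psi> a' b'"
  unfolding dominated_def
proof (intro conjI ballI allI impI)
  fix x y
  show "0 \<le> a' x" "0 \<le> b' y"
    using dominatedD(4)[OF p, of x] dominatedD(5)[OF p, of y] a'(2)[of x] b'(2)[of y] by linarith+
  show "cmod (\<psi> (x, y)) \<le> (a' x + b' y) / 2"
    by (rule order_trans[OF dominatedD(6)[OF p, of x y]]) (intro divide_right_mono add_mono a'(2) b'(2), simp)
next
  fix k and f :: "'a \<Rightarrow> complex" and g :: "'b \<Rightarrow> complex"
  assume k: "k \<in> square_integrable P" and fg: "f \<in> borel_measurable M" "g \<in> borel_measurable N"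
    and b: "bounded (range f)" "bounded (range g)"
  have "(\<integral>x. a x * (cmod (f x))\<^sup>2 \<partial>M) \<le> (\<integral>x. a' x * (cmod (f x))\<^sup>2 \<partial>M)"
    using dominatedD(2)[OF p] a' fg b
    by (intro integral_mono integrable_mult_bounded_square mult_right_mono) auto
  moreover have "(\<integral>y. b y * (cmod (g y))\<^sup>2 \<partial>N) \<le> (\<integral>y. b' y * (cmod (g y))\<^sup>2 \<partial>N)"
    using dominatedD(3)[OF p] b' fg b
    by (intro integral_mono integrable_mult_bounded_square mult_right_mono) auto
  ultimately have "kernel_norm k / 2 * ((\<integral>x. a x * (cmod (f x))\<^sup>2 \<partial>M) + (\<integral>y. b y * (cmod (g y))\<^sup>2 \<partial>N)) \<le>
      kernel_norm k / 2 * ((\<integral>x. a' x * (cmod (f x))\<^sup>2 \<partial>M) + (\<integral>y. b' y * (cmod (g y))\<^sup>2 \<partial>N))"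
    using kernel_norm_nonneg[OF k] by (intro mult_left_mono) auto
  with dominated_form_le[OF p k fg b]
  show "Re (form k \<psi> f g) \<le> kernel_norm k / 2 * ((\<integral>x. a' x * (cmod (f x))\<^sup>2 \<partial>M) + (\<integral>y. b' y * (cmod (g y))\<^sup>2 \<partial>N))"
    by linarith
qed (fact dominatedD(1)[OF p] a'(1) b'(1))+

lemma dominated_convex:
  assumes p: "dominated \<psi> a b" and p': "dominated \<psi>' a' b'" and s: "0 \<le> s" "0 \<le> t" "s + t = 1"
  shows "dominated (\<lambda>z. complex_of_real s * \<psi> z + complex_of_real t * \<psi>' z)
    (\<lambda>x. s * a x + t * a' x) (\<lambda>y. s * b y + t * b' y)"
  unfolding dominated_def
proof (intro conjI ballI allI impI)
  fix x y
  have "cmod (complex_of_real s * \<psi> (x, y) + complex_of_real t * \<psi>' (x, y)) \<le>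
      s * cmod (\<psi> (x, y)) + t * cmod (\<psi>' (x, y))"
    using norm_triangle_ineq[of "complex_of_real s * \<psi> (x, y)" "complex_of_real t * \<psi>' (x, y)"] s
    by (simp add: norm_mult)
  also have "\<dots> \<le> s * ((a x + b y) / 2) + t * ((a' x + b' y) / 2)"
    using s by (intro add_mono mult_left_mono dominatedD(6)[OF p] dominatedD(6)[OF p'])
  finally show "cmod (complex_of_real s * \<psi> (x, y) + complex_of_real t * \<psi>' (x, y)) \<le>
      (s * a x + t * a' x + (s * b y + t * b' y)) / 2"
    by (simp add: field_simps)
next
  fix k and f :: "'a \<Rightarrow> complex" and g :: "'b \<Rightarrow> complex"
  assume k: "k \<in> square_integrable P" and fg: "f \<in> borel_measurable M" "g \<in> borel_measurable N"
    and bd: "bounded (range f)" "bounded (range g)"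
  note i = form_integrable[OF k dominatedD(1)[OF p] fg bd] form_integrable[OF k dominatedD(1)[OF p'] fg bd]
  have "form k (\<lambda>z. complex_of_real s * \<psi> z + complex_of_real t * \<psi>' z) f g =
      (\<integral>z. complex_of_real s * (k z * (\<psi> z * tensor f g z)) + complex_of_real t * (k z * (\<psi>' z * tensor f g z)) \<partial>P)"
    unfolding form_def by (intro Bochner_Integration.integral_cong) (auto simp: algebra_simps)
  also have "\<dots> = complex_of_real s * form k \<psi> f g + complex_of_real t * form k \<psi>' f g"
    unfolding form_def using i by simp
  finally have "Re (form k (\<lambda>z. complex_of_real s * \<psi> z + complex_of_real t * \<psi>' z) f g) =
      s * Re (form k \<psi> f g) + t * Re (form k \<psi>' f g)" by simp
  also have "\<dots> \<le> s * (kernel_norm k / 2 * ((\<integral>x. a x * (cmod (f x))\<^sup>2 \<partial>M) + (\<integral>y. b y * (cmod (g y))\<^sup>2 \<partial>N))) +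
      t * (kernel_norm k / 2 * ((\<integral>x. a' x * (cmod (f x))\<^sup>2 \<partial>M) + (\<integral>y. b' y * (cmod (g y))\<^sup>2 \<partial>N)))"
    using s by (intro add_mono mult_left_mono dominated_form_le[OF p k fg bd] dominated_form_le[OF p' k fg bd])
  also have "\<dots> = kernel_norm k / 2 * ((\<integral>x. (s * a x + t * a' x) * (cmod (f x))\<^sup>2 \<partial>M) +
      (\<integral>y. (s * b y + t * b' y) * (cmod (g y))\<^sup>2 \<partial>N))"
  proof -
    have "(\<integral>x. (s * a x + t * a' x) * (cmod (f x))\<^sup>2 \<partial>M) =
        s * (\<integral>x. a x * (cmod (f x))\<^sup>2 \<partial>M) + t * (\<integral>x. a' x * (cmod (f x))\<^sup>2 \<partial>M)"
      using integrable_mult_bounded_square[OF dominatedD(2)[OF p] fg(1) bd(1)]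
        integrable_mult_bounded_square[OF dominatedD(2)[OF p'] fg(1) bd(1)]
      by (simp add: distrib_right mult.assoc)
    moreover have "(\<integral>y. (s * b y + t * b' y) * (cmod (g y))\<^sup>2 \<partial>N) =
        s * (\<integral>y. b y * (cmod (g y))\<^sup>2 \<partial>N) + t * (\<integral>y. b' y * (cmod (g y))\<^sup>2 \<partial>N)"
      using integrable_mult_bounded_square[OF dominatedD(3)[OF p] fg(2) bd(2)]
        integrable_mult_bounded_square[OF dominatedD(3)[OF p'] fg(2) bd(2)]
      by (simp add: distrib_right mult.assoc)
    ultimately show ?thesis by (simp add: algebra_simps)
  qed
  finally show "Re (form k (\<lambda>z. complex_of_real s * \<psi> z + complex_of_real t * \<psi>' z) f g) \<le>
    kernel_norm k / 2 * ((\<integral>x. (s * a x + t * a' x) * (cmod (f x))\<^sup>2 \<partial>M) +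
      (\<integral>y. (s * b y + t * b' y) * (cmod (g y))\<^sup>2 \<partial>N))" .
qed (use dominatedD(1-5)[OF p] dominatedD(1-5)[OF p'] s in \<open>simp_all add: sqint_add\<close>)

lemma dominated_integral_le:
  assumes p: "dominated \<psi> a b" and k: "k \<in> square_integrable P"
  shows "Re (\<integral>z. k z * \<psi> z \<partial>P) \<le> kernel_norm k / 2 * (integral\<^sup>L M a + integral\<^sup>L N b)"
proof -
  have "form k \<psi> (\<lambda>_. 1) (\<lambda>_. 1) = (\<integral>z. k z * \<psi> z \<partial>P)"
    by (simp only: form_def tensor_def mult_1_right)
  moreover have "(\<integral>x. a x * (cmod 1)\<^sup>2 \<partial>M) = integral\<^sup>L M a" "(\<integral>y. b y * (cmod 1)\<^sup>2 \<partial>N) = integral\<^sup>L N b"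
    by (simp_all only: norm_one power_one mult_1_right)
  ultimately show ?thesis
    using dominated_form_le[OF p k borel_measurable_const borel_measurable_const, of 1 1] 
      bounded_subset[of "{1::complex}" "range (\<lambda>_::'a. 1)"] bounded_subset[of "{1::complex}" "range (\<lambda>_::'b. 1)"]
    by (simp only: finite_imp_bounded finite.intros image_subset_iff singletonI ball_UNIV simp_thms)
qed

text \<open>The bound applied to the kernel \<open>cnj \<psi>\<close> reads \<open>\<parallel>\<psi>\<parallel>\<^sup>2 \<le> p(cnj \<psi>) (\<integral>a + \<integral>b) / 2\<close>, and \<open>p \<le> \<parallel>\<cdot>\<parallel>\<close>.\<close>

lemma dominated_norm2_le:
  assumes p: "dominated \<psi> a b"
  shows "2 * norm2 P \<psi> \<le> integral\<^sup>L M a + integral\<^sup>L N b"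
proof -
  note ps = dominatedD(1)[OF p]
  have I: "0 \<le> integral\<^sup>L M a + integral\<^sup>L N b"
    using dominatedD(4,5)[OF p] by (simp add: Bochner_Integration.integral_nonneg)
  have "cnj (\<psi> z) * \<psi> z = complex_of_real ((cmod (\<psi> z))\<^sup>2)" for z
    unfolding complex_norm_square by (rule mult.commute)
  then have "(\<integral>z. cnj (\<psi> z) * \<psi> z \<partial>P) = complex_of_real ((norm2 P \<psi>)\<^sup>2)"
    by (simp only: norm2_square integral_complex_of_real)
  then have "(norm2 P \<psi>)\<^sup>2 \<le> kernel_norm (\<lambda>z. cnj (\<psi> z)) / 2 * (integral\<^sup>L M a + integral\<^sup>L N b)"
    using dominated_integral_le[OF p sqint_cnj[OF ps]] by simp
  also have "\<dots> \<le> norm2 P \<psi> / 2 * (integral\<^sup>L M a + integral\<^sup>L N b)"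
    using kernel_norm_le_norm2[OF sqint_cnj[OF ps]] I by (intro mult_right_mono) auto
  finally show ?thesis
    using norm2_nonneg[of P \<psi>] I by (cases "norm2 P \<psi> = 0") (auto simp: power2_eq_square)
qed


text \<open>A single pair \<open>(a, b)\<close> controls both \<open>\<psi>\<close> and \<open>\<theta>\<close>. The value 2 leaves room for the sum of the
  densities of two elementary tensors.\<close>

definition feasible :: "('a \<times> 'b \<Rightarrow> complex) \<Rightarrow> ('a \<times> 'b \<Rightarrow> complex) \<Rightarrow> ('a \<Rightarrow> real) \<Rightarrow> ('b \<Rightarrow> real) \<Rightarrow> bool" where
  "feasible \<psi> \<theta> a b \<longleftrightarrow> dominated \<psi> a b \<and> dominated \<theta> a b \<and> integral\<^sup>L M a \<le> 2 \<and> integral\<^sup>L N b \<le> 2"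

lemma feasible_tensor:
  assumes "u \<in> square_integrable M" "v \<in> square_integrable N" "u' \<in> square_integrable M" "v' \<in> square_integrable N"
    and "norm2 M u \<le> 1" "norm2 N v \<le> 1" "norm2 M u' \<le> 1" "norm2 N v' \<le> 1"
  shows "feasible (tensor u v) (tensor u' v')
    (\<lambda>x. (cmod (u x))\<^sup>2 + (cmod (u' x))\<^sup>2) (\<lambda>y. (cmod (v y))\<^sup>2 + (cmod (v' y))\<^sup>2)"
proof -
  have "(norm2 M u)\<^sup>2 \<le> 1" "(norm2 N v)\<^sup>2 \<le> 1" "(norm2 M u')\<^sup>2 \<le> 1" "(norm2 N v')\<^sup>2 \<le> 1"
    using assms by (simp_all add: power_le_one)
  moreover note i = sqint_integrable_square[OF assms(1)] sqint_integrable_square[OF assms(2)]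
    sqint_integrable_square[OF assms(3)] sqint_integrable_square[OF assms(4)]
  ultimately show ?thesis
    unfolding feasible_def norm2_square
    by (intro conjI dominated_mono[OF dominated_tensor[OF assms(1,2)]] dominated_mono[OF dominated_tensor[OF assms(3,4)]])
      simp_all
qed

lemma feasible_convex:
  assumes "feasible \<psi> \<theta> a b" "feasible \<psi>' \<theta>' a' b'" and s: "0 \<le> s" "0 \<le> t" "s + t = 1"
  shows "feasible (\<lambda>z. complex_of_real s * \<psi> z + complex_of_real t * \<psi>' z)
    (\<lambda>z. complex_of_real s * \<theta> z + complex_of_real t * \<theta>' z)
    (\<lambda>x. s * a x + t * a' x) (\<lambda>y. s * b y + t * b' y)"
proof -
  have i: "integrable M a" "integrable M a'" "integrable N b" "integrable N b'"
    using assms(1,2) unfolding feasible_def by (blast dest: dominatedD(2,3))+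
  have le: "s * p + t * q \<le> 2" if "p \<le> 2" "q \<le> 2" for p q :: real
  proof -
    have "s * p + t * q \<le> s * 2 + t * 2" using that s by (intro add_mono mult_left_mono)
    also have "\<dots> = 2" using s(3) by (simp flip: distrib_right)
    finally show ?thesis .
  qed
  show ?thesis
    unfolding feasible_def
  proof (intro conjI dominated_convex s)
    show "(\<integral>x. s * a x + t * a' x \<partial>M) \<le> 2" "(\<integral>y. s * b y + t * b' y \<partial>N) \<le> 2"
      using assms i by (simp_all add: feasible_def le)
  qed (use assms in \<open>simp_all add: feasible_def\<close>)
qed

lemma feasibleD:
  assumes "feasible \<psi> \<theta> a b"
  shows "\<psi> \<in> square_integrable P" "\<theta> \<in> square_integrable P" "norm2 P \<psi> \<le> 2" "norm2 P \<theta> \<le> 2"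
    and "dominated \<psi> a b" "dominated \<theta> a b" "integral\<^sup>L M a \<le> 2" "integral\<^sup>L N b \<le> 2"
proof -
  have d: "dominated \<psi> a b" "dominated \<theta> a b" "integral\<^sup>L M a \<le> 2" "integral\<^sup>L N b \<le> 2"
    using assms by (simp_all add: feasible_def)
  then show "dominated \<psi> a b" "dominated \<theta> a b" "integral\<^sup>L M a \<le> 2" "integral\<^sup>L N b \<le> 2"
    by blast+
  show "\<psi> \<in> square_integrable P" "\<theta> \<in> square_integrable P"
    using dominatedD(1)[OF d(1)] dominatedD(1)[OF d(2)] by auto
  show "norm2 P \<psi> \<le> 2" "norm2 P \<theta> \<le> 2"
    using dominated_norm2_le[OF d(1)] dominated_norm2_le[OF d(2)] d(3,4) by linarith+
qed

lemma feasible_integral_le: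
  assumes f: "feasible \<psi> \<theta> a b" and k: "k \<in> square_integrable P"
  shows "Re (\<integral>z. k z * \<psi> z \<partial>P) \<le> 2 * kernel_norm k"
proof -
  have "Re (\<integral>z. k z * \<psi> z \<partial>P) \<le> kernel_norm k / 2 * (integral\<^sup>L M a + integral\<^sup>L N b)"
    by (rule dominated_integral_le[OF feasibleD(5)[OF f] k])
  also have "\<dots> \<le> kernel_norm k / 2 * 4"
    using feasibleD(7,8)[OF f] kernel_norm_nonneg[OF k] by (intro mult_left_mono) auto
  finally show ?thesis by simp
qed

end

lemma exists_near_minimiser:
  fixes J :: "'z \<Rightarrow> real"
  assumes "z0 \<in> Z" and bdd: "\<And>z. z \<in> Z \<Longrightarrow> B \<le> J z" and "\<eta> > 0"
  obtains z where "z \<in> Z" "\<And>z'. z' \<in> Z \<Longrightarrow> J z \<le> J z' + \<eta>"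
proof -
  have ne: "J ` Z \<noteq> {}" and bb: "bdd_below (J ` Z)" using assms by (auto intro!: bdd_belowI[of _ B])
  have "Inf (J ` Z) < Inf (J ` Z) + \<eta>" using \<open>\<eta> > 0\<close> by simp
  then obtain z where z: "z \<in> Z" "J z < Inf (J ` Z) + \<eta>"
    using cInf_lessD[OF ne] by blast
  have "J z \<le> J z' + \<eta>" if "z' \<in> Z" for z'
    using cINF_lower[OF bb that] z(2) by linarith
  with z(1) that show ?thesis by blast
qed

lemma norm2_square_add:
  assumes e: "e \<in> square_integrable M" and h: "h \<in> square_integrable M"
  shows "(norm2 M (\<lambda>x. e x + complex_of_real s * h x))\<^sup>2 =
    (norm2 M e)\<^sup>2 + 2 * s * Re (\<integral>x. cnj (e x) * h x \<partial>M) + s\<^sup>2 * (norm2 M h)\<^sup>2"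
proof -
  have i: "integrable M (\<lambda>x. cnj (e x) * h x)" by (rule sqint_integrable_mult[OF sqint_cnj[OF e] h])
  have "(cmod (e x + complex_of_real s * h x))\<^sup>2 =
      (cmod (e x))\<^sup>2 + (2 * s * Re (cnj (e x) * h x) + s\<^sup>2 * (cmod (h x))\<^sup>2)" for x
    unfolding cmod_power2 by (simp add: power2_eq_square algebra_simps)
  then have "(norm2 M (\<lambda>x. e x + complex_of_real s * h x))\<^sup>2 =
      (\<integral>x. (cmod (e x))\<^sup>2 + (2 * s * Re (cnj (e x) * h x) + s\<^sup>2 * (cmod (h x))\<^sup>2) \<partial>M)"
    by (simp add: norm2_square)
  also have "\<dots> = (norm2 M e)\<^sup>2 + (2 * s * (\<integral>x. Re (cnj (e x) * h x) \<partial>M) + s\<^sup>2 * (norm2 M h)\<^sup>2)"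
    using sqint_integrable_square[OF e] sqint_integrable_square[OF h] integrable_Re[OF i]
    by (simp add: norm2_square)
  also have "(\<integral>x. Re (cnj (e x) * h x) \<partial>M) = Re (\<integral>x. cnj (e x) * h x \<partial>M)"
    using integral_Re[OF i] .
  finally show ?thesis by simp
qed


section \<open>Separation by a pair of multipliers\<close>

text \<open>The weight makes \<open>w (\<phi> \<psi> - \<theta>)\<close> square-integrable for all square-integrable \<open>\<psi>, \<theta>\<close>, and its
  product with a further factor \<open>w\<close> is a kernel in the domain of \<open>\<phi>\<close>, since both \<open>w\<close> and \<open>w |\<phi>|\<close> are
  at most 1.\<close>

definition weight :: "('z \<Rightarrow> complex) \<Rightarrow> 'z \<Rightarrow> real" where
  "weight \<phi> z = 1 / sqrt (1 + (cmod (\<phi> z))\<^sup>2)"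

lemma weight_pos: "0 < weight \<phi> z"
  by (simp add: weight_def add_pos_nonneg)

lemma weight_le_1: "weight \<phi> z \<le> 1"
  by (simp add: weight_def divide_le_eq_1 add_pos_nonneg)

lemma weight_mult_le_1: "weight \<phi> z * cmod (\<phi> z) \<le> 1"
proof -
  have "sqrt ((cmod (\<phi> z))\<^sup>2) \<le> sqrt (1 + (cmod (\<phi> z))\<^sup>2)" by (rule real_sqrt_le_mono) simp
  then have "cmod (\<phi> z) \<le> sqrt (1 + (cmod (\<phi> z))\<^sup>2)" by simp
  moreover have "0 < sqrt (1 + (cmod (\<phi> z))\<^sup>2)" by (simp add: add_pos_nonneg)
  ultimately show ?thesis by (simp add: weight_def divide_le_eq_1)
qed

lemma weight_measurable [measurable]:
  "\<phi> \<in> borel_measurable M \<Longrightarrow> weight \<phi> \<in> borel_measurable M"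
  unfolding weight_def by measurable

definition mismatch :: "('z \<Rightarrow> complex) \<Rightarrow> ('z \<Rightarrow> complex) \<Rightarrow> ('z \<Rightarrow> complex) \<Rightarrow> 'z \<Rightarrow> complex" where
  "mismatch \<phi> \<psi> \<theta> z = complex_of_real (weight \<phi> z) * (\<phi> z * \<psi> z - \<theta> z)"

lemma cmod_weight_mult_le: "cmod (complex_of_real (weight \<phi> z) * (\<phi> z * w)) \<le> 1 * cmod w"
proof -
  have "cmod (complex_of_real (weight \<phi> z) * (\<phi> z * w)) = (weight \<phi> z * cmod (\<phi> z)) * cmod w"
    using weight_pos[of \<phi> z] by (simp add: norm_mult)
  also have "\<dots> \<le> 1 * cmod w" by (intro mult_right_mono weight_mult_le_1) simp
  finally show ?thesis .
qed

lemma cmod_weight_le: "cmod (complex_of_real (weight \<phi> z) * w) \<le> 1 * cmod w"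
  using weight_pos[of \<phi> z] weight_le_1[of \<phi> z] by (simp add: norm_mult mult_left_le_one_le)

lemma mismatch_sqint:
  assumes [measurable]: "\<phi> \<in> borel_measurable M" and p: "\<psi> \<in> square_integrable M" and q: "\<theta> \<in> square_integrable M"
  shows "mismatch \<phi> \<psi> \<theta> \<in> square_integrable M" "norm2 M (mismatch \<phi> \<psi> \<theta>) \<le> norm2 M \<psi> + norm2 M \<theta>"
proof -
  note [measurable] = sqint_measurable[OF p] sqint_measurable[OF q]
  let ?a = "\<lambda>z. complex_of_real (weight \<phi> z) * (\<phi> z * \<psi> z)" and ?b = "\<lambda>z. complex_of_real (weight \<phi> z) * \<theta> z"
  have eq: "mismatch \<phi> \<psi> \<theta> = (\<lambda>z. ?a z - ?b z)" by (auto simp: mismatch_def algebra_simps)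
  have am: "?a \<in> borel_measurable M" and bm: "?b \<in> borel_measurable M" by measurable
  have a: "?a \<in> square_integrable M" by (rule sqint_bounded_by[OF p am AE_I2[OF cmod_weight_mult_le]])
  have b: "?b \<in> square_integrable M" by (rule sqint_bounded_by[OF q bm AE_I2[OF cmod_weight_le]])
  show "mismatch \<phi> \<psi> \<theta> \<in> square_integrable M" unfolding eq by (rule sqint_diff[OF a b])
  have "norm2 M ?a \<le> 1 * norm2 M \<psi>" by (rule norm2_mono[OF p am zero_le_one AE_I2[OF cmod_weight_mult_le]])
  moreover have "norm2 M ?b \<le> 1 * norm2 M \<theta>" by (rule norm2_mono[OF q bm zero_le_one AE_I2[OF cmod_weight_le]])
  ultimately show "norm2 M (mismatch \<phi> \<psi> \<theta>) \<le> norm2 M \<psi> + norm2 M \<theta>"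
    unfolding eq using norm2_triangle_diff[OF a b] by simp
qed

lemma exists_phase: "\<exists>c. cmod c \<le> 1 \<and> c * w = complex_of_real (cmod w)"
proof (intro exI[of _ "cnj (sgn w)"] conjI)
  show "cmod (cnj (sgn w)) \<le> 1" by (simp add: norm_sgn)
  show "cnj (sgn w) * w = complex_of_real (cmod w)"
  proof (cases "w = 0")
    case False
    have "cnj (sgn w) * w = (w * cnj w) / complex_of_real (cmod w)" by (simp add: sgn_eq mult.commute)
    also have "\<dots> = complex_of_real (cmod w)"
      using False unfolding complex_norm_square[symmetric] by (simp add: power2_eq_square)
    finally show ?thesis .
  qed simp
qed

context measure_pair
begin

text \<open>Minimise \<open>J(\<psi>, \<theta>) = n \<parallel>e\<parallel>\<^sup>2 - Re \<integral> t \<psi>\<close> with \<open>e = w (\<phi> \<psi> - \<theta>)\<close> over the feasible pairs, and put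
  \<open>k = 2 n w cnj e\<close>. At a minimiser the derivative of \<open>J\<close> towards any feasible \<open>(\<psi>', \<theta>')\<close> is nonnegative:
  \<open>Re \<integral> (t - \<phi> k) \<psi>' + Re \<integral> k \<theta>' \<le> Re \<integral> t \<psi> - 2 n \<parallel>e\<parallel>\<^sup>2\<close>. For elementary tensors \<open>\<psi>', \<theta>'\<close> the supremum of
  the left-hand side is \<open>p(t - \<phi> k) + p(k)\<close>, which is at least \<open>\<epsilon>\<close>. A near-minimiser loses at most
  \<open>\<epsilon> / 2\<close>.\<close>

lemma separating_pair:
  assumes \<phi> [measurable]: "\<phi> \<in> borel_measurable P" and t: "t \<in> square_integrable P"
    and \<epsilon>: "\<epsilon> > 0" and n: "n > 0"
    and sep: "\<And>k. k \<in> multiplier_kernels M N \<phi> \<Longrightarrow> \<epsilon> \<le> kernel_norm k + kernel_norm (\<lambda>z. t z - \<phi> z * k z)"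
  obtains \<psi> \<theta> a b where "feasible \<psi> \<theta> a b" "\<epsilon> / 2 \<le> Re (\<integral>z. t z * \<psi> z \<partial>P)"
    "(norm2 P (mismatch \<phi> \<psi> \<theta>))\<^sup>2 \<le> kernel_norm t / n"
proof -
  define Z where "Z = {(\<psi>, \<theta>). \<exists>a b. feasible \<psi> \<theta> a b}"
  define A where "A \<psi> = Re (\<integral>z. t z * \<psi> z \<partial>P)" for \<psi>
  define J where "J = (\<lambda>(\<psi>, \<theta>). n * (norm2 P (mismatch \<phi> \<psi> \<theta>))\<^sup>2 - A \<psi>)"
  \<comment> \<open>The step towards a competitor. All feasible \<open>e\<close> have norm at most 4, so the quadratic term of
    \<open>J\<close> is at most \<open>64 n s\<^sup>2\<close>; it and the error of near-minimality cost \<open>s \<epsilon> / 4\<close> each.\<close>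
  define s where "s = min 1 (\<epsilon> / (256 * n))"
  have s: "0 < s" "s \<le> 1" "s * n * 64 \<le> \<epsilon> / 4"
    using \<epsilon> n by (auto simp: s_def min_def field_simps)
  have z0: "(tensor (\<lambda>_. 0) (\<lambda>_. 0), tensor (\<lambda>_. 0) (\<lambda>_. 0)) \<in> Z"
    using feasible_tensor[OF sqint_zero sqint_zero sqint_zero sqint_zero] unfolding Z_def by auto
  have A_le: "A \<psi> \<le> 2 * kernel_norm t" if "feasible \<psi> \<theta> a b" for \<psi> \<theta> a b
    unfolding A_def by (rule feasible_integral_le[OF that t])
  have J_ge: "- (2 * kernel_norm t) \<le> J z" if zZ: "z \<in> Z" for z
  proof -
    obtain \<psi> \<theta> a b where z: "z = (\<psi>, \<theta>)" "feasible \<psi> \<theta> a b" using zZ unfolding Z_def by (cases z) auto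
    have "0 \<le> n * (norm2 P (mismatch \<phi> \<psi> \<theta>))\<^sup>2" using n by simp
    with A_le[OF z(2)] show ?thesis unfolding J_def z by simp
  qed
  obtain z where zZ: "z \<in> Z" and zmin: "\<And>z'. z' \<in> Z \<Longrightarrow> J z \<le> J z' + s * \<epsilon> / 4"
    using exists_near_minimiser[where Z = Z and J = J and \<eta> = "s * \<epsilon> / 4", OF z0 J_ge] s(1) \<epsilon> by auto
  obtain \<psi> \<theta> a b where z: "z = (\<psi>, \<theta>)" and f: "feasible \<psi> \<theta> a b"
    using zZ unfolding Z_def by (cases z) auto
  note fD = feasibleD[OF f]
  define e where "e = mismatch \<phi> \<psi> \<theta>"
  have e: "e \<in> square_integrable P" "norm2 P e \<le> 4"
    using mismatch_sqint[OF \<phi> fD(1,2)] fD(3,4) by (auto simp: e_def)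
  define E where "E = (norm2 P e)\<^sup>2"
  define k where "k w = complex_of_real (2 * n) * (complex_of_real (weight \<phi> w) * cnj (e w))" for w
  note [measurable] = sqint_measurable[OF e(1)] sqint_measurable[OF t]
  have km [measurable]: "k \<in> borel_measurable P" unfolding k_def by measurable
  have k: "k \<in> square_integrable P"
  proof (rule sqint_bounded_by[OF e(1) km, where c = "2 * n"], rule AE_I2)
    fix w show "cmod (k w) \<le> 2 * n * cmod (e w)"
      unfolding k_def norm_mult[of "complex_of_real (2 * n)"]
      using n mult_left_mono[OF cmod_weight_le[of \<phi> w "cnj (e w)"], of "2 * n"] by simp
  qed
  have \<phi>k: "(\<lambda>w. \<phi> w * k w) \<in> square_integrable P"
  proof (rule sqint_bounded_by[OF e(1), where c = "2 * n"])
    show "AE w in P. cmod (\<phi> w * k w) \<le> 2 * n * cmod (e w)"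
    proof (rule AE_I2)
      fix w
      have eq: "\<phi> w * k w = complex_of_real (2 * n) * (complex_of_real (weight \<phi> w) * (\<phi> w * cnj (e w)))"
        by (simp add: k_def mult_ac)
      show "cmod (\<phi> w * k w) \<le> 2 * n * cmod (e w)"
        unfolding eq norm_mult[of "complex_of_real (2 * n)"]
        using n mult_left_mono[OF cmod_weight_mult_le[of \<phi> w "cnj (e w)"], of "2 * n"] by simp
    qed
  qed measurable
  have kD: "k \<in> multiplier_kernels M N \<phi>" using k \<phi>k by (simp add: multiplier_kernels_def)
  have l: "(\<lambda>w. t w - \<phi> w * k w) \<in> square_integrable P" by (rule sqint_diff[OF t \<phi>k])
  define R where "R = A \<psi> + \<epsilon> / 2 - 2 * n * E"
  have first_order: "Re (\<integral>w. (t w - \<phi> w * k w) * \<psi>' w \<partial>P) + Re (\<integral>w. k w * \<theta>' w \<partial>P) \<le> R"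
    if f': "feasible \<psi>' \<theta>' a' b'" for \<psi>' \<theta>' a' b'
  proof -
    note fD' = feasibleD[OF f']
    define e' where "e' = mismatch \<phi> \<psi>' \<theta>'"
    have e': "e' \<in> square_integrable P" "norm2 P e' \<le> 4"
      using mismatch_sqint[OF \<phi> fD'(1,2)] fD'(3,4) by (auto simp: e'_def)
    define h where "h w = e' w - e w" for w
    have h: "h \<in> square_integrable P" unfolding h_def by (rule sqint_diff[OF e'(1) e(1)])
    have h8: "norm2 P h \<le> 8"
      unfolding h_def using norm2_triangle_diff[OF e'(1) e(1)] e'(2) e(2) by linarith
    have h64: "(norm2 P h)\<^sup>2 \<le> 64" using power_mono[OF h8 norm2_nonneg, of 2] by simp
    let ?\<psi> = "\<lambda>w. complex_of_real (1 - s) * \<psi> w + complex_of_real s * \<psi>' w"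
    let ?\<theta> = "\<lambda>w. complex_of_real (1 - s) * \<theta> w + complex_of_real s * \<theta>' w"
    have zs: "(?\<psi>, ?\<theta>) \<in> Z"
    proof -
      have "feasible ?\<psi> ?\<theta> (\<lambda>x. (1 - s) * a x + s * a' x) (\<lambda>y. (1 - s) * b y + s * b' y)"
        by (rule feasible_convex[OF f f']) (use s in auto)
      then show ?thesis unfolding Z_def by blast
    qed
    have it: "integrable P (\<lambda>w. t w * \<psi> w)" "integrable P (\<lambda>w. t w * \<psi>' w)"
      by (intro sqint_integrable_mult t fD(1) fD'(1))+
    have A_s: "A ?\<psi> = (1 - s) * A \<psi> + s * A \<psi>'"
    proof -
      have "(\<integral>w. t w * ?\<psi> w \<partial>P) = (\<integral>w. complex_of_real (1 - s) * (t w * \<psi> w) + complex_of_real s * (t w * \<psi>' w) \<partial>P)"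
        by (intro Bochner_Integration.integral_cong refl) (simp only: distrib_left mult.left_commute)
      also have "\<dots> = complex_of_real (1 - s) * (\<integral>w. t w * \<psi> w \<partial>P) + complex_of_real s * (\<integral>w. t w * \<psi>' w \<partial>P)"
        using it by (simp only: Bochner_Integration.integral_add integral_mult_right_zero
            integrable_mult_right)
      finally show ?thesis unfolding A_def by simp
    qed
    have e_s: "mismatch \<phi> ?\<psi> ?\<theta> = (\<lambda>w. e w + complex_of_real s * h w)"
      by (auto simp: e_def e'_def h_def mismatch_def algebra_simps)
    define c where "c = Re (\<integral>w. cnj (e w) * h w \<partial>P)"
    have "n * E - A \<psi> \<le> n * (E + 2 * s * c + s\<^sup>2 * (norm2 P h)\<^sup>2) - ((1 - s) * A \<psi> + s * A \<psi>') + s * \<epsilon> / 4"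
      using zmin[OF zs]
      by (simp only: z J_def prod.case e_s A_s norm2_square_add[OF e(1) h] E_def c_def e_def[symmetric])
    then have "s * (A \<psi>' - A \<psi>) \<le> s * (2 * n * c + s * n * (norm2 P h)\<^sup>2 + \<epsilon> / 4)"
      by (simp add: algebra_simps power2_eq_square)
    then have "A \<psi>' - A \<psi> \<le> 2 * n * c + s * n * (norm2 P h)\<^sup>2 + \<epsilon> / 4" using s(1) by simp
    moreover have "s * n * (norm2 P h)\<^sup>2 \<le> s * n * 64" using s n h64 by (intro mult_left_mono) auto
    ultimately have *: "A \<psi>' - A \<psi> \<le> 2 * n * c + \<epsilon> / 2" using s(3) by linarith
    have i: "integrable P (\<lambda>w. \<phi> w * k w * \<psi>' w)" "integrable P (\<lambda>w. k w * \<theta>' w)"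
      "integrable P (\<lambda>w. cnj (e w) * e w)" "integrable P (\<lambda>w. cnj (e w) * h w)"
      by (intro sqint_integrable_mult \<phi>k k sqint_cnj e(1) fD'(1,2) h)+
    have E_int: "(\<integral>w. cnj (e w) * e w \<partial>P) = complex_of_real E"
    proof -
      have "cnj (e w) * e w = complex_of_real ((cmod (e w))\<^sup>2)" for w
        unfolding complex_norm_square by (rule mult.commute)
      then show ?thesis by (simp only: E_def norm2_square integral_complex_of_real)
    qed
    have "complex_of_real (2 * n) * (\<integral>w. cnj (e w) * h w \<partial>P) = (\<integral>w. complex_of_real (2 * n) * (cnj (e w) * h w) \<partial>P)"
      by (simp only: integral_mult_right_zero)
    also have "\<dots> = (\<integral>w. (\<phi> w * k w * \<psi>' w - k w * \<theta>' w) - complex_of_real (2 * n) * (cnj (e w) * e w) \<partial>P)"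
    proof (intro Bochner_Integration.integral_cong refl)
      fix w
      have "complex_of_real (2 * n) * (cnj (e w) * e' w) = \<phi> w * k w * \<psi>' w - k w * \<theta>' w"
        unfolding k_def e'_def mismatch_def by (simp add: algebra_simps)
      then show "complex_of_real (2 * n) * (cnj (e w) * h w) =
          (\<phi> w * k w * \<psi>' w - k w * \<theta>' w) - complex_of_real (2 * n) * (cnj (e w) * e w)"
        unfolding h_def right_diff_distrib by simp
    qed
    also have "\<dots> = (\<integral>w. \<phi> w * k w * \<psi>' w \<partial>P) - (\<integral>w. k w * \<theta>' w \<partial>P) - complex_of_real (2 * n) * complex_of_real E"
      using i by (simp only: Bochner_Integration.integral_diff Bochner_Integration.integrable_diff
          integrable_mult_right integral_mult_right_zero E_int)
    finally have "2 * n * c = Re (\<integral>w. \<phi> w * k w * \<psi>' w \<partial>P) - Re (\<integral>w. k w * \<theta>' w \<partial>P) - 2 * n * E"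
      unfolding c_def by (simp add: complex_eq_iff)
    moreover have "Re (\<integral>w. (t w - \<phi> w * k w) * \<psi>' w \<partial>P) = A \<psi>' - Re (\<integral>w. \<phi> w * k w * \<psi>' w \<partial>P)"
      unfolding A_def left_diff_distrib using it(2) i(1) by (simp only: Bochner_Integration.integral_diff minus_complex.sel)
    ultimately show ?thesis using * unfolding R_def by linarith
  qed
  have pair_le: "cmod (pairing (\<lambda>w. t w - \<phi> w * k w) f g) + cmod (pairing k f' g') \<le> R"
    if fg: "f \<in> square_integrable M" "norm2 M f \<le> 1" "g \<in> square_integrable N" "norm2 N g \<le> 1"
      and fg': "f' \<in> square_integrable M" "norm2 M f' \<le> 1" "g' \<in> square_integrable N" "norm2 N g' \<le> 1"
    for f g f' g'
  proof -
    obtain c where c: "cmod c \<le> 1" "c * pairing (\<lambda>w. t w - \<phi> w * k w) f g = complex_of_real (cmod (pairing (\<lambda>w. t w - \<phi> w * k w) f g))"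
      using exists_phase by blast
    obtain d where d: "cmod d \<le> 1" "d * pairing k f' g' = complex_of_real (cmod (pairing k f' g'))"
      using exists_phase by blast
    have "cmod c * norm2 M f \<le> 1 * 1" "cmod d * norm2 M f' \<le> 1 * 1"
      by (intro mult_mono c(1) d(1) fg(2) fg'(2) zero_le_one norm2_nonneg)+
    then have "feasible (tensor (\<lambda>x. c * f x) g) (tensor (\<lambda>x. d * f' x) g')
        (\<lambda>x. (cmod (c * f x))\<^sup>2 + (cmod (d * f' x))\<^sup>2) (\<lambda>y. (cmod (g y))\<^sup>2 + (cmod (g' y))\<^sup>2)"
      by (intro feasible_tensor sqint_scale fg fg') (simp_all add: norm2_scale)
    from first_order[OF this]
    have "Re (pairing (\<lambda>w. t w - \<phi> w * k w) (\<lambda>x. c * f x) g) + Re (pairing k (\<lambda>x. d * f' x) g') \<le> R"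
      by (simp only: pairing_def)
    then show ?thesis
      using pairing_scale[of "\<lambda>w. t w - \<phi> w * k w" c f 1 g] pairing_scale[of k d f' 1 g'] c(2) d(2) by simp
  qed
  have "kernel_norm (\<lambda>w. t w - \<phi> w * k w) \<le> R - cmod (pairing k f' g')"
    if "f' \<in> square_integrable M" "norm2 M f' \<le> 1" "g' \<in> square_integrable N" "norm2 N g' \<le> 1" for f' g'
    by (rule kernel_norm_least) (use pair_le that in fastforce)
  then have "kernel_norm k \<le> R - kernel_norm (\<lambda>w. t w - \<phi> w * k w)"
    by (intro kernel_norm_least) fastforce
  then have main: "\<epsilon> / 2 + 2 * n * E \<le> A \<psi>"
    using sep[OF kD] unfolding R_def by linarith
  have E0: "0 \<le> 2 * n * E" using n by (simp add: E_def)
  show ?thesis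
  proof (rule that[OF f])
    show "\<epsilon> / 2 \<le> Re (\<integral>z. t z * \<psi> z \<partial>P)" using main E0 unfolding A_def by linarith
    have "2 * n * E \<le> 2 * kernel_norm t" using main \<epsilon> A_le[OF f] by linarith
    then have "E \<le> kernel_norm t / n" using n by (simp add: field_simps)
    then show "(norm2 P (mismatch \<phi> \<psi> \<theta>))\<^sup>2 \<le> kernel_norm t / n" by (simp add: E_def e_def)
  qed
qed

end

section \<open>Limits of separating pairs\<close>

text \<open>The infima of \<open>F\<close> over the decreasing sets \<open>Z n\<close> increase to a limit. Near-minimisers at late stages
  are close to each other in the sense of \<open>d\<close>, because \<open>F\<close> at their midpoint cannot drop below the earlier
  infimum.\<close>

lemma decreasing_near_minimisers:
  fixes F :: "'z \<Rightarrow> real" and Z :: "nat \<Rightarrow> 'z set"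
  assumes dec: "decseq Z" and ne: "\<And>n. Z n \<noteq> {}"
    and F: "\<And>z. z \<in> Z 0 \<Longrightarrow> 0 \<le> F z" "\<And>z. z \<in> Z 0 \<Longrightarrow> F z \<le> B"
    and mid: "\<And>n z z'. z \<in> Z n \<Longrightarrow> z' \<in> Z n \<Longrightarrow> mid z z' \<in> Z n"
    and conv: "\<And>z z'. z \<in> Z 0 \<Longrightarrow> z' \<in> Z 0 \<Longrightarrow> F (mid z z') \<le> (F z + F z') / 2 - d z z'"
  obtains z r where "strict_mono (r :: nat \<Rightarrow> nat)" "\<And>j. z j \<in> Z (r j)" "\<And>i j. j \<le> i \<Longrightarrow> d (z j) (z i) \<le> 1 / 8 ^ j"
proof -
  define E :: "nat \<Rightarrow> real" where "E j = 1 / 8 ^ j" for j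
  have E_pos: "0 < E j" for j by (simp add: E_def)
  have Z0: "z \<in> Z 0" if "z \<in> Z n" for z n using that decseqD[OF dec, of 0 n] by auto
  define f where "f n = Inf (F ` Z n)" for n
  have bb: "bdd_below (F ` Z n)" for n using F(1) Z0 by (auto intro!: bdd_belowI[of _ 0])
  have f_le: "f n \<le> F z" if "z \<in> Z n" for n z unfolding f_def using bb that by (rule cINF_lower)
  have "incseq f"
    unfolding f_def incseq_def using decseqD[OF dec] ne bb by (auto intro!: cINF_superset_mono)
  moreover have "f n \<le> B" for n
  proof -
    obtain z where "z \<in> Z n" using ne by blast
    then show ?thesis using f_le F(2) Z0 order_trans by blast
  qed
  ultimately obtain s where fs: "f \<longlonglongrightarrow> s" by (meson incseq_convergent)
  have Cau: "\<exists>L. \<forall>m\<ge>L. \<forall>n\<ge>L. \<bar>f m - f n\<bar> < e" if "e > 0" for e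
    using CauchyD[OF LIMSEQ_imp_Cauchy[OF fs] that] by simp
  obtain r :: "nat \<Rightarrow> nat" where r: "strict_mono r" "\<And>j m n. r j \<le> m \<Longrightarrow> r j \<le> n \<Longrightarrow> \<bar>f m - f n\<bar> < E j / 2"
    using fast_subsequence[of "\<lambda>m n. \<bar>f m - f n\<bar>" "\<lambda>j. E j / 2", OF Cau] E_pos by auto
  have "\<exists>z. z \<in> Z (r j) \<and> F z < f (r j) + E j / 2" for j
  proof -
    have "Inf (F ` Z (r j)) < f (r j) + E j / 2" using E_pos[of j] by (simp add: f_def)
    then show ?thesis using cInf_lessD[of "F ` Z (r j)"] ne by auto
  qed
  then obtain z where z: "\<And>j. z j \<in> Z (r j)" "\<And>j. F (z j) < f (r j) + E j / 2" by metis
  have "d (z j) (z i) \<le> 1 / 8 ^ j" if ji: "j \<le> i" for i j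
  proof -
    have rji: "r j \<le> r i" using strict_mono_less_eq[OF r(1)] ji by simp
    have zi: "z i \<in> Z (r j)" using z(1)[of i] decseqD[OF dec rji] by auto
    have "f (r j) \<le> F (mid (z j) (z i))" by (rule f_le[OF mid[OF z(1) zi]])
    also have "\<dots> \<le> (F (z j) + F (z i)) / 2 - d (z j) (z i)" by (rule conv[OF Z0[OF z(1)] Z0[OF z(1)]])
    finally have 1: "2 * d (z j) (z i) \<le> F (z j) + F (z i) - 2 * f (r j)" by (simp add: field_simps)
    have "E i \<le> E j" unfolding E_def using ji by (intro divide_left_mono) (auto intro: power_increasing)
    moreover have "f (r i) < f (r j) + E j / 2" using r(2)[OF rji order_refl] by linarith
    ultimately have "d (z j) (z i) \<le> E j" using E_pos[of j] 1 z(2)[of j] z(2)[of i] by linarith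
    then show ?thesis by (simp add: E_def)
  qed
  with r(1) z(1) that show ?thesis by blast
qed

text \<open>By Fatou's lemma \<open>liminf a\<^sub>j\<close> is finite almost everywhere, so \<open>exp (- a\<^sub>j / 2)\<close> cannot tend to 0 there;
  hence \<open>a\<^sub>j\<close> itself converges.\<close>

lemma AE_bounded_of_convergent_exp:
  fixes a :: "nat \<Rightarrow> 'a \<Rightarrow> real"
  assumes int: "\<And>j. integrable M (a j)" and a0: "\<And>j x. 0 \<le> a j x" and le: "\<And>j. integral\<^sup>L M (a j) \<le> C"
    and conv: "AE x in M. convergent (\<lambda>j. exp (- a j x / 2) * u x)" and u: "\<And>x. x \<in> space M \<Longrightarrow> 0 < u x"
  shows "AE x in M. \<exists>c. \<forall>j. a j x \<le> c"
proof -
  have [measurable]: "\<And>j. a j \<in> borel_measurable M" using int by auto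
  have "(\<integral>\<^sup>+x. liminf (\<lambda>j. ennreal (a j x)) \<partial>M) \<le> liminf (\<lambda>j. \<integral>\<^sup>+x. ennreal (a j x) \<partial>M)"
    by (rule nn_integral_liminf) auto
  also have "\<dots> \<le> liminf (\<lambda>j. ennreal C)"
  proof (rule Liminf_mono, rule eventuallyI)
    fix j show "(\<integral>\<^sup>+x. ennreal (a j x) \<partial>M) \<le> ennreal C"
      using nn_integral_eq_integral[OF int[of j]] a0 le[of j] by (simp add: ennreal_leI)
  qed
  also have "\<dots> = ennreal C" by (simp add: Liminf_const)
  finally have "(\<integral>\<^sup>+x. liminf (\<lambda>j. ennreal (a j x)) \<partial>M) \<noteq> \<infinity>" by (auto simp: top_unique)
  then have "AE x in M. liminf (\<lambda>j. ennreal (a j x)) \<noteq> \<infinity>"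
    by (intro nn_integral_noteq_infinite) auto
  with conv AE_space show ?thesis
  proof eventually_elim
    case (elim x)
    have ux: "u x > 0" using u elim by simp
    from elim obtain l where l: "(\<lambda>j. exp (- a j x / 2) * u x) \<longlonglongrightarrow> l" by (auto simp: convergent_def)
    have e: "(\<lambda>j. exp (- a j x / 2)) \<longlonglongrightarrow> l / u x"
      using tendsto_divide[OF l tendsto_const, of "u x"] ux by simp
    have "0 \<le> l / u x" by (rule LIMSEQ_le_const[OF e]) auto
    have "l / u x \<noteq> 0"
    proof
      assume "l / u x = 0"
      with e have e0: "(\<lambda>j. exp (- a j x / 2)) \<longlonglongrightarrow> 0" by (simp only:)
      have "filterlim (\<lambda>j. a j x) at_top sequentially"
      proof (subst filterlim_at_top, intro allI)
        fix R :: real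
        have "eventually (\<lambda>j. exp (- a j x / 2) < exp (- R / 2)) sequentially"
          using e0 by (rule order_tendstoD(2)) simp
        then show "eventually (\<lambda>j. R \<le> a j x) sequentially" by eventually_elim simp
      qed
      then have "(\<lambda>j. ennreal (a j x)) \<longlonglongrightarrow> top"
        by (simp add: ennreal_tendsto_top_eq_at_top)
      then have "liminf (\<lambda>j. ennreal (a j x)) = top" by (rule lim_imp_Liminf[rotated]) simp
      with elim show False by simp
    qed
    then have "(\<lambda>j. ln (exp (- a j x / 2))) \<longlonglongrightarrow> ln (l / u x)"
      by (rule tendsto_ln[OF e])
    then have "(\<lambda>j. - 2 * (- a j x / 2)) \<longlonglongrightarrow> - 2 * ln (l / u x)" by (intro tendsto_intros) simp
    then have "convergent (\<lambda>j. a j x)" by (auto simp: convergent_def)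
    then have "Bseq (\<lambda>j. a j x)" by (rule convergent_imp_Bseq)
    then obtain c where "\<forall>j. norm (a j x) \<le> c" unfolding Bseq_def by blast
    then show ?case by (intro exI[of _ c]) (metis abs_le_iff real_norm_def)
  qed
qed

lemma norm2_parallelogram:
  assumes f: "f \<in> square_integrable M" and g: "g \<in> square_integrable M"
  shows "(norm2 M (\<lambda>x. complex_of_real (1/2) * f x + complex_of_real (1/2) * g x))\<^sup>2 =
    ((norm2 M f)\<^sup>2 + (norm2 M g)\<^sup>2) / 2 - (norm2 M (\<lambda>x. f x - g x))\<^sup>2 / 4"
proof -
  note i = sqint_integrable_square[OF f] sqint_integrable_square[OF g] sqint_integrable_square[OF sqint_diff[OF f g]]
  have "(cmod (complex_of_real (1/2) * f x + complex_of_real (1/2) * g x))\<^sup>2 =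
      ((cmod (f x))\<^sup>2 + (cmod (g x))\<^sup>2) / 2 - (cmod (f x - g x))\<^sup>2 / 4" for x
    unfolding cmod_power2 by (simp add: power2_eq_square field_simps)
  then show ?thesis using i by (simp add: norm2_square)
qed

text \<open>The densities \<open>a\<close> are bounded in \<open>L\<^sup>1\<close> only, where no weak compactness is available. The convex
  functional \<open>\<integral> exp (- a) u\<close> satisfies a parallelogram identity for \<open>exp (- a / 2)\<close> in \<open>L\<^sup>2(u)\<close>.\<close>

lemma exp_parallelogram:
  fixes a b u :: "'a \<Rightarrow> real"
  assumes a: "a \<in> borel_measurable M" "\<And>x. 0 \<le> a x" and b: "b \<in> borel_measurable M" "\<And>x. 0 \<le> b x"
    and u: "integrable M u" "\<And>x. 0 \<le> u x"
  shows "(\<integral>x. exp (- (1/2 * a x + 1/2 * b x)) * u x \<partial>M) =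
      ((\<integral>x. exp (- a x) * u x \<partial>M) + (\<integral>x. exp (- b x) * u x \<partial>M)) / 2
      - (\<integral>x. (exp (- a x / 2) * sqrt (u x) - exp (- b x / 2) * sqrt (u x))\<^sup>2 \<partial>M) / 2" (is ?eq)
    and "integrable M (\<lambda>x. (exp (- a x / 2) * sqrt (u x) - exp (- b x / 2) * sqrt (u x))\<^sup>2)" (is ?int)
proof -
  note [measurable] = a(1) b(1) borel_measurable_integrable[OF u(1)]
  have i: "integrable M (\<lambda>x. exp (- c x) * u x)" if "c \<in> borel_measurable M" "\<And>x. 0 \<le> c x" for c :: "'a \<Rightarrow> real"
  proof (rule Bochner_Integration.integrable_bound[OF u(1)])
    show "(\<lambda>x. exp (- c x) * u x) \<in> borel_measurable M" using that by measurable
    show "AE x in M. norm (exp (- c x) * u x) \<le> norm (u x)"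
      using that(2) by (intro AE_I2) (simp add: abs_mult mult_left_le_one_le)
  qed
  have m: "integrable M (\<lambda>x. exp (- (1/2 * a x + 1/2 * b x)) * u x)"
    by (rule i) (use a b in auto)
  have pt: "(exp (- a x / 2) * sqrt (u x) - exp (- b x / 2) * sqrt (u x))\<^sup>2 =
      exp (- a x) * u x + exp (- b x) * u x - 2 * (exp (- (1/2 * a x + 1/2 * b x)) * u x)" for x
  proof -
    have "exp (- a x) = (exp (- a x / 2))\<^sup>2" "exp (- b x) = (exp (- b x / 2))\<^sup>2"
      "exp (- (1/2 * a x + 1/2 * b x)) = exp (- a x / 2) * exp (- b x / 2)"
      by (simp_all flip: exp_double exp_add)
    moreover have "u x = (sqrt (u x))\<^sup>2" using u(2) by simp
    ultimately show ?thesis by (simp add: power2_diff power_mult_distrib) (simp add: power2_eq_square algebra_simps)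
  qed
  show ?int unfolding pt using i[OF a] i[OF b] m by simp
  define I J K where "I = (\<integral>x. exp (- a x) * u x \<partial>M)" and "J = (\<integral>x. exp (- b x) * u x \<partial>M)"
    and "K = (\<integral>x. exp (- (1/2 * a x + 1/2 * b x)) * u x \<partial>M)"
  have "(\<integral>x. (exp (- a x / 2) * sqrt (u x) - exp (- b x / 2) * sqrt (u x))\<^sup>2 \<partial>M) = I + J - 2 * K"
    unfolding pt I_def J_def K_def using i[OF a] i[OF b] m by simp
  then show ?eq unfolding I_def[symmetric] J_def[symmetric] K_def[symmetric] by (simp add: field_simps)
qed

context measure_pair
begin

definition schur_multiplier :: "('a \<times> 'b \<Rightarrow> complex) \<Rightarrow> bool" where
  "schur_multiplier \<psi> \<longleftrightarrow> \<psi> \<in> borel_measurable P \<and> (\<exists>c. \<forall>z. cmod (\<psi> z) \<le> c) \<and>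
     (\<exists>c\<ge>0. \<forall>k\<in>square_integrable P. kernel_norm (\<lambda>z. \<psi> z * k z) \<le> c * kernel_norm k)"

lemma tensor_indicator: "tensor (indicator A) (indicator B) z = indicator (A \<times> B) z"
  by (cases z) (simp add: tensor_def indicator_def)

text \<open>On \<open>A \<times> B\<close> the densities are at most \<open>m\<close>, so the estimates of \<open>dominated\<close> hold there with the constant
  density \<open>m\<close>, and dominated convergence carries them to the limit \<open>\<rho>\<close>.\<close>

lemma limit_of_dominated:
  assumes dom: "\<And>j. dominated (\<psi> j) (a j) (b j)"
    and A: "A \<in> sets M" and B: "B \<in> sets N"
    and am: "\<And>j x. x \<in> A \<Longrightarrow> a j x \<le> m" and bm: "\<And>j y. y \<in> B \<Longrightarrow> b j y \<le> m"
    and lim: "AE z in P. z \<in> A \<times> B \<longrightarrow> (\<lambda>j. \<psi> j z) \<longlonglongrightarrow> \<rho> z"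
    and zero: "\<And>z. z \<notin> A \<times> B \<Longrightarrow> \<rho> z = 0"
    and \<rho> [measurable]: "\<rho> \<in> borel_measurable P" and \<rho>_le: "\<And>z. cmod (\<rho> z) \<le> m" and m: "0 \<le> m"
    and k: "k \<in> square_integrable P"
  shows "kernel_norm (\<lambda>z. \<rho> z * k z) \<le> m * kernel_norm k"
    and "emeasure M A < \<infinity> \<Longrightarrow> emeasure N B < \<infinity> \<Longrightarrow>
      (\<lambda>j. form k (\<psi> j) (indicator A) (indicator B)) \<longlonglongrightarrow> (\<integral>z. k z * \<rho> z \<partial>P)"
proof -
  note [measurable] = sqint_measurable[OF k] A B
  have [measurable]: "\<psi> j \<in> borel_measurable P" for j using dominatedD(1)[OF dom] by (rule sqint_measurable)
  have \<psi>_le: "cmod (\<psi> j z) \<le> m" if zAB: "z \<in> A \<times> B" for j z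
  proof -
    obtain x y where z: "z = (x, y)" "x \<in> A" "y \<in> B" using zAB by auto
    have "cmod (\<psi> j (x, y)) \<le> (a j x + b j y) / 2" using dom by (rule dominatedD(6))
    also have "\<dots> \<le> (m + m) / 2" using z am bm by (intro divide_right_mono add_mono) auto
    finally show ?thesis using z by simp
  qed
  show "(\<lambda>j. form k (\<psi> j) (indicator A) (indicator B)) \<longlonglongrightarrow> (\<integral>z. k z * \<rho> z \<partial>P)"
    if fin: "emeasure M A < \<infinity>" "emeasure N B < \<infinity>"
    unfolding form_def tensor_indicator
  proof (rule integral_dominated_convergence)
    have "emeasure P (A \<times> B) < \<infinity>"
      using fin by (simp add: M2.emeasure_pair_measure_Times A B ennreal_mult_less_top)
    then have "(indicator (A \<times> B) :: _ \<Rightarrow> complex) \<in> square_integrable P"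
      by (intro sqint_indicator) auto
    then show "integrable P (\<lambda>z. m * (cmod (k z) * cmod (indicator (A \<times> B) z :: complex)))"
      by (intro integrable_mult_right sqint_integrable_mult_cmod k)
    show "AE z in P. (\<lambda>j. k z * (\<psi> j z * indicator (A \<times> B) z)) \<longlonglongrightarrow> k z * \<rho> z"
      using lim
    proof eventually_elim
      case (elim z)
      show ?case
      proof (cases "z \<in> A \<times> B")
        case True
        then show ?thesis using elim by (auto intro!: tendsto_intros)
      qed (simp add: zero)
    qed
    show "AE z in P. cmod (k z * (\<psi> j z * indicator (A \<times> B) z)) \<le> m * (cmod (k z) * cmod (indicator (A \<times> B) z :: complex))" for j
    proof (rule AE_I2)
      fix z
      show "cmod (k z * (\<psi> j z * indicator (A \<times> B) z)) \<le> m * (cmod (k z) * cmod (indicator (A \<times> B) z :: complex))"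
      proof (cases "z \<in> A \<times> B")
        case True
        have "cmod (k z) * cmod (\<psi> j z) \<le> cmod (k z) * m" by (intro mult_left_mono \<psi>_le True) simp
        then show ?thesis using True by (simp add: norm_mult mult.commute)
      qed (use m in simp)
    qed
  qed measurable
  have Re_le: "Re (pairing (\<lambda>z. \<rho> z * k z) f g) \<le> m * kernel_norm k"
    if f: "f \<in> square_integrable M" "norm2 M f \<le> 1" and g: "g \<in> square_integrable N" "norm2 N g \<le> 1" for f g
  proof -
    note [measurable] = sqint_measurable[OF f(1)] sqint_measurable[OF g(1)]
    \<comment> \<open>The estimate for \<open>\<psi> j\<close> needs bounded test functions; the truncation at height \<open>j\<close> disappears in the
      same limit.\<close>
    define F where "F j x = (if x \<in> A \<and> cmod (f x) \<le> real j then f x else 0)" for j x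
    define G where "G j y = (if y \<in> B \<and> cmod (g y) \<le> real j then g y else 0)" for j y
    have Fm [measurable]: "F j \<in> borel_measurable M" and Gm [measurable]: "G j \<in> borel_measurable N" for j
      unfolding F_def G_def by measurable
    have Fb: "bounded (range (F j))" and Gb: "bounded (range (G j))" for j
      by (auto simp: bounded_iff F_def G_def intro!: exI[of _ "real j"])
    have "(\<lambda>j. form k (\<psi> j) (F j) (G j)) \<longlonglongrightarrow> pairing (\<lambda>z. \<rho> z * k z) f g"
      unfolding form_def pairing_def
    proof (rule integral_dominated_convergence)
      show "integrable P (\<lambda>z. m * (cmod (k z) * cmod (tensor f g z)))"
        by (intro integrable_mult_right sqint_integrable_mult_cmod k tensor_sqint f g)
      show "AE z in P. (\<lambda>j. k z * (\<psi> j z * tensor (F j) (G j) z)) \<longlonglongrightarrow> \<rho> z * k z * tensor f g z"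
        using lim
      proof eventually_elim
        case (elim z)
        obtain x y where z: "z = (x, y)" by (cases z)
        show ?case
        proof (cases "z \<in> A \<times> B")
          case True
          obtain J where J: "cmod (f x) \<le> real J" "cmod (g y) \<le> real J"
            using real_arch_simple[of "max (cmod (f x)) (cmod (g y))"] by auto
          have "\<forall>\<^sub>F j in sequentially. k z * (\<psi> j z * tensor f g z) = k z * (\<psi> j z * tensor (F j) (G j) z)"
            unfolding eventually_sequentially
          proof (intro exI allI impI)
            fix j assume "J \<le> j"
            then have "cmod (f x) \<le> real j" "cmod (g y) \<le> real j" using J by auto
            then show "k z * (\<psi> j z * tensor f g z) = k z * (\<psi> j z * tensor (F j) (G j) z)"
              using True z by (simp add: tensor_def F_def G_def)
          qed
          moreover have "(\<lambda>j. k z * (\<psi> j z * tensor f g z)) \<longlonglongrightarrow> k z * (\<rho> z * tensor f g z)"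
            using elim True by (auto intro!: tendsto_intros)
          ultimately have "(\<lambda>j. k z * (\<psi> j z * tensor (F j) (G j) z)) \<longlonglongrightarrow> k z * (\<rho> z * tensor f g z)"
            by (rule Lim_transform_eventually[rotated])
          moreover have "k z * (\<rho> z * tensor f g z) = \<rho> z * k z * tensor f g z" by simp
          ultimately show ?thesis by (simp only:)
        next
          case False
          then have "tensor (F j) (G j) z = 0" for j using z by (auto simp: tensor_def F_def G_def)
          then show ?thesis using zero[OF False] by simp
        qed
      qed
      show "AE z in P. cmod (k z * (\<psi> j z * tensor (F j) (G j) z)) \<le> m * (cmod (k z) * cmod (tensor f g z))" for j
      proof (rule AE_I2)
        fix z :: "'a \<times> 'b"
        obtain x y where z: "z = (x, y)" by (cases z)
        show "cmod (k z * (\<psi> j z * tensor (F j) (G j) z)) \<le> m * (cmod (k z) * cmod (tensor f g z))"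
        proof (cases "z \<in> A \<times> B")
          case True
          have "cmod (\<psi> j z) * cmod (tensor (F j) (G j) z) \<le> m * cmod (tensor f g z)"
            using \<psi>_le[OF True, of j] m by (intro mult_mono) (auto simp: tensor_def F_def G_def)
          then have "cmod (k z) * (cmod (\<psi> j z) * cmod (tensor (F j) (G j) z)) \<le> cmod (k z) * (m * cmod (tensor f g z))"
            by (rule mult_left_mono) simp
          then show ?thesis by (simp only: norm_mult mult_ac)
        next
          case False
          then have "tensor (F j) (G j) z = 0" using z by (auto simp: tensor_def F_def G_def)
          then show ?thesis using m by simp
        qed
      qed
    qed measurable
    then have l: "(\<lambda>j. Re (form k (\<psi> j) (F j) (G j))) \<longlonglongrightarrow> Re (pairing (\<lambda>z. \<rho> z * k z) f g)"
      by (rule tendsto_Re)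
    have "Re (form k (\<psi> j) (F j) (G j)) \<le> m * kernel_norm k" for j
    proof -
      have "(\<integral>x. a j x * (cmod (F j x))\<^sup>2 \<partial>M) \<le> (\<integral>x. m * (cmod (f x))\<^sup>2 \<partial>M)"
      proof (rule integral_mono)
        show "integrable M (\<lambda>x. a j x * (cmod (F j x))\<^sup>2)"
          by (rule integrable_mult_bounded_square[OF dominatedD(2)[OF dom] Fm Fb])
        show "integrable M (\<lambda>x. m * (cmod (f x))\<^sup>2)" using sqint_integrable_square[OF f(1)] by simp
        show "a j x * (cmod (F j x))\<^sup>2 \<le> m * (cmod (f x))\<^sup>2" for x
          using am[of x j] m by (auto simp: F_def intro!: mult_right_mono)
      qed
      also have "\<dots> = m * (norm2 M f)\<^sup>2" by (simp add: norm2_square)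
      also have "\<dots> \<le> m * 1" using f m by (intro mult_left_mono) (auto simp: power_le_one)
      finally have 1: "(\<integral>x. a j x * (cmod (F j x))\<^sup>2 \<partial>M) \<le> m" by simp
      have "(\<integral>y. b j y * (cmod (G j y))\<^sup>2 \<partial>N) \<le> (\<integral>y. m * (cmod (g y))\<^sup>2 \<partial>N)"
      proof (rule integral_mono)
        show "integrable N (\<lambda>y. b j y * (cmod (G j y))\<^sup>2)"
          by (rule integrable_mult_bounded_square[OF dominatedD(3)[OF dom] Gm Gb])
        show "integrable N (\<lambda>y. m * (cmod (g y))\<^sup>2)" using sqint_integrable_square[OF g(1)] by simp
        show "b j y * (cmod (G j y))\<^sup>2 \<le> m * (cmod (g y))\<^sup>2" for y
          using bm[of y j] m by (auto simp: G_def intro!: mult_right_mono)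
      qed
      also have "\<dots> = m * (norm2 N g)\<^sup>2" by (simp add: norm2_square)
      also have "\<dots> \<le> m * 1" using g m by (intro mult_left_mono) (auto simp: power_le_one)
      finally have 2: "(\<integral>y. b j y * (cmod (G j y))\<^sup>2 \<partial>N) \<le> m" by simp
      have "Re (form k (\<psi> j) (F j) (G j)) \<le> kernel_norm k / 2 *
          ((\<integral>x. a j x * (cmod (F j x))\<^sup>2 \<partial>M) + (\<integral>y. b j y * (cmod (G j y))\<^sup>2 \<partial>N))"
        by (rule dominated_form_le[OF dom k Fm Gm Fb Gb])
      also have "\<dots> \<le> kernel_norm k / 2 * (m + m)"
        using 1 2 kernel_norm_nonneg[OF k] by (intro mult_left_mono add_mono) auto
      finally show ?thesis by (simp add: mult.commute)
    qed
    then show ?thesis by (intro LIMSEQ_le_const2[OF l]) auto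
  qed
  show "kernel_norm (\<lambda>z. \<rho> z * k z) \<le> m * kernel_norm k"
  proof (rule kernel_norm_least)
    fix f g assume fg: "f \<in> square_integrable M" "norm2 M f \<le> 1" "g \<in> square_integrable N" "norm2 N g \<le> 1"
    obtain c where c: "cmod c \<le> 1" "c * pairing (\<lambda>z. \<rho> z * k z) f g = complex_of_real (cmod (pairing (\<lambda>z. \<rho> z * k z) f g))"
      using exists_phase by blast
    have "cmod c * norm2 M f \<le> 1 * 1" by (intro mult_mono c(1) fg(2) zero_le_one norm2_nonneg)
    then have "norm2 M (\<lambda>x. c * f x) \<le> 1" by (simp add: norm2_scale)
    from Re_le[OF sqint_scale[OF fg(1)] this fg(3,4)]
    show "cmod (pairing (\<lambda>z. \<rho> z * k z) f g) \<le> m * kernel_norm k"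
      using pairing_scale[of "\<lambda>z. \<rho> z * k z" c f 1 g] c(2) by simp
  qed
qed



lemma sigma_finite_positive_integrable:
  assumes "sigma_finite_measure Q"
  obtains u :: "'c \<Rightarrow> real" where "integrable Q u" "\<And>x. 0 \<le> u x" "\<And>x. x \<in> space Q \<Longrightarrow> 0 < u x"
proof -
  interpret sigma_finite_measure Q by fact
  obtain h where h: "h \<in> borel_measurable Q" "integral\<^sup>N Q h \<noteq> \<infinity>" "\<And>x. x \<in> space Q \<Longrightarrow> 0 < h x \<and> h x < \<infinity>"
    using Ex_finite_integrable_function by blast
  have "integral\<^sup>N Q (\<lambda>x. ennreal (enn2real (h x))) = integral\<^sup>N Q h"
  proof (rule nn_integral_cong)
    fix x assume "x \<in> space Q"
    then show "ennreal (enn2real (h x)) = h x" using h(3)[of x] by simp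
  qed
  then have fin: "integral\<^sup>N Q (\<lambda>x. ennreal (enn2real (h x))) < \<infinity>"
    using h(2) by (simp only: less_top[symmetric] infinity_ennreal_def not_False_eq_True)
  have "integrable Q (\<lambda>x. enn2real (h x))"
  proof (rule integrableI_nonneg[OF _ _ fin])
    show "(\<lambda>x. enn2real (h x)) \<in> borel_measurable Q" using h(1) by measurable
  qed simp
  moreover have "0 < enn2real (h x)" if x: "x \<in> space Q" for x
    using h(3)[OF x] by (simp add: enn2real_positive_iff)
  ultimately show ?thesis using that by auto
qed

text \<open>Let \<open>Z n\<close> consist of the feasible pairs with \<open>Re \<integral> t \<psi> \<ge> \<epsilon> / 2\<close> and penalty at most \<open>p(t) / (n + 1)\<close>, together
  with their densities; it is convex and nonempty. Near-minimisers of
  \<open>\<parallel>\<psi>\<parallel>\<^sup>2 + \<parallel>\<theta>\<parallel>\<^sup>2 + \<integral> exp (- a) u + \<integral> exp (- b) v\<close> form a fast Cauchy sequence, and the penalty of the limit is 0.\<close>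

lemma separating_sequence:
  assumes \<phi> [measurable]: "\<phi> \<in> borel_measurable P" and t: "t \<in> square_integrable P" and \<epsilon>: "\<epsilon> > 0"
    and sep: "\<And>k. k \<in> multiplier_kernels M N \<phi> \<Longrightarrow> \<epsilon> \<le> kernel_norm k + kernel_norm (\<lambda>z. t z - \<phi> z * k z)"
  obtains \<psi> \<theta> a b where "\<And>j::nat. feasible (\<psi> j) (\<theta> j) (a j) (b j)"
    "\<And>j. \<epsilon> / 2 \<le> Re (\<integral>z. t z * \<psi> j z \<partial>P)"
    "AE z in P. convergent (\<lambda>j. \<psi> j z)" "AE z in P. convergent (\<lambda>j. \<theta> j z)"
    "AE z in P. lim (\<lambda>j. \<theta> j z) = \<phi> z * lim (\<lambda>j. \<psi> j z)"
    "AE x in M. \<exists>c. \<forall>j. a j x \<le> c" "AE y in N. \<exists>c. \<forall>j. b j y \<le> c"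
proof -
  obtain u :: "'a \<Rightarrow> real" where u: "integrable M u" "\<And>x. 0 \<le> u x" "\<And>x. x \<in> space M \<Longrightarrow> 0 < u x"
    using sigma_finite_positive_integrable[OF M1.sigma_finite_measure_axioms] by blast
  obtain v :: "'b \<Rightarrow> real" where v: "integrable N v" "\<And>x. 0 \<le> v x" "\<And>x. x \<in> space N \<Longrightarrow> 0 < v x"
    using sigma_finite_positive_integrable[OF M2.sigma_finite_measure_axioms] by blast
  note [measurable] = borel_measurable_integrable[OF u(1)] borel_measurable_integrable[OF v(1)]
  define \<delta> where "\<delta> n = sqrt (kernel_norm t / real (Suc n))" for n
  have \<delta>_dec: "\<delta> n \<le> \<delta> m" if "m \<le> n" for m n
    unfolding \<delta>_def using that kernel_norm_nonneg[OF t] by (intro real_sqrt_le_mono divide_left_mono) auto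
  define good where "good n \<psi> \<theta> a b \<longleftrightarrow> feasible \<psi> \<theta> a b \<and> \<epsilon> / 2 \<le> Re (\<integral>z. t z * \<psi> z \<partial>P) \<and>
      norm2 P (mismatch \<phi> \<psi> \<theta>) \<le> \<delta> n" for n \<psi> \<theta> a b
  define Z where "Z n = {(\<psi>, \<theta>, a, b). good n \<psi> \<theta> a b}" for n
  define mid where "mid = (\<lambda>(\<psi> :: 'a \<times> 'b \<Rightarrow> complex, \<theta> :: 'a \<times> 'b \<Rightarrow> complex, a :: 'a \<Rightarrow> real, b :: 'b \<Rightarrow> real) (\<psi>', \<theta>', a', b').
    (\<lambda>z. complex_of_real (1/2) * \<psi> z + complex_of_real (1/2) * \<psi>' z,
     \<lambda>z. complex_of_real (1/2) * \<theta> z + complex_of_real (1/2) * \<theta>' z,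
     \<lambda>x. 1/2 * a x + 1/2 * a' x, \<lambda>y. 1/2 * b y + 1/2 * b' y))"
  define F where "F = (\<lambda>(\<psi>, \<theta>, a, b). (norm2 P \<psi>)\<^sup>2 + (norm2 P \<theta>)\<^sup>2 +
    ((\<integral>x. exp (- a x) * u x \<partial>M) + (\<integral>y. exp (- b y) * v y \<partial>N)))"
  define d where "d = (\<lambda>(\<psi>, \<theta>, a, b) (\<psi>', \<theta>', a', b').
    (norm2 P (\<lambda>z. \<psi> z - \<psi>' z))\<^sup>2 / 4 + (norm2 P (\<lambda>z. \<theta> z - \<theta>' z))\<^sup>2 / 4 +
    ((\<integral>x. (exp (- a x / 2) * sqrt (u x) - exp (- a' x / 2) * sqrt (u x))\<^sup>2 \<partial>M) / 2 +
     (\<integral>y. (exp (- b y / 2) * sqrt (v y) - exp (- b' y / 2) * sqrt (v y))\<^sup>2 \<partial>N) / 2))"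
  have fm: "a \<in> borel_measurable M" "b \<in> borel_measurable N" "0 \<le> a x" "0 \<le> b y" "integrable M a" "integrable N b"
    if "feasible \<psi> \<theta> a b" for \<psi> \<theta> a b x y
    using dominatedD(2-5)[OF feasibleD(5)[OF that]] by auto
  have ex_good: "Z n \<noteq> {}" for n
  proof -
    have n0: "0 < real (Suc n)" by simp
    obtain \<psi> \<theta> a b where f: "feasible \<psi> \<theta> a b" "\<epsilon> / 2 \<le> Re (\<integral>z. t z * \<psi> z \<partial>P)"
      "(norm2 P (mismatch \<phi> \<psi> \<theta>))\<^sup>2 \<le> kernel_norm t / real (Suc n)"
      by (rule separating_pair[OF \<phi> t \<epsilon> n0 sep])
    have "good n \<psi> \<theta> a b" unfolding good_def \<delta>_def using f by (auto intro: real_le_rsqrt)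
    then show ?thesis unfolding Z_def by auto
  qed
  have Z_mid: "mid z z' \<in> Z n" if z: "z \<in> Z n" and z': "z' \<in> Z n" for n z z'
  proof -
    obtain \<psi> \<theta> a b where g: "z = (\<psi>, \<theta>, a, b)" "good n \<psi> \<theta> a b" using z unfolding Z_def by (cases z) auto
    obtain \<psi>' \<theta>' a' b' where g': "z' = (\<psi>', \<theta>', a', b')" "good n \<psi>' \<theta>' a' b'" using z' unfolding Z_def by (cases z') auto
    have f: "feasible \<psi> \<theta> a b" and f': "feasible \<psi>' \<theta>' a' b'" using g g' by (auto simp: good_def)
    note fD = feasibleD[OF f] and fD' = feasibleD[OF f']
    have "good n (\<lambda>z. complex_of_real (1/2) * \<psi> z + complex_of_real (1/2) * \<psi>' z)
       (\<lambda>z. complex_of_real (1/2) * \<theta> z + complex_of_real (1/2) * \<theta>' z)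
       (\<lambda>x. 1/2 * a x + 1/2 * a' x) (\<lambda>y. 1/2 * b y + 1/2 * b' y)" (is "good n ?\<psi> ?\<theta> ?a ?b")
      unfolding good_def
    proof (intro conjI)
      show "feasible ?\<psi> ?\<theta> ?a ?b" by (rule feasible_convex[OF f f']) auto
      have it: "integrable P (\<lambda>z. t z * \<psi> z)" "integrable P (\<lambda>z. t z * \<psi>' z)"
        by (intro sqint_integrable_mult t fD(1) fD'(1))+
      have "(\<integral>z. t z * ?\<psi> z \<partial>P) = (\<integral>z. complex_of_real (1/2) * (t z * \<psi> z) + complex_of_real (1/2) * (t z * \<psi>' z) \<partial>P)"
        by (intro Bochner_Integration.integral_cong refl) (simp only: distrib_left mult.left_commute)
      also have "\<dots> = complex_of_real (1/2) * (\<integral>z. t z * \<psi> z \<partial>P) + complex_of_real (1/2) * (\<integral>z. t z * \<psi>' z \<partial>P)"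
        using it by (simp only: Bochner_Integration.integral_add integral_mult_right_zero integrable_mult_right)
      finally have "2 * Re (\<integral>z. t z * ?\<psi> z \<partial>P) = Re (\<integral>z. t z * \<psi> z \<partial>P) + Re (\<integral>z. t z * \<psi>' z \<partial>P)" by simp
      then show "\<epsilon> / 2 \<le> Re (\<integral>z. t z * ?\<psi> z \<partial>P)" using g(2) g'(2) unfolding good_def by linarith
      have m: "mismatch \<phi> \<psi> \<theta> \<in> square_integrable P" "mismatch \<phi> \<psi>' \<theta>' \<in> square_integrable P"
        using mismatch_sqint(1)[OF \<phi> fD(1,2)] mismatch_sqint(1)[OF \<phi> fD'(1,2)] by auto
      have "mismatch \<phi> ?\<psi> ?\<theta> = (\<lambda>z. complex_of_real (1/2) * mismatch \<phi> \<psi> \<theta> z + complex_of_real (1/2) * mismatch \<phi> \<psi>' \<theta>' z)"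
        by (auto simp: mismatch_def algebra_simps)
      then have "norm2 P (mismatch \<phi> ?\<psi> ?\<theta>) \<le>
          norm2 P (\<lambda>z. complex_of_real (1/2) * mismatch \<phi> \<psi> \<theta> z) + norm2 P (\<lambda>z. complex_of_real (1/2) * mismatch \<phi> \<psi>' \<theta>' z)"
        using norm2_triangle[OF sqint_scale[OF m(1)] sqint_scale[OF m(2)]] by (simp only:)
      also have "\<dots> = 1/2 * norm2 P (mismatch \<phi> \<psi> \<theta>) + 1/2 * norm2 P (mismatch \<phi> \<psi>' \<theta>')"
        by (simp only: norm2_scale norm_of_real)
      also have "\<dots> \<le> 1/2 * \<delta> n + 1/2 * \<delta> n"
        using g(2) g'(2) unfolding good_def by (intro add_mono mult_left_mono) auto
      finally show "norm2 P (mismatch \<phi> ?\<psi> ?\<theta>) \<le> \<delta> n" by simp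
    qed
    then show ?thesis unfolding g g' mid_def Z_def by simp
  qed
  have F_mid: "F (mid z z') \<le> (F z + F z') / 2 - d z z'" if z: "z \<in> Z 0" and z': "z' \<in> Z 0" for z z'
  proof -
    obtain \<psi> \<theta> a b where g: "z = (\<psi>, \<theta>, a, b)" "good 0 \<psi> \<theta> a b" using z unfolding Z_def by (cases z) auto
    obtain \<psi>' \<theta>' a' b' where g': "z' = (\<psi>', \<theta>', a', b')" "good 0 \<psi>' \<theta>' a' b'" using z' unfolding Z_def by (cases z') auto
    have f: "feasible \<psi> \<theta> a b" and f': "feasible \<psi>' \<theta>' a' b'" using g g' by (auto simp: good_def)
    note fD = feasibleD[OF f] and fD' = feasibleD[OF f']
    show ?thesis
      unfolding g(1) g'(1) F_def mid_def d_def prod.case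
      unfolding norm2_parallelogram[OF fD(1) fD'(1)] norm2_parallelogram[OF fD(2) fD'(2)]
        exp_parallelogram(1)[OF fm(1)[OF f] fm(3)[OF f] fm(1)[OF f'] fm(3)[OF f'] u(1,2)]
        exp_parallelogram(1)[OF fm(2)[OF f] fm(4)[OF f] fm(2)[OF f'] fm(4)[OF f'] v(1,2)]
      by (simp only: add_divide_distrib diff_divide_distrib)
  qed
  have F_le: "0 \<le> F z \<and> F z \<le> 8 + (integral\<^sup>L M u + integral\<^sup>L N v)" if z: "z \<in> Z 0" for z
  proof -
    obtain \<psi> \<theta> a b where g: "z = (\<psi>, \<theta>, a, b)" "good 0 \<psi> \<theta> a b" using z unfolding Z_def by (cases z) auto
    have f: "feasible \<psi> \<theta> a b" using g by (auto simp: good_def)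
    have "(norm2 P \<psi>)\<^sup>2 \<le> 2\<^sup>2" "(norm2 P \<theta>)\<^sup>2 \<le> 2\<^sup>2" using feasibleD(3,4)[OF f] by (intro power_mono; simp)+
    moreover have "(\<integral>x. exp (- a x) * u x \<partial>M) \<le> integral\<^sup>L M u"
      using u by (intro integral_mono') (auto simp: mult_left_le_one_le fm(3)[OF f])
    moreover have "(\<integral>y. exp (- b y) * v y \<partial>N) \<le> integral\<^sup>L N v"
      using v by (intro integral_mono') (auto simp: mult_left_le_one_le fm(4)[OF f])
    moreover have "0 \<le> (\<integral>x. exp (- a x) * u x \<partial>M)" "0 \<le> (\<integral>y. exp (- b y) * v y \<partial>N)"
      using u(2) v(2) by (auto intro!: Bochner_Integration.integral_nonneg)
    ultimately show ?thesis unfolding g(1) F_def by simp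
  qed
  have Z_dec: "decseq Z"
    unfolding decseq_def
  proof (intro allI impI subsetI)
    fix m n z assume mn: "m \<le> n" and z: "z \<in> Z n"
    then obtain \<psi> \<theta> a b where g: "z = (\<psi>, \<theta>, a, b)" "good n \<psi> \<theta> a b" unfolding Z_def by (cases z) auto
    have "good m \<psi> \<theta> a b"
      using g(2) order_trans[OF _ \<delta>_dec[OF mn]] unfolding good_def by blast
    then show "z \<in> Z m" by (simp add: g(1) Z_def)
  qed
  have F0: "0 \<le> F z" and FB: "F z \<le> 8 + (integral\<^sup>L M u + integral\<^sup>L N v)" if "z \<in> Z 0" for z
    using F_le[OF that] by blast+
  obtain z r where r: "strict_mono (r :: nat \<Rightarrow> nat)" and zZ: "\<And>j. z j \<in> Z (r j)"
    and zd: "\<And>i j. j \<le> i \<Longrightarrow> d (z j) (z i) \<le> 1 / 8 ^ j"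
    by (rule decreasing_near_minimisers[OF Z_dec ex_good F0 FB Z_mid F_mid], assumption+, rule that, assumption+)
  define \<psi> where "\<psi> j = fst (z j)" for j
  define \<theta> where "\<theta> j = fst (snd (z j))" for j
  define a where "a j = fst (snd (snd (z j)))" for j
  define b where "b j = snd (snd (snd (z j)))" for j
  have z: "z j = (\<psi> j, \<theta> j, a j, b j)" for j by (simp add: \<psi>_def \<theta>_def a_def b_def)
  have g: "good (r j) (\<psi> j) (\<theta> j) (a j) (b j)" for j using zZ[of j] by (simp add: z Z_def)
  then have f: "feasible (\<psi> j) (\<theta> j) (a j) (b j)" and tpsi: "\<epsilon> / 2 \<le> Re (\<integral>z. t z * \<psi> j z \<partial>P)"
    and mis: "norm2 P (mismatch \<phi> (\<psi> j) (\<theta> j)) \<le> \<delta> (r j)" for j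
    unfolding good_def by blast+
  note fD = feasibleD[OF f]
  note [measurable] = sqint_measurable[OF fD(1)] sqint_measurable[OF fD(2)] fm(1,2)[OF f]
  have dj: "(norm2 P (\<lambda>z. \<psi> (Suc j) z - \<psi> j z))\<^sup>2 \<le> 4 / 8 ^ j" "(norm2 P (\<lambda>z. \<theta> (Suc j) z - \<theta> j z))\<^sup>2 \<le> 4 / 8 ^ j"
    "(\<integral>x. (norm (exp (- a (Suc j) x / 2) * sqrt (u x) - exp (- a j x / 2) * sqrt (u x)))\<^sup>2 \<partial>M) \<le> 2 / 8 ^ j"
    "(\<integral>y. (norm (exp (- b (Suc j) y / 2) * sqrt (v y) - exp (- b j y / 2) * sqrt (v y)))\<^sup>2 \<partial>N) \<le> 2 / 8 ^ j" for j
  proof -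
    define p1 where "p1 = (norm2 P (\<lambda>z. \<psi> j z - \<psi> (Suc j) z))\<^sup>2"
    define p2 where "p2 = (norm2 P (\<lambda>z. \<theta> j z - \<theta> (Suc j) z))\<^sup>2"
    define p3 where "p3 = (\<integral>x. (exp (- a j x / 2) * sqrt (u x) - exp (- a (Suc j) x / 2) * sqrt (u x))\<^sup>2 \<partial>M)"
    define p4 where "p4 = (\<integral>y. (exp (- b j y / 2) * sqrt (v y) - exp (- b (Suc j) y / 2) * sqrt (v y))\<^sup>2 \<partial>N)"
    have nn: "0 \<le> p1" "0 \<le> p2" "0 \<le> p3" "0 \<le> p4" by (simp_all add: p1_def p2_def p3_def p4_def)
    have "d (z j) (z (Suc j)) = p1 / 4 + p2 / 4 + (p3 / 2 + p4 / 2)"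
      by (simp only: z d_def prod.case p1_def p2_def p3_def p4_def)
    then have "p1 / 4 + p2 / 4 + (p3 / 2 + p4 / 2) \<le> 1 / 8 ^ j" using zd[of j "Suc j"] by simp
    then have le: "p1 \<le> 4 * (1 / 8 ^ j)" "p2 \<le> 4 * (1 / 8 ^ j)" "p3 \<le> 2 * (1 / 8 ^ j)" "p4 \<le> 2 * (1 / 8 ^ j)"
      using nn by linarith+
    show "(norm2 P (\<lambda>z. \<psi> (Suc j) z - \<psi> j z))\<^sup>2 \<le> 4 / 8 ^ j" "(norm2 P (\<lambda>z. \<theta> (Suc j) z - \<theta> j z))\<^sup>2 \<le> 4 / 8 ^ j"
      "(\<integral>x. (norm (exp (- a (Suc j) x / 2) * sqrt (u x) - exp (- a j x / 2) * sqrt (u x)))\<^sup>2 \<partial>M) \<le> 2 / 8 ^ j"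
      "(\<integral>y. (norm (exp (- b (Suc j) y / 2) * sqrt (v y) - exp (- b j y / 2) * sqrt (v y)))\<^sup>2 \<partial>N) \<le> 2 / 8 ^ j"
      using le unfolding p1_def p2_def p3_def p4_def norm2_def norm_minus_commute[of "\<psi> j _"] norm_minus_commute[of "\<theta> j _"]
      by (simp_all add: power2_commute[of "exp (- (a j _ / 2)) * _"] power2_commute[of "exp (- (b j _ / 2)) * _"])
  qed
  have conv\<psi>: "AE z in P. convergent (\<lambda>j. \<psi> j z)"
  proof (rule AE_convergent_of_fast_Cauchy[where C = 4])
    show "integrable P (\<lambda>z. (norm (\<psi> (Suc n) z - \<psi> n z))\<^sup>2)" for n
      by (rule sqint_integrable_square[OF sqint_diff[OF fD(1) fD(1)]])
  qed (use dj(1) in \<open>simp_all add: norm2_square\<close>)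
  have conv\<theta>: "AE z in P. convergent (\<lambda>j. \<theta> j z)"
  proof (rule AE_convergent_of_fast_Cauchy[where C = 4])
    show "integrable P (\<lambda>z. (norm (\<theta> (Suc n) z - \<theta> n z))\<^sup>2)" for n
      by (rule sqint_integrable_square[OF sqint_diff[OF fD(2) fD(2)]])
  qed (use dj(2) in \<open>simp_all add: norm2_square\<close>)
  have "AE x in M. convergent (\<lambda>j. exp (- a j x / 2) * sqrt (u x))"
  proof (rule AE_convergent_of_fast_Cauchy[where C = 2])
    show "integrable M (\<lambda>x. (norm (exp (- a (Suc n) x / 2) * sqrt (u x) - exp (- a n x / 2) * sqrt (u x)))\<^sup>2)" for n
      using exp_parallelogram(2)[OF fm(1)[OF f] fm(3)[OF f] fm(1)[OF f] fm(3)[OF f] u(1,2), of "Suc n" n] by simp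
  qed (use dj(3) in simp_all)
  then have bda: "AE x in M. \<exists>c. \<forall>j. a j x \<le> c"
    by (rule AE_bounded_of_convergent_exp[OF fm(5)[OF f] fm(3)[OF f] fD(7)]) (use u(3) in simp)
  have "AE y in N. convergent (\<lambda>j. exp (- b j y / 2) * sqrt (v y))"
  proof (rule AE_convergent_of_fast_Cauchy[where C = 2])
    show "integrable N (\<lambda>x. (norm (exp (- b (Suc n) x / 2) * sqrt (v x) - exp (- b n x / 2) * sqrt (v x)))\<^sup>2)" for n
      using exp_parallelogram(2)[OF fm(2)[OF f] fm(4)[OF f] fm(2)[OF f] fm(4)[OF f] v(1,2), of "Suc n" n] by simp
  qed (use dj(4) in simp_all)
  then have bdb: "AE y in N. \<exists>c. \<forall>j. b j y \<le> c"
    by (rule AE_bounded_of_convergent_exp[OF fm(6)[OF f] fm(4)[OF f] fD(8)]) (use v(3) in simp)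
  let ?\<psi> = "\<lambda>z. lim (\<lambda>j. \<psi> j z)" and ?\<theta> = "\<lambda>z. lim (\<lambda>j. \<theta> j z)"
  have lim: "AE z in P. (\<lambda>j. mismatch \<phi> (\<psi> j) (\<theta> j) z) \<longlonglongrightarrow> mismatch \<phi> ?\<psi> ?\<theta> z"
    using conv\<psi> conv\<theta> unfolding mismatch_def
    by eventually_elim (auto simp: convergent_LIMSEQ_iff intro!: tendsto_intros)
  have mm: "mismatch \<phi> ?\<psi> ?\<theta> \<in> borel_measurable P" unfolding mismatch_def by measurable
  have key: "mismatch \<phi> ?\<psi> ?\<theta> \<in> square_integrable P \<and> norm2 P (mismatch \<phi> ?\<psi> ?\<theta>) \<le> \<delta> n" for n
  proof -
    have "AE z in P. (\<lambda>j. mismatch \<phi> (\<psi> (j + n)) (\<theta> (j + n)) z) \<longlonglongrightarrow> mismatch \<phi> ?\<psi> ?\<theta> z"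
      using lim by eventually_elim (rule LIMSEQ_ignore_initial_segment)
    moreover have "norm2 P (mismatch \<phi> (\<psi> (j + n)) (\<theta> (j + n))) \<le> \<delta> n" for j
    proof -
      have "n \<le> r (j + n)" using seq_suble[OF r, of "j + n"] by simp
      then show ?thesis using mis[of "j + n"] \<delta>_dec by (meson order_trans)
    qed
    ultimately show ?thesis
      using sqint_AE_limit[of "\<lambda>j. mismatch \<phi> (\<psi> (j + n)) (\<theta> (j + n))" P "\<delta> n", OF mismatch_sqint(1)[OF \<phi> fD(1,2)] _ mm]
      by blast
  qed
  have "(\<lambda>n. kernel_norm t * (1 / real (Suc n))) \<longlonglongrightarrow> kernel_norm t * 0"
    by (intro tendsto_mult tendsto_const lim_const_over_n[of 1, THEN LIMSEQ_Suc])
  then have "(\<lambda>n. sqrt (kernel_norm t * (1 / real (Suc n)))) \<longlonglongrightarrow> sqrt (kernel_norm t * 0)" by (rule tendsto_real_sqrt)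
  then have \<delta>0: "\<delta> \<longlonglongrightarrow> 0" by (simp add: \<delta>_def[abs_def])
  have "norm2 P (mismatch \<phi> ?\<psi> ?\<theta>) \<le> 0" by (rule LIMSEQ_le_const[OF \<delta>0]) (use key in auto)
  then have "norm2 P (mismatch \<phi> ?\<psi> ?\<theta>) = 0" using norm2_nonneg by (rule antisym)
  then have "AE z in P. mismatch \<phi> ?\<psi> ?\<theta> z = 0" using norm2_eq_0_iff key[of 0] by blast
  then have eq: "AE z in P. ?\<theta> z = \<phi> z * ?\<psi> z"
  proof eventually_elim
    case (elim z)
    then show ?case using weight_pos[of \<phi> z] by (simp add: mismatch_def)
  qed
  show ?thesis by (rule that[OF f tpsi conv\<psi> conv\<theta> eq bda bdb])
qed


lemma AE_fst:
  assumes "AE x in M. Q x" shows "AE z in P. Q (fst z)"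
proof -
  obtain A where A: "A \<in> null_sets M" "\<And>x. x \<in> space M - A \<Longrightarrow> Q x"
    using assms by (rule AE_E3) (rule that, assumption+)
  have "A \<times> space N \<in> null_sets P"
    using A(1) by (auto simp: null_sets_def M2.emeasure_pair_measure_Times)
  moreover have "x \<in> A" if "x \<in> space M" "\<not> Q x" for x using A(2) that by blast
  ultimately show ?thesis by (intro AE_I'[of "A \<times> space N"]) (auto simp: space_pair_measure)
qed

lemma AE_snd:
  assumes "AE y in N. Q y" shows "AE z in P. Q (snd z)"
proof -
  obtain B where B: "B \<in> null_sets N" "\<And>y. y \<in> space N - B \<Longrightarrow> Q y" using assms by (auto elim: AE_E3)
  have "space M \<times> B \<in> null_sets P"
    using B(1) by (auto simp: null_sets_def M2.emeasure_pair_measure_Times)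
  moreover have "y \<in> B" if "y \<in> space N" "\<not> Q y" for y using B(2) that by blast
  ultimately show ?thesis by (intro AE_I'[of "space M \<times> B"]) (auto simp: space_pair_measure)
qed

text \<open>The multiplier is the limit of a separating sequence, cut off to a rectangle of finite measure on
  which the densities are at most \<open>m\<close>. For large \<open>m\<close> the cut-off changes \<open>Re \<integral> t \<psi>\<close> by at most \<open>\<epsilon> / 4\<close>. The last
  property holds because \<open>\<integral> r \<sigma>\<close> is the pairing of \<open>\<sigma> r\<close> with the indicator functions of the sides.\<close>

lemma separating_multiplier:
  assumes \<phi> [measurable]: "\<phi> \<in> borel_measurable P" and t: "t \<in> square_integrable P" and \<epsilon>: "\<epsilon> > 0"
    and sep: "\<And>k. k \<in> multiplier_kernels M N \<phi> \<Longrightarrow> \<epsilon> \<le> kernel_norm k + kernel_norm (\<lambda>z. t z - \<phi> z * k z)"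
  obtains \<sigma> c where "\<sigma> \<in> square_integrable P" "schur_multiplier \<sigma>" "schur_multiplier (\<lambda>z. \<phi> z * \<sigma> z)"
    "\<epsilon> / 4 \<le> Re (\<integral>z. t z * \<sigma> z \<partial>P)"
    "\<And>r. r \<in> square_integrable P \<Longrightarrow> Re (\<integral>z. r z * \<sigma> z \<partial>P) \<le> 2 * kernel_norm r"
    "\<And>r. r \<in> square_integrable P \<Longrightarrow> Re (\<integral>z. r z * \<sigma> z \<partial>P) \<le> c * kernel_norm (\<lambda>z. \<sigma> z * r z)"
proof -
  obtain \<psi> \<theta> a b where f: "\<And>j::nat. feasible (\<psi> j) (\<theta> j) (a j) (b j)"
    and tpsi: "\<And>j. \<epsilon> / 2 \<le> Re (\<integral>z. t z * \<psi> j z \<partial>P)"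
    and lims: "AE z in P. convergent (\<lambda>j. \<psi> j z)" "AE z in P. convergent (\<lambda>j. \<theta> j z)"
      "AE z in P. lim (\<lambda>j. \<theta> j z) = \<phi> z * lim (\<lambda>j. \<psi> j z)"
    and bd: "AE x in M. \<exists>c. \<forall>j. a j x \<le> c" "AE y in N. \<exists>c. \<forall>j. b j y \<le> c"
    by (rule separating_sequence[OF \<phi> t \<epsilon> sep], assumption, rule that, assumption+)
  note fD = feasibleD[OF f]
  note [measurable] = sqint_measurable[OF fD(1)] sqint_measurable[OF fD(2)] sqint_measurable[OF t]
    borel_measurable_integrable[OF dominatedD(2)[OF fD(5)]] borel_measurable_integrable[OF dominatedD(3)[OF fD(5)]]
  obtain X Y where XY: "\<And>i::nat. X i \<in> sets M" "\<And>i. emeasure M (X i) < \<infinity>" "incseq X" "(\<Union>i. X i) = space M"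
    "\<And>i. Y i \<in> sets N" "\<And>i. emeasure N (Y i) < \<infinity>" "incseq Y" "(\<Union>i. Y i) = space N"
    by (rule exhausting_rectangles, rule that, assumption+)
  note [measurable] = XY(1,5)
  define A where "A m = {x \<in> space M. x \<in> X m \<and> (\<forall>j. a j x \<le> real m)}" for m
  define B where "B m = {y \<in> space N. y \<in> Y m \<and> (\<forall>j. b j y \<le> real m)}" for m
  have Am [measurable]: "A m \<in> sets M" and Bm [measurable]: "B m \<in> sets N" for m
    unfolding A_def B_def by measurable
  have Afin: "emeasure M (A m) < \<infinity>" and Bfin: "emeasure N (B m) < \<infinity>" for m
    using emeasure_mono[of "A m" "X m" M] emeasure_mono[of "B m" "Y m" N] XY(1,2,5,6)
    by (auto simp: A_def B_def intro: le_less_trans)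
  have ev: "AE z in P. \<forall>\<^sub>F m in sequentially. z \<in> A m \<times> B m"
    using AE_fst[OF bd(1)] AE_snd[OF bd(2)] AE_space
  proof eventually_elim
    case (elim z)
    obtain c d where c: "\<And>j. a j (fst z) \<le> c" and d: "\<And>j. b j (snd z) \<le> d" using elim by auto
    obtain m0 where m0: "max c d \<le> real m0" using real_arch_simple by blast
    have "\<forall>\<^sub>F m in sequentially. z \<in> X m \<times> Y m" by (rule eventually_in_rectangles[OF XY(3,4,7,8) elim(3)])
    then show ?case
      using eventually_ge_at_top[of m0]
    proof eventually_elim
      case (elim m)
      have "max c d \<le> real m" using m0 elim(2) by (meson of_nat_mono order_trans)
      then have "a j (fst z) \<le> real m" "b j (snd z) \<le> real m" for j
        using c[of j] d[of j] by linarith+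
      then show ?case
        using elim(1) \<open>z \<in> space P\<close> by (auto simp: A_def B_def space_pair_measure)
    qed
  qed
  have "(\<lambda>m. norm2 P (\<lambda>z. indicator (A m \<times> B m) z * t z - t z)) \<longlonglongrightarrow> 0"
  proof (rule norm2_dominated_convergence[OF _ _ t, where c = 1])
    show "AE z in P. (\<lambda>m. indicator (A m \<times> B m) z * t z) \<longlonglongrightarrow> t z"
      using ev
    proof eventually_elim
      case (elim z)
      then have "\<forall>\<^sub>F m in sequentially. indicator (A m \<times> B m) z * t z = t z" by eventually_elim simp
      then show ?case by (rule tendsto_eventually)
    qed
    show "AE z in P. cmod (indicator (A m \<times> B m) z * t z - t z) \<le> 1 * cmod (t z)" for m
      by (rule AE_I2) (simp add: indicator_def)
  qed measurable
  then have "\<forall>\<^sub>F m in sequentially. norm2 P (\<lambda>z. indicator (A m \<times> B m) z * t z - t z) < \<epsilon> / 8"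
    using \<epsilon> by (intro order_tendstoD(2)) auto
  then obtain m where m: "norm2 P (\<lambda>z. indicator (A m \<times> B m) z * t z - t z) < \<epsilon> / 8"
    by (auto simp: eventually_sequentially)
  define G where "G = A m \<times> B m"
  have Gm [measurable]: "G \<in> sets P" unfolding G_def by measurable
  have "AE z in P. convergent (\<lambda>j. \<psi> j z) \<and> convergent (\<lambda>j. \<theta> j z) \<and> lim (\<lambda>j. \<theta> j z) = \<phi> z * lim (\<lambda>j. \<psi> j z)"
    using lims by eventually_elim simp
  then obtain Z where Z: "Z \<in> null_sets P"
    "\<And>z. z \<in> space P - Z \<Longrightarrow> convergent (\<lambda>j. \<psi> j z) \<and> convergent (\<lambda>j. \<theta> j z) \<and> lim (\<lambda>j. \<theta> j z) = \<phi> z * lim (\<lambda>j. \<psi> j z)"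
    by (rule AE_E3) (rule that, assumption+)
  have [measurable]: "Z \<in> sets P" using Z(1) by auto
  \<comment> \<open>Without the null set \<open>Z\<close> the equation \<open>\<phi> \<sigma> = \<tau>\<close> and the bound \<open>m\<close> hold everywhere.\<close>
  define \<sigma> where "\<sigma> z = (if z \<in> G - Z then lim (\<lambda>j. \<psi> j z) else 0)" for z
  define \<tau> where "\<tau> z = (if z \<in> G - Z then lim (\<lambda>j. \<theta> j z) else 0)" for z
  have \<sigma>m [measurable]: "\<sigma> \<in> borel_measurable P" and \<tau>m [measurable]: "\<tau> \<in> borel_measurable P"
    unfolding \<sigma>_def \<tau>_def by measurable
  have G_space: "G \<subseteq> space P" using sets.sets_into_space[OF Gm] .
  have \<sigma>\<tau>: "(\<lambda>z. \<phi> z * \<sigma> z) = \<tau>" using Z(2) G_space by (auto simp: \<sigma>_def \<tau>_def fun_eq_iff)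
  have a_le: "a j x \<le> real m" if "x \<in> A m" for j x using that by (simp add: A_def)
  have b_le: "b j y \<le> real m" if "y \<in> B m" for j y using that by (simp add: B_def)
  have conv: "(\<lambda>j. \<psi> j z) \<longlonglongrightarrow> \<sigma> z" "(\<lambda>j. \<theta> j z) \<longlonglongrightarrow> \<tau> z" if "z \<in> G - Z" for z
    using Z(2)[of z] that G_space by (auto simp: \<sigma>_def \<tau>_def convergent_LIMSEQ_iff)
  have bound: "cmod (\<rho> z) \<le> real m" if dom: "\<And>j. dominated (\<rho>' j) (a j) (b j)" and l: "(\<lambda>j. \<rho>' j z) \<longlonglongrightarrow> \<rho> z" and z: "z \<in> G"
    for \<rho> :: "'a \<times> 'b \<Rightarrow> complex" and \<rho>' z
  proof (rule LIMSEQ_le_const2[OF tendsto_norm[OF l]], intro exI allI impI)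
    fix j :: nat
    obtain x y where xy: "z = (x, y)" "x \<in> A m" "y \<in> B m" using z by (auto simp: G_def)
    have "cmod (\<rho>' j (x, y)) \<le> (a j x + b j y) / 2" using dom by (rule dominatedD(6))
    also have "\<dots> \<le> (real m + real m) / 2" using a_le[OF xy(2)] b_le[OF xy(3)] by (intro divide_right_mono add_mono) auto
    finally show "cmod (\<rho>' j z) \<le> real m" by (simp add: xy)
  qed
  have \<sigma>_le: "cmod (\<sigma> z) \<le> real m" for z
  proof (cases "z \<in> G - Z")
    case True
    then have "z \<in> G" by blast
    then show ?thesis by (rule bound[of \<psi> z \<sigma>, OF fD(5) conv(1)[OF True]])
  next
    case False
    then have "\<sigma> z = 0" by (simp only: \<sigma>_def if_False)
    then show ?thesis by simp
  qed
  have \<tau>_le: "cmod (\<tau> z) \<le> real m" for z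
  proof (cases "z \<in> G - Z")
    case True
    then have "z \<in> G" by blast
    then show ?thesis by (rule bound[of \<theta> z \<tau>, OF fD(6) conv(2)[OF True]])
  next
    case False
    then have "\<tau> z = 0" by (simp only: \<tau>_def if_False)
    then show ?thesis by simp
  qed
  have \<sigma>0: "\<sigma> z = 0" and \<tau>0: "\<tau> z = 0" if "z \<notin> A m \<times> B m" for z
    using that by (auto simp: \<sigma>_def \<tau>_def G_def)
  have AE\<sigma>: "AE z in P. z \<in> A m \<times> B m \<longrightarrow> (\<lambda>j. \<psi> j z) \<longlonglongrightarrow> \<sigma> z"
    and AE\<tau>: "AE z in P. z \<in> A m \<times> B m \<longrightarrow> (\<lambda>j. \<theta> j z) \<longlonglongrightarrow> \<tau> z"
    using AE_not_in[OF Z(1)] by (eventually_elim, use conv in \<open>auto simp: G_def\<close>)+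
  note lim\<sigma> = limit_of_dominated[where a = a and b = b and m = "real m", OF fD(5) Am Bm a_le b_le AE\<sigma> \<sigma>0 \<sigma>m \<sigma>_le of_nat_0_le_iff]
  note lim\<tau> = limit_of_dominated[where a = a and b = b and m = "real m", OF fD(6) Am Bm a_le b_le AE\<tau> \<tau>0 \<tau>m \<tau>_le of_nat_0_le_iff]
  have S\<sigma>: "schur_multiplier \<sigma>"
    unfolding schur_multiplier_def using \<sigma>m \<sigma>_le lim\<sigma>(1) by (auto intro!: exI[of _ "real m"])
  have S\<tau>: "schur_multiplier (\<lambda>z. \<phi> z * \<sigma> z)"
    unfolding \<sigma>\<tau> unfolding schur_multiplier_def using \<tau>m \<tau>_le lim\<tau>(1) by (auto intro!: exI[of _ "real m"])
  have form_lim: "(\<lambda>j. Re (form r (\<psi> j) (indicator (A m)) (indicator (B m)))) \<longlonglongrightarrow> Re (\<integral>z. r z * \<sigma> z \<partial>P)"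
    if "r \<in> square_integrable P" for r
    using lim\<sigma>(2)[OF _ _ _ that Afin Bfin] by (intro tendsto_Re) auto
  have t_ge: "\<epsilon> / 4 \<le> Re (\<integral>z. t z * \<sigma> z \<partial>P)"
  proof (rule LIMSEQ_le_const[OF form_lim[OF t]], intro exI allI impI)
    fix j :: nat
    define s where "s z = indicator G z * t z - t z" for z
    have s: "s \<in> square_integrable P"
      unfolding s_def by (intro sqint_diff t, rule sqint_bounded_mult[OF t, where c = 1]) (auto simp: indicator_def)
    have i: "integrable P (\<lambda>z. t z * \<psi> j z)" "integrable P (\<lambda>z. s z * \<psi> j z)"
      by (intro sqint_integrable_mult t s fD(1))+
    have "form t (\<psi> j) (indicator (A m)) (indicator (B m)) = (\<integral>z. t z * \<psi> j z + s z * \<psi> j z \<partial>P)"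
      unfolding form_def tensor_indicator by (intro Bochner_Integration.integral_cong) (auto simp: s_def G_def algebra_simps)
    also have "\<dots> = (\<integral>z. t z * \<psi> j z \<partial>P) + (\<integral>z. s z * \<psi> j z \<partial>P)" using i by simp
    finally have "Re (form t (\<psi> j) (indicator (A m)) (indicator (B m))) = Re (\<integral>z. t z * \<psi> j z \<partial>P) + Re (\<integral>z. s z * \<psi> j z \<partial>P)"
      by simp
    moreover have "\<bar>Re (\<integral>z. s z * \<psi> j z \<partial>P)\<bar> \<le> \<epsilon> / 4"
    proof -
      have "\<bar>Re (\<integral>z. s z * \<psi> j z \<partial>P)\<bar> \<le> norm2 P s * norm2 P (\<psi> j)"
        using abs_Re_le_cmod Cauchy_Schwarz_L2[OF s fD(1)] by (rule order_trans)
      also have "\<dots> \<le> (\<epsilon> / 8) * 2"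
        using m fD(3) \<epsilon> unfolding s_def G_def by (intro mult_mono) auto
      finally show ?thesis by simp
    qed
    ultimately show "\<epsilon> / 4 \<le> Re (form t (\<psi> j) (indicator (A m)) (indicator (B m)))"
      using tpsi[of j] by linarith
  qed
  have r_le: "Re (\<integral>z. r z * \<sigma> z \<partial>P) \<le> 2 * kernel_norm r" if r: "r \<in> square_integrable P" for r
  proof (rule LIMSEQ_le_const2[OF form_lim[OF r]], intro exI allI impI)
    fix j :: nat
    have "(\<integral>x. a j x * (cmod (indicator (A m) x))\<^sup>2 \<partial>M) \<le> integral\<^sup>L M (a j)"
      using dominatedD(2,4)[OF fD(5)] by (intro integral_mono') (auto simp: indicator_def)
    moreover have "(\<integral>y. b j y * (cmod (indicator (B m) y))\<^sup>2 \<partial>N) \<le> integral\<^sup>L N (b j)"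
      using dominatedD(3,5)[OF fD(5)] by (intro integral_mono') (auto simp: indicator_def)
    ultimately have le: "(\<integral>x. a j x * (cmod (indicator (A m) x))\<^sup>2 \<partial>M) + (\<integral>y. b j y * (cmod (indicator (B m) y))\<^sup>2 \<partial>N) \<le> 4"
      using fD(7,8)[of j] by linarith
    have "Re (form r (\<psi> j) (indicator (A m)) (indicator (B m))) \<le> kernel_norm r / 2 *
        ((\<integral>x. a j x * (cmod (indicator (A m) x))\<^sup>2 \<partial>M) + (\<integral>y. b j y * (cmod (indicator (B m) y))\<^sup>2 \<partial>N))"
      by (rule dominated_form_le[OF fD(5) r]) (auto simp: bounded_iff indicator_def intro!: exI[of _ 1])
    also have "\<dots> \<le> kernel_norm r / 2 * 4" using le kernel_norm_nonneg[OF r] by (intro mult_left_mono) auto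
    finally show "Re (form r (\<psi> j) (indicator (A m)) (indicator (B m))) \<le> 2 * kernel_norm r" by simp
  qed
  define c where "c = norm2 M (indicator (A m)) * norm2 N (indicator (B m))"
  have r_le': "Re (\<integral>z. r z * \<sigma> z \<partial>P) \<le> c * kernel_norm (\<lambda>z. \<sigma> z * r z)" if r: "r \<in> square_integrable P" for r
  proof -
    have \<sigma>r: "(\<lambda>z. \<sigma> z * r z) \<in> square_integrable P" by (rule sqint_bounded_mult[OF r \<sigma>m \<sigma>_le])
    have "(\<integral>z. r z * \<sigma> z \<partial>P) = pairing (\<lambda>z. \<sigma> z * r z) (indicator (A m)) (indicator (B m))"
      unfolding pairing_def tensor_indicator
    proof (intro Bochner_Integration.integral_cong refl)
      fix z show "r z * \<sigma> z = \<sigma> z * r z * indicator (A m \<times> B m) z"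
      proof (cases "z \<in> A m \<times> B m")
        case False
        then have "\<sigma> z = 0" by (rule \<sigma>0)
        then show ?thesis by simp
      qed simp
    qed
    then have "Re (\<integral>z. r z * \<sigma> z \<partial>P) \<le> cmod (pairing (\<lambda>z. \<sigma> z * r z) (indicator (A m)) (indicator (B m)))"
      using complex_Re_le_cmod by simp
    also have "\<dots> \<le> kernel_norm (\<lambda>z. \<sigma> z * r z) * c"
      unfolding c_def by (rule pairing_le_kernel_norm[OF \<sigma>r sqint_indicator[OF Am Afin] sqint_indicator[OF Bm Bfin]])
    finally show ?thesis by (simp add: mult.commute)
  qed
  have "(\<lambda>z. \<sigma> z * tensor (indicator (A m)) (indicator (B m)) z) \<in> square_integrable P"
    by (rule sqint_bounded_mult[OF tensor_sqint[OF sqint_indicator[OF Am Afin] sqint_indicator[OF Bm Bfin]] \<sigma>m \<sigma>_le])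
  moreover have "(\<lambda>z. \<sigma> z * tensor (indicator (A m)) (indicator (B m)) z) = \<sigma>"
    using \<sigma>0 by (auto simp: tensor_indicator fun_eq_iff indicator_def)
  ultimately have "\<sigma> \<in> square_integrable P" by (simp only:)
  then show ?thesis using S\<sigma> S\<tau> t_ge r_le r_le' by (rule that)
qed

section \<open>Sums and products\<close>

lemma schur_multiplier_sqint:
  assumes "schur_multiplier \<sigma>" "k \<in> square_integrable P"
  shows "(\<lambda>z. \<sigma> z * k z) \<in> square_integrable P"
proof -
  obtain c where "\<sigma> \<in> borel_measurable P" "\<And>z. cmod (\<sigma> z) \<le> c"
    using assms(1) unfolding schur_multiplier_def by auto
  then show ?thesis by (rule sqint_bounded_mult[OF assms(2)])
qed

lemma schur_multiplier_norm:
  assumes "schur_multiplier \<sigma>"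
  obtains c where "0 \<le> c" "\<And>k. k \<in> square_integrable P \<Longrightarrow> kernel_norm (\<lambda>z. \<sigma> z * k z) \<le> c * kernel_norm k"
proof -
  have "\<exists>c\<ge>0. \<forall>k\<in>square_integrable P. kernel_norm (\<lambda>z. \<sigma> z * k z) \<le> c * kernel_norm k"
    using assms by (simp only: schur_multiplier_def)
  then obtain c where c: "0 \<le> c" "\<forall>k\<in>square_integrable P. kernel_norm (\<lambda>z. \<sigma> z * k z) \<le> c * kernel_norm k"
    by (elim exE conjE)
  show ?thesis by (rule that[OF c(1)]) (rule c(2)[rule_format])
qed

lemma schur_multiplier_tendsto_0:
  assumes \<sigma>: "schur_multiplier \<sigma>" and k: "\<And>n. k n \<in> square_integrable P"
    and lim: "(\<lambda>n. kernel_norm (k n)) \<longlonglongrightarrow> 0"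
  shows "(\<lambda>n. kernel_norm (\<lambda>z. \<sigma> z * k n z)) \<longlonglongrightarrow> 0"
proof -
  obtain c where c: "0 \<le> c" "\<And>k. k \<in> square_integrable P \<Longrightarrow> kernel_norm (\<lambda>z. \<sigma> z * k z) \<le> c * kernel_norm k"
    by (rule schur_multiplier_norm[OF \<sigma>], rule that, assumption+)
  show ?thesis
  proof (rule real_tendsto_sandwich[OF _ _ tendsto_const])
    show "(\<lambda>n. c * kernel_norm (k n)) \<longlonglongrightarrow> 0" using tendsto_mult_left[OF lim, of c] by simp
    show "\<forall>\<^sub>F n in sequentially. 0 \<le> kernel_norm (\<lambda>z. \<sigma> z * k n z)"
      using kernel_norm_nonneg[OF schur_multiplier_sqint[OF \<sigma> k]] by simp
  qed (use c(2) k in simp)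
qed

text \<open>The reindexing \<open>h\<close> accommodates sequences that are compared with a subsequence of \<open>r\<close>.\<close>

lemma kernel_Cauchy_dominated:
  assumes r: "kernel_Cauchy r" and c: "0 \<le> c" and e: "e \<longlonglongrightarrow> (0::real)"
    and le: "\<And>m n. kernel_norm (\<lambda>z. s m z - s n z) \<le> c * kernel_norm (\<lambda>z. r (h m) z - r (h n) z) + (e m + e n)"
    and h: "\<And>n. n \<le> h n"
  shows "kernel_Cauchy s"
  unfolding kernel_Cauchy_def
proof (intro allI impI)
  fix \<epsilon> :: real assume \<epsilon>: "\<epsilon> > 0"
  have c1: "0 < c + 1" using c by simp
  then have pos: "0 < \<epsilon> / 2 / (c + 1)" using \<epsilon> by simp
  obtain L where L: "\<And>m n. m \<ge> L \<Longrightarrow> n \<ge> L \<Longrightarrow> kernel_norm (\<lambda>z. r m z - r n z) < \<epsilon> / 2 / (c + 1)"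
    using r pos unfolding kernel_Cauchy_def by meson
  have "\<forall>\<^sub>F n in sequentially. e n < \<epsilon> / 4" using e \<epsilon> by (intro order_tendstoD(2)) auto
  then obtain L' where L': "\<And>n. n \<ge> L' \<Longrightarrow> e n < \<epsilon> / 4" by (auto simp: eventually_sequentially)
  have "kernel_norm (\<lambda>z. s m z - s n z) < \<epsilon>" if mn: "m \<ge> max L L'" "n \<ge> max L L'" for m n
  proof -
    have "L \<le> h m" "L \<le> h n" using mn h[of m] h[of n] by linarith+
    then have "c * kernel_norm (\<lambda>z. r (h m) z - r (h n) z) \<le> c * (\<epsilon> / 2 / (c + 1))"
      using L[of "h m" "h n"] c by (intro mult_left_mono) auto
    also have "\<dots> \<le> \<epsilon> / 2" using c1 \<epsilon> c by (simp add: field_simps)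
    finally show ?thesis using le[of m n] L'[of m] L'[of n] mn by simp
  qed
  then show "\<exists>L. \<forall>m\<ge>L. \<forall>n\<ge>L. kernel_norm (\<lambda>z. s m z - s n z) < \<epsilon>" by blast
qed

lemma tendsto_0_of_subsequence:
  assumes r: "\<And>n. r n \<in> square_integrable P" and Cau: "kernel_Cauchy r" and h: "\<And>n::nat. n \<le> h n"
    and lim: "(\<lambda>n. kernel_norm (r (h n))) \<longlonglongrightarrow> 0"
  shows "(\<lambda>n. kernel_norm (r n)) \<longlonglongrightarrow> 0"
proof (rule LIMSEQ_I)
  fix e :: real assume e: "e > 0"
  obtain L where L: "\<And>m n. m \<ge> L \<Longrightarrow> n \<ge> L \<Longrightarrow> kernel_norm (\<lambda>z. r m z - r n z) < e / 2"
    using Cau e unfolding kernel_Cauchy_def by (meson half_gt_zero)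
  have "\<forall>\<^sub>F n in sequentially. kernel_norm (r (h n)) < e / 2" using lim e by (intro order_tendstoD(2)) auto
  then obtain L' where L': "\<And>n. n \<ge> L' \<Longrightarrow> kernel_norm (r (h n)) < e / 2" by (auto simp: eventually_sequentially)
  define m where "m = h (max L L')"
  have m: "m \<ge> L" "kernel_norm (r m) < e / 2" using h[of "max L L'"] L'[of "max L L'"] by (auto simp: m_def)
  have "norm (kernel_norm (r n) - 0) < e" if "n \<ge> L" for n
  proof -
    have "kernel_norm (\<lambda>z. (r n z - r m z) + r m z) \<le> kernel_norm (\<lambda>z. r n z - r m z) + kernel_norm (r m)"
      by (rule kernel_norm_triangle[OF sqint_diff[OF r r] r])
    then show ?thesis using L[OF that m(1)] m(2) kernel_norm_nonneg[OF r, of n] by simp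
  qed
  then show "\<exists>L. \<forall>n\<ge>L. norm (kernel_norm (r n) - 0) < e" by blast
qed

text \<open>If the kernels \<open>r n\<close>, for large \<open>n\<close>, were approximated by \<open>\<phi> k\<close> with \<open>p(k)\<close> small, closability would force
  \<open>p(r n) \<rightarrow> 0\<close>. Otherwise a separating multiplier \<open>\<sigma>\<close> for one late member \<open>t\<close> of the sequence has
  \<open>Re \<integral> r n \<sigma> \<ge> \<epsilon> / 8\<close> for all later \<open>n\<close>, since \<open>|\<integral> (r n - t) \<sigma>| \<le> 2 p(r n - t)\<close>; this bounds \<open>p(\<sigma> r n)\<close> away from 0.\<close>

lemma tendsto_0_of_multipliers:
  assumes \<phi>: "\<phi> \<in> borel_measurable P" and cl: "kernel_closable \<phi>"
    and r: "\<And>n. r n \<in> square_integrable P" and Cau: "kernel_Cauchy r"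
    and mult: "\<And>\<sigma>. schur_multiplier \<sigma> \<Longrightarrow> schur_multiplier (\<lambda>z. \<phi> z * \<sigma> z) \<Longrightarrow>
      (\<lambda>n. kernel_norm (\<lambda>z. \<sigma> z * r n z)) \<longlonglongrightarrow> 0"
  shows "(\<lambda>n. kernel_norm (r n)) \<longlonglongrightarrow> 0"
proof (rule ccontr)
  assume not0: "\<not> (\<lambda>n. kernel_norm (r n)) \<longlonglongrightarrow> 0"
  have "\<exists>\<epsilon>>0. \<exists>L. \<forall>n\<ge>L. \<forall>k\<in>multiplier_kernels M N \<phi>. \<epsilon> \<le> kernel_norm k + kernel_norm (\<lambda>z. r n z - \<phi> z * k z)"
  proof (rule ccontr)
    assume contr: "\<not> ?thesis"
    have "\<exists>n k. j \<le> n \<and> k \<in> multiplier_kernels M N \<phi> \<and>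
        kernel_norm k + kernel_norm (\<lambda>z. r n z - \<phi> z * k z) < 1 / real (Suc j)" for j
    proof -
      have "0 < 1 / real (Suc j)" by simp
      then have "\<not> (\<forall>n\<ge>j. \<forall>k\<in>multiplier_kernels M N \<phi>. 1 / real (Suc j) \<le> kernel_norm k + kernel_norm (\<lambda>z. r n z - \<phi> z * k z))"
        using contr by blast
      then show ?thesis by (auto simp: not_le)
    qed
    then obtain h k where h: "\<And>j. j \<le> h j" and k: "\<And>j. k j \<in> multiplier_kernels M N \<phi>"
      and small: "\<And>j. kernel_norm (k j) + kernel_norm (\<lambda>z. r (h j) z - \<phi> z * k j z) < 1 / real (Suc j)" by metis
    note kD = multiplier_kernelsD[OF k]
    define e where "e j = kernel_norm (\<lambda>z. r (h j) z - \<phi> z * k j z)" for j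
    have e_nn: "0 \<le> e j" and k_nn: "0 \<le> kernel_norm (k j)" for j
      unfolding e_def by (intro kernel_norm_nonneg sqint_diff r kD)+
    have e0: "e \<longlonglongrightarrow> 0"
    proof (rule tendsto_0_of_less_inverse_Suc[OF e_nn])
      show "e j < 1 / real (Suc j)" for j using small[of j] k_nn[of j] unfolding e_def by linarith
    qed
    have k0: "(\<lambda>j. kernel_norm (k j)) \<longlonglongrightarrow> 0"
    proof (rule tendsto_0_of_less_inverse_Suc[OF k_nn])
      show "kernel_norm (k j) < 1 / real (Suc j)" for j using small[of j] e_nn[of j] unfolding e_def by linarith
    qed
    have "kernel_Cauchy (\<lambda>j z. \<phi> z * k j z)"
    proof (rule kernel_Cauchy_dominated[OF Cau _ e0 _ h, of 1])
      fix i j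
      let ?d = "\<lambda>j z. r (h j) z - \<phi> z * k j z"
      have d: "?d j \<in> square_integrable P" for j by (intro sqint_diff r kD)
      have "kernel_norm (\<lambda>z. (r (h i) z - r (h j) z) - (?d i z - ?d j z)) \<le>
          kernel_norm (\<lambda>z. r (h i) z - r (h j) z) + kernel_norm (\<lambda>z. ?d i z - ?d j z)"
        by (rule kernel_norm_triangle_diff[OF sqint_diff[OF r r] sqint_diff[OF d d]])
      also have "(\<lambda>z. (r (h i) z - r (h j) z) - (?d i z - ?d j z)) = (\<lambda>z. \<phi> z * k i z - \<phi> z * k j z)" by auto
      finally show "kernel_norm (\<lambda>z. \<phi> z * k i z - \<phi> z * k j z) \<le> 1 * kernel_norm (\<lambda>z. r (h i) z - r (h j) z) + (e i + e j)"
        using kernel_norm_triangle_diff[OF d d, of i j] unfolding e_def by linarith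
    qed simp
    then have \<phi>k0: "(\<lambda>j. kernel_norm (\<lambda>z. \<phi> z * k j z)) \<longlonglongrightarrow> 0"
      using cl k k0 unfolding kernel_closable_def by blast
    have "(\<lambda>j. kernel_norm (r (h j))) \<longlonglongrightarrow> 0"
    proof (rule real_tendsto_sandwich[OF _ _ tendsto_const])
      show "(\<lambda>j. e j + kernel_norm (\<lambda>z. \<phi> z * k j z)) \<longlonglongrightarrow> 0" using tendsto_add[OF e0 \<phi>k0] by simp
      have "kernel_norm (r (h j)) \<le> e j + kernel_norm (\<lambda>z. \<phi> z * k j z)" for j
        using kernel_norm_triangle[OF sqint_diff[OF r kD(2)] kD(2), of "h j" j j] by (simp add: e_def)
      then show "\<forall>\<^sub>F j in sequentially. kernel_norm (r (h j)) \<le> e j + kernel_norm (\<lambda>z. \<phi> z * k j z)" by simp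
    qed (use kernel_norm_nonneg[OF r] in simp)
    then have "(\<lambda>n. kernel_norm (r n)) \<longlonglongrightarrow> 0" by (rule tendsto_0_of_subsequence[OF r Cau h])
    with not0 show False by simp
  qed
  then obtain \<epsilon> L where \<epsilon>: "\<epsilon> > 0"
    and L: "\<And>n k. L \<le> n \<Longrightarrow> k \<in> multiplier_kernels M N \<phi> \<Longrightarrow> \<epsilon> \<le> kernel_norm k + kernel_norm (\<lambda>z. r n z - \<phi> z * k z)"
    by blast
  have "\<epsilon> / 16 > 0" using \<epsilon> by simp
  then obtain L' where L': "\<And>m n. m \<ge> L' \<Longrightarrow> n \<ge> L' \<Longrightarrow> kernel_norm (\<lambda>z. r m z - r n z) < \<epsilon> / 16"
    using Cau unfolding kernel_Cauchy_def by meson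
  define n0 where "n0 = max L L'"
  have sep: "\<epsilon> \<le> kernel_norm k + kernel_norm (\<lambda>z. r n0 z - \<phi> z * k z)" if "k \<in> multiplier_kernels M N \<phi>" for k
    using L[OF _ that] by (simp add: n0_def)
  obtain \<sigma> c where \<sigma>_sq: "\<sigma> \<in> square_integrable P" and \<sigma>: "schur_multiplier \<sigma>" "schur_multiplier (\<lambda>z. \<phi> z * \<sigma> z)"
    and t_ge: "\<epsilon> / 4 \<le> Re (\<integral>z. r n0 z * \<sigma> z \<partial>P)"
    and le2: "\<And>r. r \<in> square_integrable P \<Longrightarrow> Re (\<integral>z. r z * \<sigma> z \<partial>P) \<le> 2 * kernel_norm r"
    and lec: "\<And>r. r \<in> square_integrable P \<Longrightarrow> Re (\<integral>z. r z * \<sigma> z \<partial>P) \<le> c * kernel_norm (\<lambda>z. \<sigma> z * r z)"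
    by (rule separating_multiplier[OF \<phi> r \<epsilon> sep], assumption, rule that, assumption+)
  have "\<epsilon> / 8 \<le> c * kernel_norm (\<lambda>z. \<sigma> z * r n z)" if n: "n \<ge> n0" for n
  proof -
    have i: "integrable P (\<lambda>z. r j z * \<sigma> z)" for j
      by (rule sqint_integrable_mult[OF r \<sigma>_sq])
    have "Re (\<integral>z. (r n0 z - r n z) * \<sigma> z \<partial>P) \<le> 2 * kernel_norm (\<lambda>z. r n0 z - r n z)"
      by (rule le2[OF sqint_diff[OF r r]])
    moreover have "(\<integral>z. (r n0 z - r n z) * \<sigma> z \<partial>P) = (\<integral>z. r n0 z * \<sigma> z \<partial>P) - (\<integral>z. r n z * \<sigma> z \<partial>P)"
      unfolding left_diff_distrib using i by simp
    moreover have "kernel_norm (\<lambda>z. r n0 z - r n z) < \<epsilon> / 16" using L' n by (simp add: n0_def)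
    ultimately have "\<epsilon> / 8 \<le> Re (\<integral>z. r n z * \<sigma> z \<partial>P)" using t_ge by simp
    then show ?thesis using lec[OF r, of n] by linarith
  qed
  moreover have "(\<lambda>n. c * kernel_norm (\<lambda>z. \<sigma> z * r n z)) \<longlonglongrightarrow> 0"
    using tendsto_mult_left[OF mult[OF \<sigma>], of c] by simp
  ultimately have "\<epsilon> / 8 \<le> 0" by (intro LIMSEQ_le_const) auto
  with \<epsilon> show False by simp
qed


text \<open>The common step for sums and products: \<open>\<phi> l n = \<sigma> r n - p n\<close> is again a Cauchy sequence, and \<open>l n\<close> tends
  to 0.\<close>

lemma kernel_closable_perturbed:
  assumes cl: "kernel_closable \<phi>"
    and l: "\<And>n. l n \<in> square_integrable P" "(\<lambda>n. kernel_norm (l n)) \<longlonglongrightarrow> 0"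
    and p: "\<And>n. p n \<in> square_integrable P" "(\<lambda>n. kernel_norm (p n)) \<longlonglongrightarrow> 0"
    and r: "\<And>n. r n \<in> square_integrable P" "kernel_Cauchy r" and \<sigma>: "schur_multiplier \<sigma>"
    and eq: "\<And>n z. \<sigma> z * r n z = \<phi> z * l n z + p n z"
  shows "(\<lambda>n. kernel_norm (\<lambda>z. \<sigma> z * r n z)) \<longlonglongrightarrow> 0"
proof -
  define q where "q n z = \<sigma> z * r n z" for n z
  have q: "q n \<in> square_integrable P" for n
    unfolding q_def by (rule schur_multiplier_sqint[OF \<sigma> r(1)])
  have eq': "(\<lambda>z. \<phi> z * l n z) = (\<lambda>z. q n z - p n z)" for n
    by (simp add: q_def eq)
  have lk: "l n \<in> multiplier_kernels M N \<phi>" for n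
    using l(1)[of n] sqint_diff[OF q p(1), of n n] by (simp only: multiplier_kernels_def mem_Collect_eq eq' simp_thms)
  obtain c where c: "0 \<le> c" "\<And>k. k \<in> square_integrable P \<Longrightarrow> kernel_norm (\<lambda>z. \<sigma> z * k z) \<le> c * kernel_norm k"
    by (rule schur_multiplier_norm[OF \<sigma>], rule that, assumption+)
  have "kernel_Cauchy (\<lambda>n z. q n z - p n z)"
  proof (rule kernel_Cauchy_dominated[OF r(2) c(1) p(2), where h = "\<lambda>n. n"])
    fix m n
    have "kernel_norm (\<lambda>z. (q m z - q n z) - (p m z - p n z)) \<le> kernel_norm (\<lambda>z. q m z - q n z) + kernel_norm (\<lambda>z. p m z - p n z)"
      by (rule kernel_norm_triangle_diff[OF sqint_diff[OF q q] sqint_diff[OF p(1) p(1)]])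
    also have "(\<lambda>z. (q m z - q n z) - (p m z - p n z)) = (\<lambda>z. q m z - p m z - (q n z - p n z))" by auto
    finally have 1: "kernel_norm (\<lambda>z. q m z - p m z - (q n z - p n z)) \<le> kernel_norm (\<lambda>z. q m z - q n z) + kernel_norm (\<lambda>z. p m z - p n z)" .
    have "kernel_norm (\<lambda>z. \<sigma> z * (r m z - r n z)) \<le> c * kernel_norm (\<lambda>z. r m z - r n z)"
      by (rule c(2)[OF sqint_diff[OF r(1) r(1)]])
    then have 2: "kernel_norm (\<lambda>z. q m z - q n z) \<le> c * kernel_norm (\<lambda>z. r m z - r n z)"
      by (simp only: q_def right_diff_distrib)
    show "kernel_norm (\<lambda>z. q m z - p m z - (q n z - p n z)) \<le> c * kernel_norm (\<lambda>z. r m z - r n z) + (kernel_norm (p m) + kernel_norm (p n))"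
      using 1 2 kernel_norm_triangle_diff[OF p(1) p(1), of m n] by linarith
  qed simp
  then have "kernel_Cauchy (\<lambda>n z. \<phi> z * l n z)" unfolding eq' .
  then have "(\<lambda>n. kernel_norm (\<lambda>z. \<phi> z * l n z)) \<longlonglongrightarrow> 0"
    using cl lk l(2) unfolding kernel_closable_def by blast
  then have qp0: "(\<lambda>n. kernel_norm (\<lambda>z. q n z - p n z)) \<longlonglongrightarrow> 0" unfolding eq' .
  have "(\<lambda>n. kernel_norm (q n)) \<longlonglongrightarrow> 0"
  proof (rule real_tendsto_sandwich[OF _ _ tendsto_const])
    show "(\<lambda>n. kernel_norm (\<lambda>z. q n z - p n z) + kernel_norm (p n)) \<longlonglongrightarrow> 0"
      using tendsto_add[OF qp0 p(2)] by simp
    have "kernel_norm (q n) \<le> kernel_norm (\<lambda>z. q n z - p n z) + kernel_norm (p n)" for n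
      using kernel_norm_triangle[OF sqint_diff[OF q p(1)] p(1), of n n n] by simp
    then show "\<forall>\<^sub>F n in sequentially. kernel_norm (q n) \<le> kernel_norm (\<lambda>z. q n z - p n z) + kernel_norm (p n)" by simp
  qed (use kernel_norm_nonneg[OF q] in simp)
  then show ?thesis unfolding q_def .
qed

text \<open>Here \<open>\<sigma> r n = \<phi>2 (\<sigma> k n) + (\<phi>1 \<sigma>) k n\<close>.\<close>

lemma kernel_closable_add:
  assumes \<phi>1: "\<phi>1 \<in> borel_measurable P" "kernel_closable \<phi>1" and \<phi>2: "kernel_closable \<phi>2"
  shows "kernel_closable (\<lambda>z. \<phi>1 z + \<phi>2 z)"
  unfolding kernel_closable_def
proof (intro allI impI)
  fix k assume k: "\<forall>n. k n \<in> multiplier_kernels M N (\<lambda>z. \<phi>1 z + \<phi>2 z)"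
    and k0: "(\<lambda>n. kernel_norm (k n)) \<longlonglongrightarrow> 0" and Cau: "kernel_Cauchy (\<lambda>n z. (\<phi>1 z + \<phi>2 z) * k n z)"
  note kD = multiplier_kernelsD[OF k[rule_format]]
  show "(\<lambda>n. kernel_norm (\<lambda>z. (\<phi>1 z + \<phi>2 z) * k n z)) \<longlonglongrightarrow> 0"
  proof (rule tendsto_0_of_multipliers[OF \<phi>1 kD(2) Cau])
    fix \<sigma> assume \<sigma>: "schur_multiplier \<sigma>" and \<sigma>1: "schur_multiplier (\<lambda>z. \<phi>1 z * \<sigma> z)"
    show "(\<lambda>n. kernel_norm (\<lambda>z. \<sigma> z * ((\<phi>1 z + \<phi>2 z) * k n z))) \<longlonglongrightarrow> 0"
      by (rule kernel_closable_perturbed[OF \<phi>2 schur_multiplier_sqint[OF \<sigma> kD(1)] schur_multiplier_tendsto_0[OF \<sigma> kD(1) k0]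
            schur_multiplier_sqint[OF \<sigma>1 kD(1)] schur_multiplier_tendsto_0[OF \<sigma>1 kD(1) k0] kD(2) Cau \<sigma>])
        (simp add: algebra_simps)
  qed
qed

text \<open>Here \<open>\<sigma> r n = \<phi>2 ((\<phi>1 \<sigma>) k n)\<close>, without a perturbation.\<close>

lemma kernel_closable_mult:
  assumes \<phi>1: "\<phi>1 \<in> borel_measurable P" "kernel_closable \<phi>1" and \<phi>2: "kernel_closable \<phi>2"
  shows "kernel_closable (\<lambda>z. \<phi>1 z * \<phi>2 z)"
  unfolding kernel_closable_def
proof (intro allI impI)
  fix k assume k: "\<forall>n. k n \<in> multiplier_kernels M N (\<lambda>z. \<phi>1 z * \<phi>2 z)"
    and k0: "(\<lambda>n. kernel_norm (k n)) \<longlonglongrightarrow> 0" and Cau: "kernel_Cauchy (\<lambda>n z. \<phi>1 z * \<phi>2 z * k n z)"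
  note kD = multiplier_kernelsD[OF k[rule_format]]
  have zero: "kernel_norm (\<lambda>_. 0) = 0"
    using kernel_norm_le_norm2[OF sqint_zero] kernel_norm_nonneg[OF sqint_zero] by simp
  show "(\<lambda>n. kernel_norm (\<lambda>z. \<phi>1 z * \<phi>2 z * k n z)) \<longlonglongrightarrow> 0"
  proof (rule tendsto_0_of_multipliers[OF \<phi>1 kD(2) Cau])
    fix \<sigma> assume \<sigma>: "schur_multiplier \<sigma>" and \<sigma>1: "schur_multiplier (\<lambda>z. \<phi>1 z * \<sigma> z)"
    show "(\<lambda>n. kernel_norm (\<lambda>z. \<sigma> z * (\<phi>1 z * \<phi>2 z * k n z))) \<longlonglongrightarrow> 0"
      by (rule kernel_closable_perturbed[OF \<phi>2 schur_multiplier_sqint[OF \<sigma>1 kD(1)] schur_multiplier_tendsto_0[OF \<sigma>1 kD(1) k0]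
            sqint_zero _ kD(2) Cau \<sigma>])
        (simp_all add: zero)
  qed
qed

lemma kernel_closable_const: "kernel_closable (\<lambda>_. c)"
  unfolding kernel_closable_def
proof (intro allI impI)
  fix k assume k: "\<forall>n. k n \<in> multiplier_kernels M N (\<lambda>_. c)" and k0: "(\<lambda>n. kernel_norm (k n)) \<longlonglongrightarrow> 0"
  note kD = multiplier_kernelsD[OF k[rule_format]]
  show "(\<lambda>n. kernel_norm (\<lambda>z. c * k n z)) \<longlonglongrightarrow> 0"
  proof (rule real_tendsto_sandwich[OF _ _ tendsto_const])
    show "(\<lambda>n. cmod c * kernel_norm (k n)) \<longlonglongrightarrow> 0" using tendsto_mult_left[OF k0, of "cmod c"] by simp
    show "\<forall>\<^sub>F n in sequentially. 0 \<le> kernel_norm (\<lambda>z. c * k n z)" using kernel_norm_nonneg[OF kD(2)] by simp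
    show "\<forall>\<^sub>F n in sequentially. kernel_norm (\<lambda>z. c * k n z) \<le> cmod c * kernel_norm (k n)"
      using kernel_norm_scale_le[OF kD(1)] by simp
  qed
qed

lemma pointwise_algebra_closable_multipliers: "pointwise_algebra (closable_multipliers M N)"
  unfolding pointwise_algebra_def
proof (intro conjI ballI allI)
  have const: "(\<lambda>_. c) \<in> closable_multipliers M N" for c
    by (simp add: closable_multipliers_iff kernel_closable_const)
  have mult: "(\<lambda>z. f z * g z) \<in> closable_multipliers M N"
    if "f \<in> closable_multipliers M N" "g \<in> closable_multipliers M N" for f g
    using that kernel_closable_mult[of f g] by (auto simp: closable_multipliers_iff)
  show "(\<lambda>_. 0) \<in> closable_multipliers M N" by (rule const)
  fix f assume f: "f \<in> closable_multipliers M N"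
  show "(\<lambda>z. c * f z) \<in> closable_multipliers M N" for c by (rule mult[OF const f])
  fix g assume g: "g \<in> closable_multipliers M N"
  show "(\<lambda>z. f z * g z) \<in> closable_multipliers M N" by (rule mult[OF f g])
  show "(\<lambda>z. f z + g z) \<in> closable_multipliers M N"
    using f g kernel_closable_add[of f g] by (auto simp: closable_multipliers_iff)
qed

end

theorem theorem5p2:
  fixes M :: "'a measure" and N :: "'b measure"
  assumes "standard_sigma_finite M" and "standard_sigma_finite N"
  shows "pointwise_subalgebra (closable_multipliers M N) (measurable_functions M N)"
proof -
  interpret measure_pair M N
    using assms by (intro measure_pair.intro pair_sigma_finite.intro) (auto simp: standard_sigma_finite_def)
  have "pointwise_algebra (measurable_functions M N)"
    by (simp add: pointwise_algebra_def measurable_functions_def)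
  moreover have "closable_multipliers M N \<subseteq> measurable_functions M N"
    by (auto simp: closable_multipliers_def)
  ultimately show ?thesis
    using pointwise_algebra_closable_multipliers by (simp add: pointwise_subalgebra_def)
qed

end
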